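(* Let $A$ be a locally finite positively graded elementary algebra over a field $\Bbbk$ satisfying the standing hypotheses. For every perfect graded left $A$-module $M$, $$\lambda_A^+\bigl(\pi_A^+(q_M(1+t))\bigr)=\operatorname{pole}_1(\mathrm{Hilb}_M).$$
   Context: All algebras are associative and unital; $\Bbbk$ is an arbitrary field. A locally finite positively graded elementary algebra is a graded algebra $A=\bigoplus_{n\ge0}A_n$ with $\dim_\Bbbk A_n<\infty$ for all $n$ and $A_0=\bigoplus_{i=1}^r\Bbbk e_i$ for primitive orthogonal idempotents $e_1,\ldots,e_r$. Put $J=A_{>0}$. Modules are graded left modules; the vertex simples are $S_j=Ae_j/Je_j$. A graded module is of graded type $\mathrm{FP}_\infty$ if it has a projective resolution by finitely generated graded projectives in every homological degree, and is perfect if it has a finite resolution by finitely generated graded projectives. The matrix Hilbert series $C_A(x)\in M_r(\mathbb Z[[x]])$ has entries $C_A(x)_{ij}=\sum_{n\ge0}\dim_\Bbbk(e_iA_ne_j)x^n$. For a graded module $M$, $\mathrm{Hilb}_M(x)$ is the column vector with $i$-th entry $\sum_n\dim_\Bbbk(e_iM_n)x^n$. Standing hypotheses on $A$: every $S_j$ is of graded type $\mathrm{FP}_\infty$, and $C_A(x)\in M_r(\mathbb Q(x))$. Put $\mathcal E_A(x)=C_A(x)^{-1}\in GL_r(\mathbb Q(x))$. Put $t=x-1$, $\Lambda_A=\mathcal E_A(1+t)\,\mathbb Q[[t]]^r\subset\mathbb Q((t))^r$, and $\mathcal G_A^+=\mathbb Q[[t]]^r/(\mathbb Q[[t]]^r\cap\Lambda_A)$,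 a finite-length $\mathbb Q[[t]]$-module. Let $\pi_A^+:\mathbb Q[[t]]^r\to\mathcal G_A^+$ be the quotient map. For $\xi\in\mathcal G_A^+$ put $\lambda_A^+(\xi)=\min\{d\ge0:t^d\xi=0\}$, and for $h\in\mathbb Q((t))^r$ put $\operatorname{pole}_1(h)=\min\{d\ge0:t^dh\in\mathbb Q[[t]]^r\}$; for a vector of rational functions of $x$, $\operatorname{pole}_1$ is applied to its expansion in $t=x-1$. Euler numerator: a finitely generated graded projective $P$ decomposes as $P\cong\bigoplus_{j=1}^rAe_j\otimes_\Bbbk W_j$ with $W_j\cong e_j(P/JP)$ finite-dimensional graded; put $q_P(x)_j=\sum_m\dim_\Bbbk((W_j)_m)x^m\in\mathbb Z[x,x^{-1}]$. For $M$ perfect with finite resolution $P_\bullet$ by finitely generated graded projectives, $q_M(x)=\sum_n(-1)^nq_{P_n}(x)\in\mathbb Z[x,x^{-1}]^r$; it is independent of the resolution and satisfies $\mathrm{Hilb}_M(x)=C_A(x)q_M(x)$, so $\mathrm{Hilb}_M$ has rational entries. $q_M(1+t)$ is regarded as an element of $\mathbb Q[[t]]^r$. *)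

theory Defs
  imports
    "HOL-Algebra.AbelCoset"
    "HOL-Algebra.Generated_Groups"
    "Jordan_Normal_Form.Missing_VectorSpace"
    "Jordan_Normal_Form.Gauss_Jordan_Elimination"
    "HOL-Computational_Algebra.Computational_Algebra"
    "HOL-Library.Poly_Mapping"
begin

hide_const (open) Multiset.mult Polynomial.smult

section \<open>Graded modules\<close>

text \<open>
  The same record serves for graded modules over a ring and for graded algebras over a field.
  As usual in HOL-Algebra, the fields \<open>mult\<close> and \<open>one\<close> are meaningless for modules.
\<close>

record ('s, 'm) graded = "('s, 'm) module" +
  gr :: "int \<Rightarrow> 'm set"

definition direct_sum_decomposition :: "('s, 'm, 'z) graded_scheme \<Rightarrow> bool" where
  "direct_sum_decomposition M \<longleftrightarrow>
     (\<forall>n. additive_subgroup (gr M n) M) \<and>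
     (\<forall>x\<in>carrier M. \<exists>!f. (\<forall>n. f n \<in> gr M n) \<and> finite {n. f n \<noteq> \<zero>\<^bsub>M\<^esub>} \<and>
        x = (\<Oplus>\<^bsub>M\<^esub>n\<in>{n. f n \<noteq> \<zero>\<^bsub>M\<^esub>}. f n))"

text \<open>The locale \<^locale>\<open>Module.module\<close> of HOL-Algebra requires a commutative ring.\<close>

locale graded_left_module = ring A + M: abelian_group M
  for A :: "('k, 'a, 'y) graded_scheme" and M :: "('a, 'm, 'z) graded_scheme" +
  assumes smult_closed:
      "\<lbrakk>a \<in> carrier A; x \<in> carrier M\<rbrakk> \<Longrightarrow> a \<odot>\<^bsub>M\<^esub> x \<in> carrier M"
    and smult_l_distr:
      "\<lbrakk>a \<in> carrier A; b \<in> carrier A; x \<in> carrier M\<rbrakk> \<Longrightarrow>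
        (a \<oplus>\<^bsub>A\<^esub> b) \<odot>\<^bsub>M\<^esub> x = a \<odot>\<^bsub>M\<^esub> x \<oplus>\<^bsub>M\<^esub> b \<odot>\<^bsub>M\<^esub> x"
    and smult_r_distr:
      "\<lbrakk>a \<in> carrier A; x \<in> carrier M; y \<in> carrier M\<rbrakk> \<Longrightarrow>
        a \<odot>\<^bsub>M\<^esub> (x \<oplus>\<^bsub>M\<^esub> y) = a \<odot>\<^bsub>M\<^esub> x \<oplus>\<^bsub>M\<^esub> a \<odot>\<^bsub>M\<^esub> y"
    and smult_assoc:
      "\<lbrakk>a \<in> carrier A; b \<in> carrier A; x \<in> carrier M\<rbrakk> \<Longrightarrow>
        (a \<otimes>\<^bsub>A\<^esub> b) \<odot>\<^bsub>M\<^esub> x = a \<odot>\<^bsub>M\<^esub> (b \<odot>\<^bsub>M\<^esub> x)"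
    and smult_one:
      "x \<in> carrier M \<Longrightarrow> \<one>\<^bsub>A\<^esub> \<odot>\<^bsub>M\<^esub> x = x"
    and decomposition: "direct_sum_decomposition M"
    and smult_gr:
      "\<lbrakk>a \<in> gr A m; x \<in> gr M n\<rbrakk> \<Longrightarrow> a \<odot>\<^bsub>M\<^esub> x \<in> gr M (m + n)"

definition graded_hom ::
  "('k, 'a, 'y) graded_scheme \<Rightarrow> ('a, 'm) graded \<Rightarrow> ('a, 'n) graded \<Rightarrow> ('m \<Rightarrow> 'n) set" where
  "graded_hom A M N = {f \<in> LinearCombinations.module_hom A M N. \<forall>n. f ` gr M n \<subseteq> gr N n}"

definition finitely_generated ::
  "('k, 'a, 'y) graded_scheme \<Rightarrow> ('a, 'm) graded \<Rightarrow> bool" where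
  "finitely_generated A M \<longleftrightarrow>
     (\<exists>X. finite X \<and> X \<subseteq> carrier M \<and>
        (\<forall>m\<in>carrier M. \<exists>c\<in>X \<rightarrow> carrier A. m = (\<Oplus>\<^bsub>M\<^esub>x\<in>X. c x \<odot>\<^bsub>M\<^esub> x)))"

text \<open>
  The lifting property against graded epimorphisms \<open>N \<rightarrow> Q\<close>. HOL does not
  allow a quantification over all types carrying \<open>N\<close> and \<open>Q\<close>. The carrier types chosen
  here lose nothing: they include the epimorphism onto \<open>P\<close> itself from the graded free module
  on the nonzero homogeneous elements of \<open>P\<close> (finitely supported functions into \<open>A\<close>), and
  splitting this one epimorphism makes \<open>P\<close> a direct summand of a graded free module, whence
  the lifting property holds for modules over arbitrary types.
\<close>

definition graded_projective ::
  "('k, 'a, 'y) graded_scheme \<Rightarrow> ('a, 'm) graded \<Rightarrow> bool" where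
  "graded_projective A P \<longleftrightarrow> graded_left_module A P \<and>
     (\<forall>(N :: ('a, 'm \<Rightarrow> 'a) graded) (Q :: ('a, 'm) graded) g f.
        graded_left_module A N \<and> graded_left_module A Q \<and>
        g \<in> graded_hom A N Q \<and> g ` carrier N = carrier Q \<and> f \<in> graded_hom A P Q \<longrightarrow>
        (\<exists>h\<in>graded_hom A P N. \<forall>x\<in>carrier P. g (h x) = f x))"

text \<open>
  \<open>\<dots> \<rightarrow> P 2 \<rightarrow> P 1 \<rightarrow> P 0 \<rightarrow> M \<rightarrow> 0\<close> with \<open>d n : P (n+1) \<rightarrow> P n\<close> and augmentation
  \<open>\<epsilon> : P 0 \<rightarrow> M\<close>.
\<close>

definition fg_projective_resolution ::
  "('k, 'a, 'y) graded_scheme \<Rightarrow> ('a, 'm) graded \<Rightarrow> (nat \<Rightarrow> ('a, 'p) graded) \<Rightarrow>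
   (nat \<Rightarrow> 'p \<Rightarrow> 'p) \<Rightarrow> ('p \<Rightarrow> 'm) \<Rightarrow> bool" where
  "fg_projective_resolution A M P d \<epsilon> \<longleftrightarrow>
     (\<forall>n. graded_projective A (P n) \<and> finitely_generated A (P n)) \<and>
     (\<forall>n. d n \<in> graded_hom A (P (Suc n)) (P n)) \<and>
     \<epsilon> \<in> graded_hom A (P 0) M \<and>
     \<epsilon> ` carrier (P 0) = carrier M \<and>
     a_kernel (P 0) M \<epsilon> = d 0 ` carrier (P (Suc 0)) \<and>
     (\<forall>n. a_kernel (P (Suc n)) (P n) (d n) = d (Suc n) ` carrier (P (Suc (Suc n))))"

definition finite_fg_projective_resolution ::
  "('k, 'a, 'y) graded_scheme \<Rightarrow> ('a, 'm) graded \<Rightarrow> nat \<Rightarrow> (nat \<Rightarrow> ('a, 'p) graded) \<Rightarrow>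
   (nat \<Rightarrow> 'p \<Rightarrow> 'p) \<Rightarrow> ('p \<Rightarrow> 'm) \<Rightarrow> bool" where
  "finite_fg_projective_resolution A M L P d \<epsilon> \<longleftrightarrow>
     fg_projective_resolution A M P d \<epsilon> \<and> (\<forall>n>L. carrier (P n) = {\<zero>\<^bsub>P n\<^esub>})"

text \<open>
  Below, the terms of resolutions are carried by sets of sequences in \<open>A\<close>. This loses nothing:
  a finitely generated module is a quotient of some \<open>A\<^sup>n\<close>, so its carrier injects into
  \<^typ>\<open>nat \<Rightarrow> 'a\<close>, and the structure can be transported.
\<close>

definition graded_FP_infinity ::
  "('k, 'a, 'y) graded_scheme \<Rightarrow> ('a, 'm) graded \<Rightarrow> bool" where
  "graded_FP_infinity A M \<longleftrightarrow>
     (\<exists>(P :: nat \<Rightarrow> ('a, nat \<Rightarrow> 'a) graded) d \<epsilon>. fg_projective_resolution A M P d \<epsilon>)"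

definition perfect ::
  "('k, 'a, 'y) graded_scheme \<Rightarrow> ('a, 'm) graded \<Rightarrow> bool" where
  "perfect A M \<longleftrightarrow>
     (\<exists>L (P :: nat \<Rightarrow> ('a, nat \<Rightarrow> 'a) graded) d \<epsilon>. finite_fg_projective_resolution A M L P d \<epsilon>)"

definition quotient_module ::
  "('s, 'm, 'z) module_scheme \<Rightarrow> 'm set \<Rightarrow> ('s, 'm set) module" where
  "quotient_module M N = \<lparr>carrier = a_rcosets\<^bsub>M\<^esub> N, mult = undefined, one = undefined,
     zero = N, add = set_add M, smult = (\<lambda>a X. \<Union>x\<in>X. N +>\<^bsub>M\<^esub> (a \<odot>\<^bsub>M\<^esub> x))\<rparr>"

definition graded_quotient ::
  "('s, 'm, 'z) graded_scheme \<Rightarrow> 'm set \<Rightarrow> ('s, 'm set) graded" where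
  "graded_quotient M N = module.extend (quotient_module M N)
     (graded.fields (\<lambda>n. (\<lambda>x. N +>\<^bsub>M\<^esub> x) ` gr M n))"


section \<open>Elementary algebras\<close>

definition idempotent :: "('a, 'y) ring_scheme \<Rightarrow> 'a \<Rightarrow> bool" where
  "idempotent A e \<longleftrightarrow> e \<in> carrier A \<and> e \<otimes>\<^bsub>A\<^esub> e = e"

definition orthogonal :: "('a, 'y) ring_scheme \<Rightarrow> 'a \<Rightarrow> 'a \<Rightarrow> bool" where
  "orthogonal A e f \<longleftrightarrow> e \<otimes>\<^bsub>A\<^esub> f = \<zero>\<^bsub>A\<^esub> \<and> f \<otimes>\<^bsub>A\<^esub> e = \<zero>\<^bsub>A\<^esub>"

definition primitive_idempotent :: "('a, 'y) ring_scheme \<Rightarrow> 'a \<Rightarrow> bool" where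
  "primitive_idempotent A e \<longleftrightarrow> idempotent A e \<and> e \<noteq> \<zero>\<^bsub>A\<^esub> \<and>
     \<not> (\<exists>f g. idempotent A f \<and> idempotent A g \<and> orthogonal A f g \<and>
          f \<noteq> \<zero>\<^bsub>A\<^esub> \<and> g \<noteq> \<zero>\<^bsub>A\<^esub> \<and> e = f \<oplus>\<^bsub>A\<^esub> g)"

text \<open>The \<open>K\<close>-dimension of a subspace \<open>S\<close> of \<open>V\<close>.\<close>

definition subspace_dim :: "('k, 'b) ring_scheme \<Rightarrow> ('k, 'v, 'z) module_scheme \<Rightarrow> 'v set \<Rightarrow> nat" where
  "subspace_dim K V S = vectorspace.dim K (V\<lparr>carrier := S\<rparr>)"

text \<open>The idempotents are indexed by \<open>0, \<dots>, r - 1\<close>.\<close>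

locale elementary_algebra = vectorspace K A + alg: ring A
  for K :: "('k, 'b) ring_scheme" and A :: "('k, 'a, 'y) graded_scheme" +
  fixes r :: nat and e :: "nat \<Rightarrow> 'a"
  assumes smult_mult:
      "\<lbrakk>c \<in> carrier K; a \<in> carrier A; b \<in> carrier A\<rbrakk> \<Longrightarrow>
        (c \<odot>\<^bsub>A\<^esub> a) \<otimes>\<^bsub>A\<^esub> b = c \<odot>\<^bsub>A\<^esub> (a \<otimes>\<^bsub>A\<^esub> b)"
    and mult_smult:
      "\<lbrakk>c \<in> carrier K; a \<in> carrier A; b \<in> carrier A\<rbrakk> \<Longrightarrow>
        a \<otimes>\<^bsub>A\<^esub> (c \<odot>\<^bsub>A\<^esub> b) = c \<odot>\<^bsub>A\<^esub> (a \<otimes>\<^bsub>A\<^esub> b)"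
    and gr_subspace: "VectorSpace.subspace K (gr A n) A"
    and gr_decomposition: "direct_sum_decomposition A"
    and gr_negative: "n < 0 \<Longrightarrow> gr A n = {\<zero>\<^bsub>A\<^esub>}"
    and one_gr: "\<one>\<^bsub>A\<^esub> \<in> gr A 0"
    and mult_gr: "\<lbrakk>a \<in> gr A m; b \<in> gr A n\<rbrakk> \<Longrightarrow> a \<otimes>\<^bsub>A\<^esub> b \<in> gr A (m + n)"
    and locally_finite: "vectorspace.fin_dim K (A\<lparr>carrier := gr A n\<rparr>)"
    and e_gr: "i < r \<Longrightarrow> e i \<in> gr A 0"
    and e_primitive: "i < r \<Longrightarrow> primitive_idempotent A (e i)"
    and e_orthogonal: "\<lbrakk>i < r; j < r; i \<noteq> j\<rbrakk> \<Longrightarrow> orthogonal A (e i) (e j)"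
    and gr_0_decomposition:
      "a \<in> gr A 0 \<Longrightarrow>
        \<exists>!c. c \<in> {..<r} \<rightarrow>\<^sub>E carrier K \<and> a = (\<Oplus>\<^bsub>A\<^esub>i\<in>{..<r}. c i \<odot>\<^bsub>A\<^esub> e i)"

text \<open>\<open>J = A\<^sub>>\<^sub>0\<close>\<close>

definition positive_part :: "('k, 'a, 'y) graded_scheme \<Rightarrow> 'a set" where
  "positive_part A = generate (add_monoid A) (\<Union>n\<in>{0<..}. gr A n)"

definition positive_part_smult ::
  "('k, 'a, 'y) graded_scheme \<Rightarrow> ('a, 'm) graded \<Rightarrow> 'm set" where
  "positive_part_smult A M =
     generate (add_monoid M) {a \<odot>\<^bsub>M\<^esub> m | a m. a \<in> positive_part A \<and> m \<in> carrier M}"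

text \<open>\<open>A e\<^sub>j\<close> as a graded left module, and \<open>S\<^sub>j = A e\<^sub>j / J e\<^sub>j\<close>.\<close>

definition vertex_projective ::
  "('k, 'a, 'y) graded_scheme \<Rightarrow> (nat \<Rightarrow> 'a) \<Rightarrow> nat \<Rightarrow> ('a, 'a) graded" where
  "vertex_projective A e j =
     \<lparr>carrier = (\<lambda>a. a \<otimes>\<^bsub>A\<^esub> e j) ` carrier A, mult = undefined, one = undefined,
      zero = \<zero>\<^bsub>A\<^esub>, add = add A, smult = monoid.mult A,
      gr = (\<lambda>n. (\<lambda>a. a \<otimes>\<^bsub>A\<^esub> e j) ` gr A n)\<rparr>"

definition vertex_simple ::
  "('k, 'a, 'y) graded_scheme \<Rightarrow> (nat \<Rightarrow> 'a) \<Rightarrow> nat \<Rightarrow> ('a, 'a set) graded" where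
  "vertex_simple A e j =
     graded_quotient (vertex_projective A e j) ((\<lambda>a. a \<otimes>\<^bsub>A\<^esub> e j) ` positive_part A)"

text \<open>An \<open>A\<close>-module as a \<open>K\<close>-vector space, via \<open>c \<mapsto> c 1\<^sub>A\<close>.\<close>

definition restrict_scalars ::
  "('k, 'a, 'y) graded_scheme \<Rightarrow> ('a, 'm) graded \<Rightarrow> ('k, 'm) module" where
  "restrict_scalars A M = \<lparr>carrier = carrier M, mult = undefined, one = undefined,
     zero = \<zero>\<^bsub>M\<^esub>, add = add M, smult = (\<lambda>c m. (c \<odot>\<^bsub>A\<^esub> \<one>\<^bsub>A\<^esub>) \<odot>\<^bsub>M\<^esub> m)\<rparr>"

text \<open>\<open>dim (e\<^sub>i M\<^sub>n)\<close>\<close>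

definition vertex_dim ::
  "('k, 'b) ring_scheme \<Rightarrow> ('k, 'a, 'y) graded_scheme \<Rightarrow> (nat \<Rightarrow> 'a) \<Rightarrow> ('a, 'm) graded \<Rightarrow>
   nat \<Rightarrow> int \<Rightarrow> nat" where
  "vertex_dim K A e M i n =
     subspace_dim K (restrict_scalars A M) ((\<lambda>m. e i \<odot>\<^bsub>M\<^esub> m) ` gr M n)"


section \<open>Rational functions and their expansions\<close>

text \<open>
  \<open>\<rat>(x)\<close> is \<^typ>\<open>rat poly fract\<close> and \<open>\<rat>((t))\<close> is \<^typ>\<open>rat fls\<close>. The function below
  is the expansion of \<open>g(x)\<close> in \<open>t = x - c\<close>, obtained by substituting \<open>x = c + t\<close>.
\<close>

definition poly_at :: "rat \<Rightarrow> rat poly \<Rightarrow> rat fls" where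
  "poly_at c p = fps_to_fls (fps_of_poly (pcompose p [:c, 1:]))"

definition expansion_at :: "rat \<Rightarrow> rat poly fract \<Rightarrow> rat fls" where
  "expansion_at c g = (THE h. \<exists>p q. q \<noteq> 0 \<and> g = Fract p q \<and> h = poly_at c p / poly_at c q)"

lemma expansion_at_Fract:
  assumes "q \<noteq> 0"
  shows "expansion_at c (Fract p q) = poly_at c p / poly_at c q"
proof -
  have mult: "poly_at c (p * q) = poly_at c p * poly_at c q" for p q
    by (simp add: poly_at_def pcompose_mult fps_of_poly_mult fls_times_fps_to_fls)
  have nonzero: "poly_at c q \<noteq> 0" if "q \<noteq> 0" for q
    using that by (auto simp: poly_at_def dest: pcompose_eq_0)
  have "poly_at c p' / poly_at c q' = poly_at c p / poly_at c q"
    if "q' \<noteq> 0" "Fract p q = Fract p' q'" for p' q'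
    using that assms by (simp add: eq_fract frac_eq_eq nonzero flip: mult)
  then show ?thesis
    unfolding expansion_at_def using assms by (intro the_equality) blast+
qed

definition rat_fls_of_int :: "int fls \<Rightarrow> rat fls" where
  "rat_fls_of_int f = Abs_fls (\<lambda>n. rat_of_int (fls_nth f n))"

definition is_rational_series :: "int fls \<Rightarrow> bool" where
  "is_rational_series f \<longleftrightarrow> (\<exists>g. expansion_at 0 g = rat_fls_of_int f)"

text \<open>Only meaningful for series that are rational; \<^term>\<open>expansion_at 0\<close> is injective.\<close>

definition rational_function_of :: "int fls \<Rightarrow> rat poly fract" where
  "rational_function_of f = (THE g. expansion_at 0 g = rat_fls_of_int f)"

text \<open>\<open>\<rat>[[t]]\<^sup>r\<close> inside \<open>\<rat>((t))\<^sup>r\<close>\<close>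

definition integral_vecs :: "nat \<Rightarrow> rat fls vec set" where
  "integral_vecs r = map_vec fps_to_fls ` carrier_vec r"

definition pole_order :: "rat fls vec \<Rightarrow> nat" where
  "pole_order h = (LEAST d. fls_X ^ d \<cdot>\<^sub>v h \<in> integral_vecs (dim_vec h))"

definition pole_order_1 :: "rat poly fract vec \<Rightarrow> nat" where
  "pole_order_1 g = pole_order (map_vec (expansion_at 1) g)"


section \<open>Hilbert series\<close>

definition hilbert_matrix ::
  "('k, 'b) ring_scheme \<Rightarrow> ('k, 'a, 'y) graded_scheme \<Rightarrow> nat \<Rightarrow> (nat \<Rightarrow> 'a) \<Rightarrow> int fps mat" where
  "hilbert_matrix K A r e = mat r r (\<lambda>(i, j). Abs_fps (\<lambda>n.
     int (subspace_dim K A ((\<lambda>a. e i \<otimes>\<^bsub>A\<^esub> a \<otimes>\<^bsub>A\<^esub> e j) ` gr A (int n)))))"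

definition rational_hilbert_matrix ::
  "('k, 'b) ring_scheme \<Rightarrow> ('k, 'a, 'y) graded_scheme \<Rightarrow> nat \<Rightarrow> (nat \<Rightarrow> 'a) \<Rightarrow>
   rat poly fract mat" where
  "rational_hilbert_matrix K A r e =
     map_mat (\<lambda>f. rational_function_of (fps_to_fls f)) (hilbert_matrix K A r e)"

text \<open>\<open>\<E>\<^sub>A(x) = C\<^sub>A(x)\<^sup>-\<^sup>1\<close>; the inverse exists because \<open>C\<^sub>A(0)\<close> is the identity matrix.\<close>

definition euler_matrix ::
  "('k, 'b) ring_scheme \<Rightarrow> ('k, 'a, 'y) graded_scheme \<Rightarrow> nat \<Rightarrow> (nat \<Rightarrow> 'a) \<Rightarrow>
   rat poly fract mat" where
  "euler_matrix K A r e = the (mat_inverse (rational_hilbert_matrix K A r e))"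

definition hilbert_vec ::
  "('k, 'b) ring_scheme \<Rightarrow> ('k, 'a, 'y) graded_scheme \<Rightarrow> nat \<Rightarrow> (nat \<Rightarrow> 'a) \<Rightarrow>
   ('a, 'm) graded \<Rightarrow> int fls vec" where
  "hilbert_vec K A r e M = vec r (\<lambda>i. Abs_fls (\<lambda>n. int (vertex_dim K A e M i n)))"


section \<open>The module \<open>\<G>\<^sub>A\<^sup>+\<close>\<close>

definition euler_lattice ::
  "('k, 'b) ring_scheme \<Rightarrow> ('k, 'a, 'y) graded_scheme \<Rightarrow> nat \<Rightarrow> (nat \<Rightarrow> 'a) \<Rightarrow> rat fls vec set" where
  "euler_lattice K A r e =
     (\<lambda>v. map_mat (expansion_at 1) (euler_matrix K A r e) *\<^sub>v v) ` integral_vecs r"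

definition integral_euler_lattice ::
  "('k, 'b) ring_scheme \<Rightarrow> ('k, 'a, 'y) graded_scheme \<Rightarrow> nat \<Rightarrow> (nat \<Rightarrow> 'a) \<Rightarrow> rat fps vec set" where
  "integral_euler_lattice K A r e =
     {v \<in> carrier_vec r. map_vec fps_to_fls v \<in> euler_lattice K A r e}"

definition G_plus ::
  "('k, 'b) ring_scheme \<Rightarrow> ('k, 'a, 'y) graded_scheme \<Rightarrow> nat \<Rightarrow> (nat \<Rightarrow> 'a) \<Rightarrow>
   (rat fps, rat fps vec set) module" where
  "G_plus K A r e =
     quotient_module (module_vec TYPE(rat fps) r) (integral_euler_lattice K A r e)"

definition pi_plus ::
  "('k, 'b) ring_scheme \<Rightarrow> ('k, 'a, 'y) graded_scheme \<Rightarrow> nat \<Rightarrow> (nat \<Rightarrow> 'a) \<Rightarrow>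
   rat fps vec \<Rightarrow> rat fps vec set" where
  "pi_plus K A r e v = integral_euler_lattice K A r e +>\<^bsub>module_vec TYPE(rat fps) r\<^esub> v"

definition lambda_plus ::
  "('k, 'b) ring_scheme \<Rightarrow> ('k, 'a, 'y) graded_scheme \<Rightarrow> nat \<Rightarrow> (nat \<Rightarrow> 'a) \<Rightarrow>
   rat fps vec set \<Rightarrow> nat" where
  "lambda_plus K A r e \<xi> =
     (LEAST d. (fps_X ^ d) \<odot>\<^bsub>G_plus K A r e\<^esub> \<xi> = \<zero>\<^bsub>G_plus K A r e\<^esub>)"


section \<open>Euler numerators\<close>

text \<open>
  Laurent polynomials in \<open>\<int>[x, x\<^sup>-\<^sup>1]\<close> are the group ring \<^typ>\<open>int \<Rightarrow>\<^sub>0 int\<close>. The coefficients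
  of \<open>q\<^sub>P(x)\<^sub>j\<close> are the dimensions of the homogeneous components of \<open>e\<^sub>j (P / J P)\<close>.
\<close>

definition projective_numerator ::
  "('k, 'b) ring_scheme \<Rightarrow> ('k, 'a, 'y) graded_scheme \<Rightarrow> nat \<Rightarrow> (nat \<Rightarrow> 'a) \<Rightarrow>
   ('a, 'p) graded \<Rightarrow> (int \<Rightarrow>\<^sub>0 int) vec" where
  "projective_numerator K A r e P = vec r (\<lambda>j. Abs_poly_mapping (\<lambda>m.
     int (vertex_dim K A e (graded_quotient P (positive_part_smult A P)) j m)))"

text \<open>The definite description expresses the independence of the resolution.\<close>

definition euler_numerator ::
  "('k, 'b) ring_scheme \<Rightarrow> ('k, 'a, 'y) graded_scheme \<Rightarrow> nat \<Rightarrow> (nat \<Rightarrow> 'a) \<Rightarrow>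
   ('a, 'm) graded \<Rightarrow> (int \<Rightarrow>\<^sub>0 int) vec" where
  "euler_numerator K A r e M = (THE q.
     \<exists>L (P :: nat \<Rightarrow> ('a, nat \<Rightarrow> 'a) graded) d \<epsilon>. finite_fg_projective_resolution A M L P d \<epsilon> \<and>
       q = vec r (\<lambda>j. \<Sum>n\<le>L. (- 1) ^ n * projective_numerator K A r e (P n) $ j))"

text \<open>The substitution \<open>x = 1 + t\<close>; note that \<open>1 + t\<close> is a unit of \<open>\<rat>[[t]]\<close>.\<close>

definition laurent_at_1_plus_t :: "(int \<Rightarrow>\<^sub>0 int) \<Rightarrow> rat fps" where
  "laurent_at_1_plus_t p =
     (\<Sum>m\<in>Poly_Mapping.keys p. of_int (Poly_Mapping.lookup p m) * (1 + fps_X) powi m)"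

end

theory Submission
  imports Defs "Jordan_Normal_Form.Determinant"
begin

text \<open>
  Why the theorem holds. Write \<open>C = C\<^sub>A(1 + t)\<close> and \<open>q = q\<^sub>M(1 + t)\<close>. A vector \<open>t\<^sup>d q\<close> with
  integral entries lies in the lattice \<open>\<Lambda>\<^sub>A = C\<^sup>-\<^sup>1 \<rat>[[t]]\<^sup>r\<close> iff \<open>t\<^sup>d C q\<close> is integral, and
  \<open>C q\<close> is the expansion of \<open>Hilb\<^sub>M\<close> at \<open>x = 1\<close>. So for every \<open>d\<close> the condition \<open>t\<^sup>d \<pi>(q) = 0\<close>
  defining \<open>\<lambda>\<^sup>+\<close> and the condition defining the pole order of \<open>Hilb\<^sub>M\<close> are the same, and so are their
  least solutions. All the work is in the identity \<open>Hilb\<^sub>M = C\<^sub>A q\<^sub>M\<close>, together with the facts that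
  give \<open>C\<^sub>A\<^sup>-\<^sup>1\<close> and \<open>q\<^sub>M\<close> a meaning.

  For one finitely generated graded projective \<open>P\<close> the identity is a structure theorem,
  \<open>graded_projective_structure\<close>. Choose a homogeneous generating set \<open>X\<close> of \<open>P\<close>, each \<open>x\<close> in some
  \<open>e\<^sub>v P\<^sub>n\<close>, of least cardinality, and map \<open>F = \<Oplus>\<^sub>x A e\<^sub>v(-n)\<close> onto \<open>P\<close>. By minimality, a
  homogeneous relation between the generators has no nonzero coefficient of degree zero
  (\<open>relation_coefficient\<close>). Projectivity
  splits \<open>F \<rightarrow> P\<close>; the complement of the image of the splitting consists of relations, and an
  induction on the degree shows that it vanishes (\<open>cover_injective_homogeneous\<close>). Hence
  \<open>F \<cong> P\<close>, which gives the dimensions of the \<open>e\<^sub>i P\<^sub>n\<close> as sums of entries of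
  \<open>C\<^sub>A\<close>. Under this isomorphism \<open>J P\<close> corresponds to the elements of \<open>F\<close> with coefficients in \<open>J\<close>,
  so that \<open>e\<^sub>j (P / J P)\<^sub>m\<close> has dimension the number of generators of vertex \<open>j\<close> and degree \<open>m\<close>
  (\<open>vertex_dim_top\<close>). The only dimension formula used is rank-nullity, applied to a linear map on a
  subspace (\<open>rank_nullity_subspace\<close>).

  A finite resolution of \<open>M\<close> is exact in each \<open>e\<^sub>i (-)\<^sub>n\<close>, so dimensions alternate
  (\<open>euler_characteristic\<close>) and \<open>Hilb\<^sub>M = C\<^sub>A q\<close> holds for the numerator \<open>q\<close> of any resolution
  (\<open>perfect_hilbert_series\<close>). The constant term of \<open>C\<^sub>A\<close> is the identity matrix, because
  \<open>A\<^sub>0 = \<Oplus>\<^sub>i K e\<^sub>i\<close>; so \<open>C\<^sub>A\<close> is invertible (\<open>rational_matrix_inverse\<close>). Therefore \<open>q\<close> is determined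
  by \<open>Hilb\<^sub>M\<close>, that is, independent of the resolution (\<open>euler_numerator_eq\<close>).
  Expansion at \<open>0\<close> and at \<open>1\<close> are
  field homomorphisms on \<open>\<rat>(x)\<close>; the first is used to recognise the entries of \<open>Hilb\<^sub>M\<close> as rational
  functions, the second carries the identity to \<open>\<rat>((t))\<close>.
\<close>

(* In this file mult and smult are the fields of the algebraic records. *)
hide_const (open) Multiset.mult Polynomial.smult

section \<open>Dimensions of subspaces\<close>

lemma (in vectorspace) subspaceI:
  assumes "S \<subseteq> carrier V" "\<zero>\<^bsub>V\<^esub> \<in> S"
    "\<And>x y. x \<in> S \<Longrightarrow> y \<in> S \<Longrightarrow> x \<oplus>\<^bsub>V\<^esub> y \<in> S"
    "\<And>c x. c \<in> carrier K \<Longrightarrow> x \<in> S \<Longrightarrow> c \<odot>\<^bsub>V\<^esub> x \<in> S"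
  shows "VectorSpace.subspace K S V"
  using assms vectorspace_axioms module_axioms
  by (auto simp: VectorSpace.subspace_def submodule_def)

lemma subspaceD:
  assumes "VectorSpace.subspace K S V"
  shows "S \<subseteq> carrier V" "\<zero>\<^bsub>V\<^esub> \<in> S"
    "\<And>x y. x \<in> S \<Longrightarrow> y \<in> S \<Longrightarrow> x \<oplus>\<^bsub>V\<^esub> y \<in> S"
    "\<And>c x. c \<in> carrier K \<Longrightarrow> x \<in> S \<Longrightarrow> c \<odot>\<^bsub>V\<^esub> x \<in> S"
  using assms by (auto simp: VectorSpace.subspace_def submodule_def)

text \<open>
  Lift a finite generating set of the image; together with generators of the kernel it generates,
  since a vector differs from some combination of the lifts by an element of the kernel.
\<close>

lemma (in linear_map) fin_dim_extension:
  assumes ker: "vectorspace.fin_dim K (V.vs kerT)"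
    and surj: "T ` carrier V = carrier W" and W: "W.fin_dim"
  shows "V.fin_dim"
proof -
  have kerS: "kerT \<subseteq> carrier V" and kerSub: "submodule K kerT V"
    using kerT_is_subspace by (auto simp: VectorSpace.subspace_def submodule_def)
  obtain B where B: "finite B" "B \<subseteq> kerT" "LinearCombinations.module.span K (V.vs kerT) B = kerT"
    using ker unfolding vectorspace.fin_dim_def[OF V.subspace_is_vs[OF kerT_is_subspace]] by auto
  have B': "V.module.span B = kerT"
    using V.module.span_li_not_depend(1)[OF B(2) kerSub] B(3) by simp
  obtain C where C: "finite C" "C \<subseteq> carrier W" "W.module.span C = carrier W"
    using W unfolding W.fin_dim_def by auto
  define s where "s w = (SOME v. v \<in> carrier V \<and> T v = w)" for w
  have s: "s w \<in> carrier V \<and> T (s w) = w" if "w \<in> carrier W" for w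
  proof -
    have "\<exists>v. v \<in> carrier V \<and> T v = w" using that surj by (metis (no_types, lifting) imageE)
    then show ?thesis unfolding s_def by (rule someI_ex)
  qed
  have sC: "finite (s ` C)" "s ` C \<subseteq> carrier V" using C s by auto
  have BC: "finite (B \<union> s ` C)" "B \<union> s ` C \<subseteq> carrier V"
    using B sC kerS by auto
  have "carrier V \<subseteq> V.module.span (B \<union> s ` C)"
  proof
    fix v assume v: "v \<in> carrier V"
    let ?I = "T ` V.module.span (s ` C)"
    have sub: "submodule K ?I W"
    proof -
      have U: "submodule K (V.module.span (s ` C)) V" using V.module.span_is_submodule[OF sC(2)] .
      note Ud = submodule.subset[OF U] submodule.m_closed[OF U] submodule.zero_closed[OF U]
        submodule.smult_closed[OF U]
      show ?thesis
      proof (unfold submodule_def, intro conjI allI impI)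
        show "Module.module K W" by (rule vectorspace.axioms(1)[OF W.vectorspace_axioms])
        show "?I \<subseteq> carrier W" using Ud(1) by auto
        show "\<zero>\<^bsub>W\<^esub> \<in> ?I" using Ud(3) by (metis T0_is_0 imageI)
        fix x y assume "x \<in> ?I" "y \<in> ?I"
        then obtain a b where ab: "a \<in> V.module.span (s ` C)" "x = T a"
          "b \<in> V.module.span (s ` C)" "y = T b" by blast
        then have "x \<oplus>\<^bsub>W\<^esub> y = T (a \<oplus>\<^bsub>V\<^esub> b)" using Ud(1) by (simp add: subsetD)
        then show "x \<oplus>\<^bsub>W\<^esub> y \<in> ?I" using Ud(2) ab by blast
      next
        fix c x assume c: "c \<in> carrier K" and "x \<in> ?I"
        then obtain a where a: "a \<in> V.module.span (s ` C)" "x = T a" by blast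
        then have "c \<odot>\<^bsub>W\<^esub> x = T (c \<odot>\<^bsub>V\<^esub> a)" using Ud(1) c by (simp add: subsetD)
        then show "c \<odot>\<^bsub>W\<^esub> x \<in> ?I" using Ud(4) a c by blast
      qed
    qed
    have "C \<subseteq> ?I"
    proof
      fix w assume w: "w \<in> C"
      then have "s w \<in> V.module.span (s ` C)" using V.module.in_own_span[OF sC(2)] by auto
      then show "w \<in> ?I" using s[of w] w C(2) by force
    qed
    then have "W.module.span C \<subseteq> ?I" by (rule W.module.span_is_subset[OF _ sub])
    moreover have "T v \<in> carrier W" using v by simp
    ultimately obtain u where u: "u \<in> V.module.span (s ` C)" "T v = T u" using C(3) by auto
    have uV: "u \<in> carrier V" using u(1) sC V.span_closed by auto
    have k: "v \<ominus>\<^bsub>V\<^esub> u \<in> kerT" using v uV u(2) by (simp add: ker_def)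
    have "v \<ominus>\<^bsub>V\<^esub> u \<in> V.module.span (B \<union> s ` C)" "u \<in> V.module.span (B \<union> s ` C)"
      using k u(1) B' V.module.span_is_monotone[of B "B \<union> s ` C"] V.module.span_is_monotone[of "s ` C" "B \<union> s ` C"] by auto
    then have "(v \<ominus>\<^bsub>V\<^esub> u) \<oplus>\<^bsub>V\<^esub> u \<in> V.module.span (B \<union> s ` C)"
      using V.module.span_is_submodule[OF BC(2)] by (rule_tac submodule.m_closed)
    then show "v \<in> V.module.span (B \<union> s ` C)" using v uV
      by (simp add: V.module.M.minus_eq V.module.M.a_assoc V.module.M.l_neg)
  qed
  moreover have "V.module.span (B \<union> s ` C) \<subseteq> carrier V" by (rule V.module.span_is_subset2[OF BC(2)])
  ultimately show ?thesis unfolding V.fin_dim_def using BC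
    by (intro exI[of _ "B \<union> s ` C"]) auto
qed

text \<open>
  The dimension of a vector space is a least cardinality of a finite generating set, so a value of
  \<^const>\<open>subspace_dim\<close> carries information only for the subspaces singled out here.
\<close>

definition fin_dim_subspace where
  "fin_dim_subspace K V S \<longleftrightarrow> vectorspace K V \<and> VectorSpace.subspace K S V \<and>
     vectorspace.fin_dim K (V\<lparr>carrier := S\<rparr>)"

text \<open>
  Stated for a map that is linear only on the subspace \<open>S\<close>, because the homogeneous pieces of
  a module are handled as subsets of the whole module. The last clause
  gives finite dimension without a basis, by climbing from the kernel and the image.
\<close>

lemma rank_nullity_subspace:
  assumes V: "vectorspace K V" and W: "vectorspace K W"
    and S: "VectorSpace.subspace K S V"
    and im: "f ` S = T" "T \<subseteq> carrier W"
    and add: "\<And>x y. x \<in> S \<Longrightarrow> y \<in> S \<Longrightarrow> f (x \<oplus>\<^bsub>V\<^esub> y) = f x \<oplus>\<^bsub>W\<^esub> f y"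
    and smult: "\<And>c x. c \<in> carrier K \<Longrightarrow> x \<in> S \<Longrightarrow> f (c \<odot>\<^bsub>V\<^esub> x) = c \<odot>\<^bsub>W\<^esub> f x"
  defines "N \<equiv> {x \<in> S. f x = \<zero>\<^bsub>W\<^esub>}"
  shows "VectorSpace.subspace K T W" "VectorSpace.subspace K N V"
    and "fin_dim_subspace K V S \<Longrightarrow> fin_dim_subspace K W T"
    and "fin_dim_subspace K V S \<Longrightarrow> subspace_dim K V S = subspace_dim K W T + subspace_dim K V N"
    and "fin_dim_subspace K V N \<Longrightarrow> fin_dim_subspace K W T \<Longrightarrow> fin_dim_subspace K V S"
proof -
  interpret V: vectorspace K V by fact
  interpret W: vectorspace K W by fact
  note Sd = subspaceD[OF S]
  have z: "f \<zero>\<^bsub>V\<^esub> = \<zero>\<^bsub>W\<^esub>"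
  proof -
    have "f \<zero>\<^bsub>V\<^esub> \<in> carrier W" using im Sd by auto
    moreover have "f \<zero>\<^bsub>V\<^esub> = f \<zero>\<^bsub>V\<^esub> \<oplus>\<^bsub>W\<^esub> f \<zero>\<^bsub>V\<^esub>" using add[of "\<zero>\<^bsub>V\<^esub>" "\<zero>\<^bsub>V\<^esub>"] Sd(2) by simp
    ultimately show ?thesis by (metis W.module.M.add.r_cancel_one')
  qed
  have fW: "f x \<in> carrier W" if "x \<in> S" for x using that im by auto
  show T: "VectorSpace.subspace K T W"
  proof (rule W.subspaceI)
    show "T \<subseteq> carrier W" by fact
    show "\<zero>\<^bsub>W\<^esub> \<in> T" using z Sd(2) im(1) by force
    show "x \<oplus>\<^bsub>W\<^esub> y \<in> T" if "x \<in> T" "y \<in> T" for x y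
      using that Sd(3) add im(1) by (metis (no_types, lifting) imageE imageI)
    show "c \<odot>\<^bsub>W\<^esub> x \<in> T" if "c \<in> carrier K" "x \<in> T" for c x
      using that Sd(4) smult im(1) by (metis (no_types, lifting) imageE imageI)
  qed
  show N: "VectorSpace.subspace K N V"
    by (rule V.subspaceI) (use Sd z add smult in \<open>auto simp: N_def\<close>)
  have VS: "vectorspace K (V\<lparr>carrier := S\<rparr>)" by (rule V.subspace_is_vs[OF S])
  have WT: "vectorspace K (W\<lparr>carrier := T\<rparr>)" by (rule W.subspace_is_vs[OF T])
  interpret f: linear_map K "V\<lparr>carrier := S\<rparr>" "W\<lparr>carrier := T\<rparr>" f
    unfolding linear_map_def mod_hom_def mod_hom_axioms_def LinearCombinations.module_hom_def
    using VS WT vectorspace.axioms(1)[OF VS] vectorspace.axioms(1)[OF WT] im(1) add smult by auto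
  have ker: "f.kerT = N" by (auto simp: f.ker_def N_def)
  show "fin_dim_subspace K W T" if "fin_dim_subspace K V S"
    using that T W f.rank_nullity_main(2) im(1) by (auto simp: fin_dim_subspace_def)
  show "subspace_dim K V S = subspace_dim K W T + subspace_dim K V N" if "fin_dim_subspace K V S"
    using that f.rank_nullity im(1) unfolding fin_dim_subspace_def subspace_dim_def ker
    by (simp add: f.im_def)
  show "fin_dim_subspace K V S" if "fin_dim_subspace K V N" "fin_dim_subspace K W T"
    using that f.fin_dim_extension im(1) V S unfolding fin_dim_subspace_def ker by simp
qed

lemma subspace_dim_zero:
  assumes "vectorspace K V"
  shows "subspace_dim K V {\<zero>\<^bsub>V\<^esub>} = 0" "fin_dim_subspace K V {\<zero>\<^bsub>V\<^esub>}"
proof -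
  interpret V: vectorspace K V by fact
  have S: "VectorSpace.subspace K {\<zero>\<^bsub>V\<^esub>} V" by (rule V.subspaceI) auto
  interpret S: vectorspace K "V\<lparr>carrier := {\<zero>\<^bsub>V\<^esub>}\<rparr>" by (rule V.subspace_is_vs[OF S])
  have g: "S.gen_set {}" by (auto simp: S.span_empty)
  then show "subspace_dim K V {\<zero>\<^bsub>V\<^esub>} = 0"
    unfolding subspace_dim_def using S.gen_ge_dim[OF _ _ g] by simp
  show "fin_dim_subspace K V {\<zero>\<^bsub>V\<^esub>}"
    unfolding fin_dim_subspace_def S.fin_dim_def using g assms S by auto
qed

section \<open>Homogeneous components\<close>

lemma additive_finsum:
  assumes M: "abelian_monoid M" and N: "abelian_group N"
    and f: "f \<in> carrier M \<rightarrow> carrier N"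
    and add: "\<And>x y. x \<in> carrier M \<Longrightarrow> y \<in> carrier M \<Longrightarrow> f (x \<oplus>\<^bsub>M\<^esub> y) = f x \<oplus>\<^bsub>N\<^esub> f y"
    and g: "g \<in> S \<rightarrow> carrier M"
  shows "f (\<Oplus>\<^bsub>M\<^esub>i\<in>S. g i) = (\<Oplus>\<^bsub>N\<^esub>i\<in>S. f (g i))"
proof -
  interpret M: abelian_monoid M by fact
  interpret N: abelian_group N by fact
  have z: "f \<zero>\<^bsub>M\<^esub> = \<zero>\<^bsub>N\<^esub>"
    using add[of "\<zero>\<^bsub>M\<^esub>" "\<zero>\<^bsub>M\<^esub>"] f by (metis M.zero_closed M.l_zero PiE N.add.r_cancel_one')
  show ?thesis using g
  proof (induction S rule: infinite_finite_induct)
    case (insert a S)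
    then show ?case using f by (simp add: add Pi_iff)
  qed (use z in auto)
qed

lemma additive_subgroup_finsum:
  assumes H: "additive_subgroup H G" and G: "abelian_group G" and f: "f \<in> S \<rightarrow> H"
  shows "finsum G f S \<in> H"
proof -
  interpret G: abelian_group G by fact
  interpret H: additive_subgroup H G by fact
  show ?thesis using f
  proof (induction S rule: infinite_finite_induct)
    case (insert x F)
    then show ?case using H.a_subset by (subst G.finsum_insert) auto
  qed auto
qed

text \<open>
  Additive component functions give uniqueness of decompositions: applying the \<open>n\<close>-th one to any
  decomposition of \<open>x\<close> returns its \<open>n\<close>-th summand.
\<close>

lemma direct_sum_decompositionI:
  assumes M: "abelian_group M"
    and gr: "\<And>n. additive_subgroup (gr M n) M"
    and c_gr: "\<And>x n. x \<in> carrier M \<Longrightarrow> c x n \<in> gr M n"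
    and c_finite: "\<And>x. x \<in> carrier M \<Longrightarrow> finite {n. c x n \<noteq> \<zero>\<^bsub>M\<^esub>}"
    and c_sum: "\<And>x. x \<in> carrier M \<Longrightarrow> x = (\<Oplus>\<^bsub>M\<^esub>n\<in>{n. c x n \<noteq> \<zero>\<^bsub>M\<^esub>}. c x n)"
    and c_add: "\<And>x y n. x \<in> carrier M \<Longrightarrow> y \<in> carrier M \<Longrightarrow> c (x \<oplus>\<^bsub>M\<^esub> y) n = c x n \<oplus>\<^bsub>M\<^esub> c y n"
    and c_homogeneous: "\<And>x m n. x \<in> gr M m \<Longrightarrow> c x n = (if n = m then x else \<zero>\<^bsub>M\<^esub>)"
  shows "direct_sum_decomposition M"
  unfolding direct_sum_decomposition_def
proof (intro conjI allI ballI gr)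
  interpret abelian_group M by fact
  have gr_carrier: "x \<in> carrier M" if "x \<in> gr M n" for x n
    using additive_subgroup.a_subset[OF gr] that by auto
  fix x assume x: "x \<in> carrier M"
  show "\<exists>!f. (\<forall>n. f n \<in> gr M n) \<and> finite {n. f n \<noteq> \<zero>\<^bsub>M\<^esub>} \<and>
      x = (\<Oplus>\<^bsub>M\<^esub>n\<in>{n. f n \<noteq> \<zero>\<^bsub>M\<^esub>}. f n)"
  proof (rule ex1I[of _ "c x"])
    show "(\<forall>n. c x n \<in> gr M n) \<and> finite {n. c x n \<noteq> \<zero>\<^bsub>M\<^esub>} \<and>
      x = (\<Oplus>\<^bsub>M\<^esub>n\<in>{n. c x n \<noteq> \<zero>\<^bsub>M\<^esub>}. c x n)"
      using x c_gr c_finite c_sum by blast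
    fix f assume f: "(\<forall>n. f n \<in> gr M n) \<and> finite {n. f n \<noteq> \<zero>\<^bsub>M\<^esub>} \<and>
      x = (\<Oplus>\<^bsub>M\<^esub>n\<in>{n. f n \<noteq> \<zero>\<^bsub>M\<^esub>}. f n)"
    let ?S = "{n. f n \<noteq> \<zero>\<^bsub>M\<^esub>}"
    have fn: "f m \<in> carrier M" for m using f gr_carrier[of "f m" m] by blast
    then have fc: "f \<in> T \<rightarrow> carrier M" for T by auto
    show "f = c x"
    proof
      fix n
      have "c x n = c (\<Oplus>\<^bsub>M\<^esub>m\<in>?S. f m) n" using f by simp
      also have "\<dots> = (\<Oplus>\<^bsub>M\<^esub>m\<in>?S. c (f m) n)"
        by (rule additive_finsum[of M M "\<lambda>x. c x n"])
          (use c_add gr_carrier[OF c_gr] fc M abelian_monoid_axioms in auto)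
      also have "\<dots> = (\<Oplus>\<^bsub>M\<^esub>m\<in>?S. if n = m then f m else \<zero>\<^bsub>M\<^esub>)"
        by (rule finsum_cong') (use f c_homogeneous fn in auto)
      also have "\<dots> = f n"
      proof (cases "n \<in> ?S")
        case True
        then show ?thesis using finsum_singleton[OF True _ fc] f by simp
      next
        case False
        then have "(\<Oplus>\<^bsub>M\<^esub>m\<in>?S. if n = m then f m else \<zero>\<^bsub>M\<^esub>) = (\<Oplus>\<^bsub>M\<^esub>m\<in>?S. \<zero>\<^bsub>M\<^esub>)"
          by (intro finsum_cong') auto
        then show ?thesis using False by simp
      qed
      finally show "f n = c x n" by simp
    qed
  qed
qed

definition homogeneous_component ::
  "('s, 'm, 'z) graded_scheme \<Rightarrow> 'm \<Rightarrow> int \<Rightarrow> 'm" where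
  "homogeneous_component M x = (THE f. (\<forall>n. f n \<in> gr M n) \<and> finite {n. f n \<noteq> \<zero>\<^bsub>M\<^esub>} \<and>
        x = (\<Oplus>\<^bsub>M\<^esub>n\<in>{n. f n \<noteq> \<zero>\<^bsub>M\<^esub>}. f n))"

locale graded_abelian_group = abelian_group M
  for M :: "('s, 'm, 'z) graded_scheme" (structure) +
  assumes direct_sum: "direct_sum_decomposition M"
begin

abbreviation cmp where "cmp \<equiv> homogeneous_component M"

lemma gr_subgroup: "additive_subgroup (gr M n) M"
  using direct_sum by (simp add: direct_sum_decomposition_def)

lemma gr_closed: "x \<in> gr M n \<Longrightarrow> x \<in> carrier M"
  using additive_subgroup.a_subset[OF gr_subgroup] by auto

lemma zero_gr: "\<zero> \<in> gr M n"
  using additive_subgroup.zero_closed[OF gr_subgroup] .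

lemma add_gr: "x \<in> gr M n \<Longrightarrow> y \<in> gr M n \<Longrightarrow> x \<oplus> y \<in> gr M n"
  using additive_subgroup.a_closed[OF gr_subgroup] .

lemma minus_gr: "x \<in> gr M n \<Longrightarrow> y \<in> gr M n \<Longrightarrow> x \<ominus> y \<in> gr M n"
  using additive_subgroup.a_inv_closed[OF gr_subgroup] by (simp add: minus_eq add_gr)

lemma finsum_gr: "f \<in> S \<rightarrow> gr M n \<Longrightarrow> finsum M f S \<in> gr M n"
proof (induction S rule: infinite_finite_induct)
  case (insert x F)
  then show ?case by (subst finsum_insert) (auto intro: add_gr gr_closed)
qed (auto simp: zero_gr)

lemma component_spec:
  assumes "x \<in> carrier M"
  shows "(\<forall>n. cmp x n \<in> gr M n) \<and> finite {n. cmp x n \<noteq> \<zero>} \<and> x = (\<Oplus>n\<in>{n. cmp x n \<noteq> \<zero>}. cmp x n)"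
  using theI'[OF direct_sum[unfolded direct_sum_decomposition_def, THEN conjunct2, rule_format, OF assms]]
  unfolding homogeneous_component_def .

lemma component_gr: "x \<in> carrier M \<Longrightarrow> cmp x n \<in> gr M n"
  and component_finite: "x \<in> carrier M \<Longrightarrow> finite {n. cmp x n \<noteq> \<zero>}"
  and component_sum: "x \<in> carrier M \<Longrightarrow> (\<Oplus>n\<in>{n. cmp x n \<noteq> \<zero>}. cmp x n) = x"
  using component_spec[of x] by auto

lemma component_closed: "x \<in> carrier M \<Longrightarrow> cmp x n \<in> carrier M"
  using component_gr gr_closed by blast

lemma component_unique:
  assumes S: "finite S" and g: "\<And>n. n \<in> S \<Longrightarrow> g n \<in> gr M n"
  shows "cmp (\<Oplus>n\<in>S. g n) n = (if n \<in> S then g n else \<zero>)"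
proof -
  let ?x = "\<Oplus>n\<in>S. g n"
  have gc: "g \<in> S \<rightarrow> carrier M" using g gr_closed by auto
  define f where "f n = (if n \<in> S then g n else \<zero>)" for n
  have fgr: "\<forall>n. f n \<in> gr M n" using g zero_gr by (auto simp: f_def)
  have ff: "finite {n. f n \<noteq> \<zero>}" by (rule finite_subset[OF _ S]) (auto simp: f_def)
  have fs: "?x = (\<Oplus>n\<in>{n. f n \<noteq> \<zero>}. f n)"
    by (rule add.finprod_mono_neutral_cong_right[OF S]) (use gc in \<open>auto simp: f_def\<close>)
  have xc: "?x \<in> carrier M" using gc by (rule finsum_closed)
  have "cmp ?x = f"
    using direct_sum[unfolded direct_sum_decomposition_def, THEN conjunct2, rule_format, OF xc]
      component_spec[OF xc] fgr ff fs by blast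
  then show ?thesis by (simp add: f_def)
qed

lemma component_sum_superset:
  assumes x: "x \<in> carrier M" and S: "finite S" "{n. cmp x n \<noteq> \<zero>} \<subseteq> S"
  shows "(\<Oplus>n\<in>S. cmp x n) = x"
proof -
  have "(\<Oplus>n\<in>S. cmp x n) = (\<Oplus>n\<in>{n. cmp x n \<noteq> \<zero>}. cmp x n)"
    by (rule add.finprod_mono_neutral_cong_right[OF S]) (use component_closed[OF x] in auto)
  then show ?thesis using component_sum[OF x] by simp
qed

lemma component_homogeneous:
  assumes "x \<in> gr M m"
  shows "cmp x n = (if n = m then x else \<zero>)"
  using component_unique[of "{m}" "\<lambda>_. x" n] assms gr_closed by simp

lemma component_add:
  assumes x: "x \<in> carrier M" and y: "y \<in> carrier M"
  shows "cmp (x \<oplus> y) n = cmp x n \<oplus> cmp y n"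
proof -
  let ?S = "{n. cmp x n \<noteq> \<zero>} \<union> {n. cmp y n \<noteq> \<zero>}"
  have S: "finite ?S" using component_finite x y by blast
  have "x \<oplus> y = (\<Oplus>n\<in>?S. cmp x n \<oplus> cmp y n)"
    using component_sum_superset[OF x S] component_sum_superset[OF y S] component_closed x y
    by (subst finsum_addf) auto
  then have "cmp (x \<oplus> y) n = (if n \<in> ?S then cmp x n \<oplus> cmp y n else \<zero>)"
    using component_unique[OF S, of "\<lambda>n. cmp x n \<oplus> cmp y n" n] component_gr x y add_gr by simp
  then show ?thesis by auto
qed

end

text \<open>
  The image of the decomposition of \<open>x\<close> is a decomposition of \<open>f x\<close>; here \<open>k\<close> is the degree
  of the map \<open>f\<close>.
\<close>

lemma component_additive_map:
  assumes M: "graded_abelian_group M" and N: "graded_abelian_group N"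
    and f: "f \<in> carrier M \<rightarrow> carrier N"
    and add: "\<And>x y. x \<in> carrier M \<Longrightarrow> y \<in> carrier M \<Longrightarrow> f (x \<oplus>\<^bsub>M\<^esub> y) = f x \<oplus>\<^bsub>N\<^esub> f y"
    and gr: "\<And>n x. x \<in> gr M n \<Longrightarrow> f x \<in> gr N (n + k)"
    and x: "x \<in> carrier M"
  shows "homogeneous_component N (f x) (n + k) = f (homogeneous_component M x n)"
proof -
  interpret M: graded_abelian_group M by fact
  interpret N: graded_abelian_group N by fact
  have z: "f \<zero>\<^bsub>M\<^esub> = \<zero>\<^bsub>N\<^esub>"
    using add[of "\<zero>\<^bsub>M\<^esub>" "\<zero>\<^bsub>M\<^esub>"] f by (metis M.zero_closed M.l_zero PiE N.add.r_cancel_one')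
  let ?S = "{n. M.cmp x n \<noteq> \<zero>\<^bsub>M\<^esub>}"
  have S: "finite ?S" using M.component_finite[OF x] .
  have "f x = f (\<Oplus>\<^bsub>M\<^esub>m\<in>?S. M.cmp x m)" using M.component_sum[OF x] by simp
  also have "\<dots> = (\<Oplus>\<^bsub>N\<^esub>m\<in>?S. f (M.cmp x m))"
    by (rule additive_finsum) (use add f M.component_closed[OF x] M.abelian_monoid_axioms N.abelian_group_axioms in auto)
  also have "\<dots> = (\<Oplus>\<^bsub>N\<^esub>m\<in>(\<lambda>m. m + k) ` ?S. f (M.cmp x (m - k)))"
    using f M.component_closed[OF x] by (subst N.finsum_reindex) (auto simp: inj_on_def)
  finally have fx: "f x = (\<Oplus>\<^bsub>N\<^esub>m\<in>(\<lambda>m. m + k) ` ?S. f (M.cmp x (m - k)))" .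
  have "f (M.cmp x (m - k)) \<in> gr N m" for m
    using gr[OF M.component_gr[OF x, of "m - k"]] by simp
  then have "N.cmp (f x) (n + k) =
      (if n + k \<in> (\<lambda>m. m + k) ` ?S then f (M.cmp x (n + k - k)) else \<zero>\<^bsub>N\<^esub>)"
    unfolding fx using S by (intro N.component_unique) auto
  then show ?thesis using z by (auto simp: image_iff)
qed

section \<open>Modules over an elementary algebra\<close>

text \<open>
  The module axioms without a grading, which is all that a vector space structure over the ground
  field requires. They suffice for the quotient \<open>P / J P\<close>, where only dimensions of subspaces matter.
\<close>

locale left_module = ring A + M: abelian_group M
  for A :: "('k, 'a, 'y) graded_scheme" and M :: "('a, 'm, 'z) graded_scheme" +
  assumes smult_closed:
      "\<lbrakk>a \<in> carrier A; x \<in> carrier M\<rbrakk> \<Longrightarrow> a \<odot>\<^bsub>M\<^esub> x \<in> carrier M"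
    and smult_l_distr:
      "\<lbrakk>a \<in> carrier A; b \<in> carrier A; x \<in> carrier M\<rbrakk> \<Longrightarrow>
        (a \<oplus>\<^bsub>A\<^esub> b) \<odot>\<^bsub>M\<^esub> x = a \<odot>\<^bsub>M\<^esub> x \<oplus>\<^bsub>M\<^esub> b \<odot>\<^bsub>M\<^esub> x"
    and smult_r_distr:
      "\<lbrakk>a \<in> carrier A; x \<in> carrier M; y \<in> carrier M\<rbrakk> \<Longrightarrow>
        a \<odot>\<^bsub>M\<^esub> (x \<oplus>\<^bsub>M\<^esub> y) = a \<odot>\<^bsub>M\<^esub> x \<oplus>\<^bsub>M\<^esub> a \<odot>\<^bsub>M\<^esub> y"
    and smult_assoc:
      "\<lbrakk>a \<in> carrier A; b \<in> carrier A; x \<in> carrier M\<rbrakk> \<Longrightarrow>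
        (a \<otimes>\<^bsub>A\<^esub> b) \<odot>\<^bsub>M\<^esub> x = a \<odot>\<^bsub>M\<^esub> (b \<odot>\<^bsub>M\<^esub> x)"
    and smult_one:
      "x \<in> carrier M \<Longrightarrow> \<one>\<^bsub>A\<^esub> \<odot>\<^bsub>M\<^esub> x = x"
begin

lemma smult_zero_left: "x \<in> carrier M \<Longrightarrow> \<zero>\<^bsub>A\<^esub> \<odot>\<^bsub>M\<^esub> x = \<zero>\<^bsub>M\<^esub>"
  using smult_l_distr[of "\<zero>\<^bsub>A\<^esub>" "\<zero>\<^bsub>A\<^esub>" x] smult_closed[of "\<zero>\<^bsub>A\<^esub>" x]
  by (metis M.add.r_cancel_one' local.ring_simprules(2) local.ring_simprules(8))

lemma smult_zero_right: "a \<in> carrier A \<Longrightarrow> a \<odot>\<^bsub>M\<^esub> \<zero>\<^bsub>M\<^esub> = \<zero>\<^bsub>M\<^esub>"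
  using smult_r_distr[of a "\<zero>\<^bsub>M\<^esub>" "\<zero>\<^bsub>M\<^esub>"] smult_closed[of a "\<zero>\<^bsub>M\<^esub>"]
  by (metis M.add.r_cancel_one' M.zero_closed M.l_zero)

lemma smult_minus: "a \<in> carrier A \<Longrightarrow> x \<in> carrier M \<Longrightarrow> a \<odot>\<^bsub>M\<^esub> (\<ominus>\<^bsub>M\<^esub> x) = \<ominus>\<^bsub>M\<^esub> (a \<odot>\<^bsub>M\<^esub> x)"
  using smult_r_distr[of a x "\<ominus>\<^bsub>M\<^esub> x"] smult_closed smult_zero_right
  by (metis M.a_inv_closed M.minus_equality M.r_neg M.a_comm)

lemma smult_finsum_right:
  assumes "a \<in> carrier A" "f \<in> S \<rightarrow> carrier M"
  shows "a \<odot>\<^bsub>M\<^esub> (\<Oplus>\<^bsub>M\<^esub>i\<in>S. f i) = (\<Oplus>\<^bsub>M\<^esub>i\<in>S. a \<odot>\<^bsub>M\<^esub> f i)"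
  by (rule additive_finsum)
    (use assms smult_closed smult_r_distr M.abelian_monoid_axioms M.abelian_group_axioms in auto)

lemma smult_finsum_left:
  assumes "x \<in> carrier M" "f \<in> S \<rightarrow> carrier A"
  shows "(\<Oplus>\<^bsub>A\<^esub>i\<in>S. f i) \<odot>\<^bsub>M\<^esub> x = (\<Oplus>\<^bsub>M\<^esub>i\<in>S. f i \<odot>\<^bsub>M\<^esub> x)"
  by (rule additive_finsum[where f = "\<lambda>a. a \<odot>\<^bsub>M\<^esub> x"])
    (use assms smult_closed smult_l_distr abelian_monoid_axioms M.abelian_group_axioms in auto)

end

text \<open>
  The axioms are equations and hence pass to the image of a homomorphism. This makes the quotient
  \<open>P / J P\<close> a module as soon as the quotient map respects the operations.
\<close>

lemma left_module_image:
  assumes M: "left_module A M"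
    and surj: "f ` carrier M = carrier N"
    and zero: "f \<zero>\<^bsub>M\<^esub> = \<zero>\<^bsub>N\<^esub>"
    and add: "\<And>x y. x \<in> carrier M \<Longrightarrow> y \<in> carrier M \<Longrightarrow> f (x \<oplus>\<^bsub>M\<^esub> y) = f x \<oplus>\<^bsub>N\<^esub> f y"
    and smult: "\<And>a x. a \<in> carrier A \<Longrightarrow> x \<in> carrier M \<Longrightarrow> f (a \<odot>\<^bsub>M\<^esub> x) = a \<odot>\<^bsub>N\<^esub> f x"
  shows "left_module A N"
proof -
  interpret M: left_module A M by fact
  have N: "x \<in> carrier N \<longleftrightarrow> (\<exists>y. y \<in> carrier M \<and> x = f y)" for x using surj by auto
  have closed: "f x \<in> carrier N" if "x \<in> carrier M" for x using N that by auto
  have "abelian_group N"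
  proof (rule abelian_groupI)
    show "\<exists>y\<in>carrier N. y \<oplus>\<^bsub>N\<^esub> x = \<zero>\<^bsub>N\<^esub>" if x: "x \<in> carrier N" for x
    proof -
      obtain y where y: "y \<in> carrier M" "x = f y" using x N by auto
      then have "f (\<ominus>\<^bsub>M\<^esub> y) \<oplus>\<^bsub>N\<^esub> x = \<zero>\<^bsub>N\<^esub>" using add[of "\<ominus>\<^bsub>M\<^esub> y" y] zero by (simp add: M.M.l_neg)
      then show ?thesis using closed[of "\<ominus>\<^bsub>M\<^esub> y"] y by blast
    qed
    show "\<zero>\<^bsub>N\<^esub> \<in> carrier N" using closed[of "\<zero>\<^bsub>M\<^esub>"] zero by simp
  qed (auto simp: N add[symmetric] zero[symmetric] M.M.a_ac intro: closed)
  then show ?thesis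
  proof (intro left_module.intro left_module_axioms.intro)
    show "ring A" by (rule M.ring_axioms)
  qed (auto simp: N add[symmetric] smult[symmetric] M.smult_closed M.smult_l_distr
      M.smult_r_distr M.smult_assoc M.smult_one intro: closed M.smult_closed)
qed

lemma graded_homD:
  assumes "f \<in> graded_hom A M N"
  shows "f \<in> carrier M \<rightarrow> carrier N"
    "\<And>x y. x \<in> carrier M \<Longrightarrow> y \<in> carrier M \<Longrightarrow> f (x \<oplus>\<^bsub>M\<^esub> y) = f x \<oplus>\<^bsub>N\<^esub> f y"
    "\<And>a x. a \<in> carrier A \<Longrightarrow> x \<in> carrier M \<Longrightarrow> f (a \<odot>\<^bsub>M\<^esub> x) = a \<odot>\<^bsub>N\<^esub> f x"
    "\<And>n x. x \<in> gr M n \<Longrightarrow> f x \<in> gr N n"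
  using assms unfolding graded_hom_def LinearCombinations.module_hom_def by blast+

lemma graded_hom_zero:
  assumes M: "left_module A M" and N: "left_module A N" and f: "f \<in> graded_hom A M N"
  shows "f \<zero>\<^bsub>M\<^esub> = \<zero>\<^bsub>N\<^esub>"
proof -
  interpret M: left_module A M by fact
  interpret N: left_module A N by fact
  have c: "f \<zero>\<^bsub>M\<^esub> \<in> carrier N" using graded_homD(1)[OF f] by auto
  have "f (\<zero>\<^bsub>A\<^esub> \<odot>\<^bsub>M\<^esub> \<zero>\<^bsub>M\<^esub>) = \<zero>\<^bsub>A\<^esub> \<odot>\<^bsub>N\<^esub> f \<zero>\<^bsub>M\<^esub>" by (rule graded_homD(3)[OF f]) auto
  then show ?thesis by (simp add: M.smult_zero_left N.smult_zero_left c)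
qed

lemma fg_projective_resolutionD:
  assumes "fg_projective_resolution A M P d \<epsilon>"
  shows "graded_projective A (P n)" "finitely_generated A (P n)"
    "d n \<in> graded_hom A (P (Suc n)) (P n)"
    "\<epsilon> \<in> graded_hom A (P 0) M" "\<epsilon> ` carrier (P 0) = carrier M"
    "a_kernel (P 0) M \<epsilon> = d 0 ` carrier (P (Suc 0))"
    "a_kernel (P (Suc n)) (P n) (d n) = d (Suc n) ` carrier (P (Suc (Suc n)))"
proof -
  note R = assms[unfolded fg_projective_resolution_def]
  show "graded_projective A (P n)" "finitely_generated A (P n)"
    using R[THEN conjunct1, THEN spec, of n] by (rule conjunct1, rule conjunct2)
  note R = R[THEN conjunct2]
  show "d n \<in> graded_hom A (P (Suc n)) (P n)" by (rule R[THEN conjunct1, THEN spec])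
  note R = R[THEN conjunct2]
  show "\<epsilon> \<in> graded_hom A (P 0) M" by (rule R[THEN conjunct1])
  note R = R[THEN conjunct2]
  show "\<epsilon> ` carrier (P 0) = carrier M" by (rule R[THEN conjunct1])
  note R = R[THEN conjunct2]
  show "a_kernel (P 0) M \<epsilon> = d 0 ` carrier (P (Suc 0))" by (rule R[THEN conjunct1])
  show "a_kernel (P (Suc n)) (P n) (d n) = d (Suc n) ` carrier (P (Suc (Suc n)))"
    by (rule R[THEN conjunct2, THEN spec])
qed

context graded_left_module
begin

lemma left_module: "left_module A M"
  by unfold_locales (fact smult_closed smult_l_distr smult_r_distr smult_assoc smult_one)+

sublocale left_module A M by (rule left_module)

sublocale gr: graded_abelian_group M by unfold_locales (rule decomposition)

end

context elementary_algebra
begin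

text \<open>
  Scalars act through \<open>c \<mapsto> c 1\<close>, a ring homomorphism from \<open>K\<close> to \<open>A\<close> since \<open>A\<close> is an algebra.
\<close>

lemma restrict_scalars_vectorspace:
  assumes "left_module A M"
  shows "vectorspace K (restrict_scalars A M)"
proof -
  interpret M: left_module A M by fact
  have K1: "c \<odot>\<^bsub>A\<^esub> \<one>\<^bsub>A\<^esub> \<in> carrier A" if "c \<in> carrier K" for c
    using that by simp
  have prod: "(c \<otimes>\<^bsub>K\<^esub> d) \<odot>\<^bsub>A\<^esub> \<one>\<^bsub>A\<^esub> = (c \<odot>\<^bsub>A\<^esub> \<one>\<^bsub>A\<^esub>) \<otimes>\<^bsub>A\<^esub> (d \<odot>\<^bsub>A\<^esub> \<one>\<^bsub>A\<^esub>)"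
    if "c \<in> carrier K" "d \<in> carrier K" for c d
    using that by (simp add: smult_mult smult_assoc1)
  have "abelian_group (restrict_scalars A M)"
    by (rule abelian_groupI) (auto simp: restrict_scalars_def M.M.a_ac intro: M.M.l_neg)
  then have "Module.module K (restrict_scalars A M)"
    by (intro moduleI) (auto simp: restrict_scalars_def M.smult_closed K1 prod smult_l_distr
        M.smult_l_distr M.smult_r_distr M.smult_assoc M.smult_one R.cring_axioms)
  then show ?thesis by (simp add: vectorspace_def field_axioms)
qed

lemma graded_abelian_group_A: "graded_abelian_group A"
  using gr_decomposition by unfold_locales

sublocale gr: graded_abelian_group A by (rule graded_abelian_group_A)

lemma e_closed: "i < r \<Longrightarrow> e i \<in> carrier A"
  using e_gr gr.gr_closed by blast

lemma e_idem: "i < r \<Longrightarrow> e i \<otimes>\<^bsub>A\<^esub> e i = e i"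
  using e_primitive by (auto simp: primitive_idempotent_def idempotent_def)

lemma e_nonzero: "i < r \<Longrightarrow> e i \<noteq> \<zero>\<^bsub>A\<^esub>"
  using e_primitive by (auto simp: primitive_idempotent_def)

lemma e_mult: "i < r \<Longrightarrow> j < r \<Longrightarrow> e i \<otimes>\<^bsub>A\<^esub> e j = (if i = j then e i else \<zero>\<^bsub>A\<^esub>)"
  using e_orthogonal[of i j] e_idem by (auto simp: orthogonal_def)

lemma gr_0_cases:
  assumes "a \<in> gr A 0"
  obtains c where "\<And>i. i < r \<Longrightarrow> c i \<in> carrier K" "a = (\<Oplus>\<^bsub>A\<^esub>i\<in>{..<r}. c i \<odot>\<^bsub>A\<^esub> e i)"
  using gr_0_decomposition[OF assms] by (metis (no_types, lifting) PiE_mem lessThan_iff)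

lemma sum_e_mult_e:
  assumes c: "\<And>i. i < r \<Longrightarrow> c i \<in> carrier K" and j: "j < r"
  shows "(\<Oplus>\<^bsub>A\<^esub>i\<in>{..<r}. c i \<odot>\<^bsub>A\<^esub> e i) \<otimes>\<^bsub>A\<^esub> e j = c j \<odot>\<^bsub>A\<^esub> e j"
proof -
  have "(\<Oplus>\<^bsub>A\<^esub>i\<in>{..<r}. c i \<odot>\<^bsub>A\<^esub> e i) \<otimes>\<^bsub>A\<^esub> e j = (\<Oplus>\<^bsub>A\<^esub>i\<in>{..<r}. (c i \<odot>\<^bsub>A\<^esub> e i) \<otimes>\<^bsub>A\<^esub> e j)"
    using c e_closed j by (intro alg.finsum_ldistr) auto
  also have "\<dots> = (\<Oplus>\<^bsub>A\<^esub>i\<in>{..<r}. if j = i then c i \<odot>\<^bsub>A\<^esub> e i else \<zero>\<^bsub>A\<^esub>)"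
    using c e_closed j by (intro M.finsum_cong') (auto simp: smult_mult e_mult)
  also have "\<dots> = c j \<odot>\<^bsub>A\<^esub> e j"
    using M.finsum_singleton[of j "{..<r}" "\<lambda>i. c i \<odot>\<^bsub>A\<^esub> e i"] c e_closed j by auto
  finally show ?thesis .
qed

text \<open>\<open>A\<^sub>0 e\<^sub>j\<close> is the line \<open>K e\<^sub>j\<close>, by orthogonality.\<close>

lemma gr_0_mult_e:
  assumes a: "a \<in> gr A 0" and j: "j < r"
  shows "\<exists>c\<in>carrier K. a \<otimes>\<^bsub>A\<^esub> e j = c \<odot>\<^bsub>A\<^esub> e j"
proof -
  obtain c where c: "\<And>i. i < r \<Longrightarrow> c i \<in> carrier K" "a = (\<Oplus>\<^bsub>A\<^esub>i\<in>{..<r}. c i \<odot>\<^bsub>A\<^esub> e i)"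
    using gr_0_cases[OF a] by blast
  then show ?thesis using sum_e_mult_e[of c j, OF c(1) j] j by auto
qed

lemma one_eq_sum_e: "\<one>\<^bsub>A\<^esub> = (\<Oplus>\<^bsub>A\<^esub>i\<in>{..<r}. e i)"
proof -
  obtain c where c: "\<And>i. i < r \<Longrightarrow> c i \<in> carrier K" "\<one>\<^bsub>A\<^esub> = (\<Oplus>\<^bsub>A\<^esub>i\<in>{..<r}. c i \<odot>\<^bsub>A\<^esub> e i)"
    using gr_0_cases[OF one_gr] by blast
  have "c j \<odot>\<^bsub>A\<^esub> e j = e j" if j: "j < r" for j
    using sum_e_mult_e[of c j, OF c(1) j] e_closed[OF j] by (simp flip: c(2))
  then show ?thesis unfolding c(2) using e_closed by (intro M.finsum_cong') auto
qed

section \<open>Corners and vertex parts\<close>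

text \<open>
  \<open>e\<^sub>i A\<^sub>n e\<^sub>j\<close>, whose dimensions are the coefficients of \<open>C\<^sub>A\<close>, and \<open>e\<^sub>i M\<^sub>n\<close>, whose
  dimensions are those of \<open>Hilb\<^sub>M\<close>. Both are the fixed points of the idempotents involved.
\<close>

abbreviation corner where
  "corner i j n \<equiv> (\<lambda>a. e i \<otimes>\<^bsub>A\<^esub> a \<otimes>\<^bsub>A\<^esub> e j) ` gr A n"

lemma corner_iff:
  assumes i: "i < r" and j: "j < r"
  shows "a \<in> corner i j n \<longleftrightarrow> a \<in> gr A n \<and> e i \<otimes>\<^bsub>A\<^esub> a = a \<and> a \<otimes>\<^bsub>A\<^esub> e j = a"
proof
  assume "a \<in> corner i j n"
  then obtain b where b: "b \<in> gr A n" "a = e i \<otimes>\<^bsub>A\<^esub> b \<otimes>\<^bsub>A\<^esub> e j" by auto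
  have bc: "b \<in> carrier A" using b gr.gr_closed by auto
  have "a \<in> gr A (0 + n + 0)" unfolding b(2) by (intro mult_gr e_gr i j b)
  moreover have "e i \<otimes>\<^bsub>A\<^esub> a = (e i \<otimes>\<^bsub>A\<^esub> e i) \<otimes>\<^bsub>A\<^esub> b \<otimes>\<^bsub>A\<^esub> e j"
    unfolding b(2) using bc e_closed i j by (simp add: alg.m_assoc)
  moreover have "a \<otimes>\<^bsub>A\<^esub> e j = e i \<otimes>\<^bsub>A\<^esub> b \<otimes>\<^bsub>A\<^esub> (e j \<otimes>\<^bsub>A\<^esub> e j)"
    unfolding b(2) using bc e_closed i j by (simp add: alg.m_assoc)
  ultimately show "a \<in> gr A n \<and> e i \<otimes>\<^bsub>A\<^esub> a = a \<and> a \<otimes>\<^bsub>A\<^esub> e j = a"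
    using b(2) i j by (simp add: e_idem)
next
  assume "a \<in> gr A n \<and> e i \<otimes>\<^bsub>A\<^esub> a = a \<and> a \<otimes>\<^bsub>A\<^esub> e j = a"
  then show "a \<in> corner i j n" by (metis (no_types, lifting) imageI)
qed

lemma vectorspace_A: "vectorspace K A" by (rule vectorspace_axioms)

lemma fin_dim_gr: "fin_dim_subspace K A (gr A n)"
  unfolding fin_dim_subspace_def using vectorspace_A gr_subspace locally_finite by blast

lemma corner_fin_dim:
  assumes i: "i < r" and j: "j < r"
  shows "fin_dim_subspace K A (corner i j n)"
proof (rule rank_nullity_subspace(3)[OF vectorspace_A vectorspace_A gr_subspace refl _ _ _ fin_dim_gr])
  show "corner i j n \<subseteq> carrier A" using e_closed[OF i] e_closed[OF j] gr.gr_closed by auto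
  fix x y assume "x \<in> gr A n" "y \<in> gr A n"
  then show "e i \<otimes>\<^bsub>A\<^esub> (x \<oplus>\<^bsub>A\<^esub> y) \<otimes>\<^bsub>A\<^esub> e j = e i \<otimes>\<^bsub>A\<^esub> x \<otimes>\<^bsub>A\<^esub> e j \<oplus>\<^bsub>A\<^esub> e i \<otimes>\<^bsub>A\<^esub> y \<otimes>\<^bsub>A\<^esub> e j"
    using e_closed[OF i] e_closed[OF j] gr.gr_closed by (simp add: alg.l_distr alg.r_distr)
next
  fix c x assume "c \<in> carrier K" "x \<in> gr A n"
  then show "e i \<otimes>\<^bsub>A\<^esub> (c \<odot>\<^bsub>A\<^esub> x) \<otimes>\<^bsub>A\<^esub> e j = c \<odot>\<^bsub>A\<^esub> (e i \<otimes>\<^bsub>A\<^esub> x \<otimes>\<^bsub>A\<^esub> e j)"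
    using e_closed[OF i] e_closed[OF j] gr.gr_closed by (simp add: smult_mult mult_smult)
qed

lemma corner_subspace: "i < r \<Longrightarrow> j < r \<Longrightarrow> VectorSpace.subspace K (corner i j n) A"
  using corner_fin_dim by (auto simp: fin_dim_subspace_def)

lemma corner_negative:
  assumes "i < r" "j < r" "n < 0"
  shows "corner i j n = {\<zero>\<^bsub>A\<^esub>}"
  using assms gr_negative e_closed by auto

text \<open>This is the statement \<open>C\<^sub>A(0) = 1\<close>: \<open>e\<^sub>i A\<^sub>0 e\<^sub>j = K e\<^sub>i e\<^sub>j\<close>.\<close>

lemma corner_dim_0:
  assumes i: "i < r" and j: "j < r"
  shows "subspace_dim K A (corner i j 0) = (if i = j then 1 else 0)"
proof (cases "i = j")
  case True
  let ?S = "corner i i 0"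
  have S: "VectorSpace.subspace K ?S A" by (rule corner_subspace[OF i i])
  interpret S: vectorspace K "A\<lparr>carrier := ?S\<rparr>" by (rule subspace_is_vs[OF S])
  have ei: "e i \<in> ?S" using i by (auto simp: corner_iff e_gr e_idem)
  have "S.gen_set {e i}"
  proof (intro equalityI)
    show "S.span {e i} \<subseteq> carrier (A\<lparr>carrier := ?S\<rparr>)" using S.span_is_subset2[of "{e i}"] ei by simp
    show "carrier (A\<lparr>carrier := ?S\<rparr>) \<subseteq> S.span {e i}"
    proof
      fix a assume "a \<in> carrier (A\<lparr>carrier := ?S\<rparr>)"
      then have a: "a \<in> gr A 0" "a \<otimes>\<^bsub>A\<^esub> e i = a" using corner_iff[OF i i] by auto
      then obtain c where c: "c \<in> carrier K" "a = c \<odot>\<^bsub>A\<^esub> e i" using gr_0_mult_e[OF a(1) i] by auto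
      have sub: "submodule K (S.span {e i}) (A\<lparr>carrier := ?S\<rparr>)" using S.span_is_submodule[of "{e i}"] ei by simp
      have "e i \<in> S.span {e i}" using S.in_own_span[of "{e i}"] ei by auto
      then show "a \<in> S.span {e i}" using submodule.smult_closed[OF sub c(1)] c(2) by simp
    qed
  qed
  then have "S.dim = 1" by (rule S.dim1I) (use ei e_nonzero[OF i] in auto)
  then show ?thesis using True by (simp add: subspace_dim_def)
next
  case False
  have "corner i j 0 = {\<zero>\<^bsub>A\<^esub>}"
  proof (intro equalityI subsetI)
    fix a assume "a \<in> corner i j 0"
    then have a: "a \<in> gr A 0" "a \<otimes>\<^bsub>A\<^esub> e j = a" "e i \<otimes>\<^bsub>A\<^esub> a = a" using corner_iff[OF i j] by auto
    then obtain c where c: "c \<in> carrier K" "a = c \<odot>\<^bsub>A\<^esub> e j" using gr_0_mult_e[OF a(1) j] by auto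
    have "e i \<otimes>\<^bsub>A\<^esub> a = c \<odot>\<^bsub>A\<^esub> (e i \<otimes>\<^bsub>A\<^esub> e j)" using c e_closed i j by (simp add: mult_smult)
    then show "a \<in> {\<zero>\<^bsub>A\<^esub>}" using a(3) False c(1) i j by (simp add: e_mult)
  next
    fix a assume "a \<in> {\<zero>\<^bsub>A\<^esub>}"
    then show "a \<in> corner i j 0" using subspaceD(2)[OF corner_subspace[OF i j]] by simp
  qed
  then show ?thesis using False subspace_dim_zero(1)[OF vectorspace_A] by simp
qed

abbreviation vertex_part where
  "vertex_part M i n \<equiv> (\<lambda>m. e i \<odot>\<^bsub>M\<^esub> m) ` gr M n"

lemma vertex_part_iff:
  assumes M: "graded_left_module A M" and i: "i < r"
  shows "x \<in> vertex_part M i n \<longleftrightarrow> x \<in> gr M n \<and> e i \<odot>\<^bsub>M\<^esub> x = x"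
proof
  interpret M: graded_left_module A M by fact
  assume "x \<in> vertex_part M i n"
  then obtain y where y: "y \<in> gr M n" "x = e i \<odot>\<^bsub>M\<^esub> y" by auto
  have "e i \<odot>\<^bsub>M\<^esub> x = (e i \<otimes>\<^bsub>A\<^esub> e i) \<odot>\<^bsub>M\<^esub> y"
    unfolding y(2) using M.gr.gr_closed[OF y(1)] e_closed[OF i] by (simp add: M.smult_assoc)
  moreover have "x \<in> gr M (0 + n)" unfolding y(2) by (rule M.smult_gr[OF e_gr[OF i] y(1)])
  ultimately show "x \<in> gr M n \<and> e i \<odot>\<^bsub>M\<^esub> x = x" using y e_idem[OF i] by simp
next
  assume "x \<in> gr M n \<and> e i \<odot>\<^bsub>M\<^esub> x = x"
  then show "x \<in> vertex_part M i n" by (metis (no_types, lifting) imageI)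
qed

lemma scalar_gr_0: "c \<in> carrier K \<Longrightarrow> c \<odot>\<^bsub>A\<^esub> \<one>\<^bsub>A\<^esub> \<in> gr A 0"
  using subspaceD(4)[OF gr_subspace _ one_gr] .

lemma vertex_part_subspace:
  assumes M: "graded_left_module A M" and i: "i < r"
  shows "VectorSpace.subspace K (vertex_part M i n) (restrict_scalars A M)"
proof -
  interpret M: graded_left_module A M by fact
  interpret V: vectorspace K "restrict_scalars A M"
    by (rule restrict_scalars_vectorspace[OF M.left_module])
  note e = e_closed[OF i]
  show ?thesis
  proof (rule V.subspaceI)
    show "vertex_part M i n \<subseteq> carrier (restrict_scalars A M)"
      using e M.gr.gr_closed M.smult_closed by (auto simp: restrict_scalars_def)
    show "\<zero>\<^bsub>restrict_scalars A M\<^esub> \<in> vertex_part M i n"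
      using e by (simp add: vertex_part_iff[OF M i] restrict_scalars_def M.gr.zero_gr M.smult_zero_right)
    show "x \<oplus>\<^bsub>restrict_scalars A M\<^esub> y \<in> vertex_part M i n"
      if "x \<in> vertex_part M i n" "y \<in> vertex_part M i n" for x y
      using that e M.gr.gr_closed[of x n] M.gr.gr_closed[of y n] unfolding vertex_part_iff[OF M i]
      by (simp add: restrict_scalars_def M.gr.add_gr M.smult_r_distr)
    fix c x assume c: "c \<in> carrier K" and x: "x \<in> vertex_part M i n"
    have xc: "x \<in> carrier M" using x M.gr.gr_closed unfolding vertex_part_iff[OF M i] by auto
    have "e i \<otimes>\<^bsub>A\<^esub> (c \<odot>\<^bsub>A\<^esub> \<one>\<^bsub>A\<^esub>) = (c \<odot>\<^bsub>A\<^esub> \<one>\<^bsub>A\<^esub>) \<otimes>\<^bsub>A\<^esub> e i"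
      using c e by (simp add: mult_smult smult_mult)
    then have "e i \<odot>\<^bsub>M\<^esub> ((c \<odot>\<^bsub>A\<^esub> \<one>\<^bsub>A\<^esub>) \<odot>\<^bsub>M\<^esub> x) = (c \<odot>\<^bsub>A\<^esub> \<one>\<^bsub>A\<^esub>) \<odot>\<^bsub>M\<^esub> (e i \<odot>\<^bsub>M\<^esub> x)"
      using c e xc by (simp flip: M.smult_assoc)
    then show "c \<odot>\<^bsub>restrict_scalars A M\<^esub> x \<in> vertex_part M i n"
      using x M.smult_gr[OF scalar_gr_0[OF c], of x n] unfolding vertex_part_iff[OF M i]
      by (simp add: restrict_scalars_def)
  qed
qed

text \<open>
  Strictness: if \<open>f x\<close> lies in \<open>e\<^sub>i N\<^sub>n\<close>, then \<open>x\<close> may be replaced by \<open>e\<^sub>i x\<^sub>n\<close>, which has the same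
  image. So taking \<open>e\<^sub>i (-)\<^sub>n\<close> preserves exactness.
\<close>

lemma vertex_part_hom_image:
  assumes M: "graded_left_module A M" and N: "graded_left_module A N"
    and f: "f \<in> graded_hom A M N" and i: "i < r"
  shows "f ` vertex_part M i n = vertex_part N i n \<inter> f ` carrier M"
proof -
  interpret M: graded_left_module A M by fact
  interpret N: graded_left_module A N by fact
  note fc = graded_homD(1)[OF f] and fadd = graded_homD(2)[OF f]
    and fsm = graded_homD(3)[OF f] and fgr = graded_homD(4)[OF f]
  note e = e_closed[OF i]
  show ?thesis
  proof (intro equalityI subsetI)
    fix y assume "y \<in> f ` vertex_part M i n"
    then obtain x where x: "x \<in> vertex_part M i n" "y = f x" by auto
    then have x': "x \<in> gr M n" "e i \<odot>\<^bsub>M\<^esub> x = x" unfolding vertex_part_iff[OF M i] by auto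
    then have "e i \<odot>\<^bsub>N\<^esub> y = y" using fsm[OF e, of x] M.gr.gr_closed x(2) by simp
    then have "y \<in> vertex_part N i n"
      using fgr[OF x'(1)] x(2) by (simp only: vertex_part_iff[OF N i])
    then show "y \<in> vertex_part N i n \<inter> f ` carrier M"
      using x(2) M.gr.gr_closed[OF x'(1)] by blast
  next
    fix y assume "y \<in> vertex_part N i n \<inter> f ` carrier M"
    then have y: "y \<in> gr N n" "e i \<odot>\<^bsub>N\<^esub> y = y" and "y \<in> f ` carrier M"
      unfolding vertex_part_iff[OF N i] Int_iff by blast+
    then obtain x where x: "x \<in> carrier M" "y = f x" by blast
    let ?z = "M.gr.cmp x n"
    have "N.gr.cmp (f x) (n + 0) = f ?z"
      by (rule component_additive_map) (use M.gr.graded_abelian_group_axioms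
          N.gr.graded_abelian_group_axioms fc fadd fgr x in auto)
    then have "f ?z = y" using x N.gr.component_homogeneous[OF y(1), of n] by simp
    then have "f (e i \<odot>\<^bsub>M\<^esub> ?z) = y" using fsm[OF e M.gr.component_closed[OF x(1)]] y(2) by simp
    then show "y \<in> f ` vertex_part M i n" using M.gr.component_gr[OF x(1)] by blast
  qed
qed

lemma vertex_dim_rank_nullity:
  assumes M: "graded_left_module A M" and N: "graded_left_module A N"
    and f: "f \<in> graded_hom A M N" and i: "i < r"
    and fin: "fin_dim_subspace K (restrict_scalars A M) (vertex_part M i n)"
  defines "T \<equiv> vertex_part N i n \<inter> f ` carrier M"
  shows "fin_dim_subspace K (restrict_scalars A N) T"
    "vertex_dim K A e M i n = subspace_dim K (restrict_scalars A N) T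
       + subspace_dim K (restrict_scalars A M) (vertex_part M i n \<inter> a_kernel M N f)"
proof -
  interpret M: graded_left_module A M by fact
  interpret N: graded_left_module A N by fact
  note fc = graded_homD(1)[OF f] and fadd = graded_homD(2)[OF f]
    and fsm = graded_homD(3)[OF f] and fgr = graded_homD(4)[OF f]
  note V = restrict_scalars_vectorspace[OF M.left_module]
  note W = restrict_scalars_vectorspace[OF N.left_module]
  have vc: "x \<in> carrier M" if "x \<in> vertex_part M i n" for x
    using that M.gr.gr_closed unfolding vertex_part_iff[OF M i] by auto
  have im: "f ` vertex_part M i n = T" unfolding T_def by (rule vertex_part_hom_image[OF M N f i])
  have T: "T \<subseteq> carrier (restrict_scalars A N)" using fc by (auto simp: T_def restrict_scalars_def)
  have add: "f (x \<oplus>\<^bsub>restrict_scalars A M\<^esub> y) = f x \<oplus>\<^bsub>restrict_scalars A N\<^esub> f y"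
    if "x \<in> vertex_part M i n" "y \<in> vertex_part M i n" for x y
    using fadd[OF vc vc, OF that] by (simp add: restrict_scalars_def)
  have sm: "f (c \<odot>\<^bsub>restrict_scalars A M\<^esub> x) = c \<odot>\<^bsub>restrict_scalars A N\<^esub> f x"
    if "c \<in> carrier K" "x \<in> vertex_part M i n" for c x
    using fsm[OF _ vc[OF that(2)]] gr.gr_closed[OF scalar_gr_0[OF that(1)]] by (simp add: restrict_scalars_def)
  note rn = rank_nullity_subspace[OF V W vertex_part_subspace[OF M i] im T add sm]
  show "fin_dim_subspace K (restrict_scalars A N) T" using rn(3) fin by blast
  have "{x \<in> vertex_part M i n. f x = \<zero>\<^bsub>restrict_scalars A N\<^esub>} = vertex_part M i n \<inter> a_kernel M N f"
    using vc by (auto simp: a_kernel_def' restrict_scalars_def)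
  then show "vertex_dim K A e M i n = subspace_dim K (restrict_scalars A N) T
       + subspace_dim K (restrict_scalars A M) (vertex_part M i n \<inter> a_kernel M N f)"
    unfolding vertex_dim_def using rn(4) fin by metis
qed

section \<open>The Euler characteristic of a resolution\<close>

text \<open>
  The proof tracks the dimension \<open>z k\<close> of the boundaries in \<open>P k\<close>. Rank-nullity for the
  augmentation and for each differential gives
  \<open>dim P\<^sub>0 = dim M + z\<^sub>0\<close> and \<open>dim P\<^sub>k\<^sub>+\<^sub>1 = z\<^sub>k + z\<^sub>k\<^sub>+\<^sub>1\<close>, so the alternating sum telescopes, and
  \<open>z\<^sub>L = 0\<close> because the resolution stops at \<open>L\<close>.
\<close>

lemma euler_characteristic:
  fixes P :: "nat \<Rightarrow> ('a, 'p) graded"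
  assumes M: "graded_left_module A M"
    and res: "finite_fg_projective_resolution A M L P d \<epsilon>"
    and fin: "\<And>k. fin_dim_subspace K (restrict_scalars A (P k)) (vertex_part (P k) i n)"
    and i: "i < r"
  shows "fin_dim_subspace K (restrict_scalars A M) (vertex_part M i n)"
    and "int (vertex_dim K A e M i n) = (\<Sum>k\<le>L. (- 1) ^ k * int (vertex_dim K A e (P k) i n))"
proof -
  have res': "fg_projective_resolution A M P d \<epsilon>"
    and top: "\<And>k. k > L \<Longrightarrow> carrier (P k) = {\<zero>\<^bsub>P k\<^esub>}"
    using res by (simp_all add: finite_fg_projective_resolution_def)
  have P: "graded_left_module A (P k)" for k
    using fg_projective_resolutionD(1)[OF res', of k] by (simp add: graded_projective_def)
  note d = fg_projective_resolutionD(3)[OF res'] and eps = fg_projective_resolutionD(4)[OF res']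
    and eps_surj = fg_projective_resolutionD(5)[OF res'] and exact_0 = fg_projective_resolutionD(6)[OF res']
    and exact = fg_projective_resolutionD(7)[OF res']
  interpret M: graded_left_module A M by fact
  interpret PL: graded_left_module A "P (Suc L)" by (rule P)
  interpret PL': graded_left_module A "P L" by (rule P)
  define z where "z k = subspace_dim K (restrict_scalars A (P k))
    (vertex_part (P k) i n \<inter> d k ` carrier (P (Suc k)))" for k
  have "vertex_part M i n \<inter> \<epsilon> ` carrier (P 0) = vertex_part M i n"
    unfolding eps_surj using M.gr.gr_closed e_closed[OF i] M.smult_closed by auto
  note rn0 = vertex_dim_rank_nullity[OF P M eps i fin, unfolded this exact_0]
  show "fin_dim_subspace K (restrict_scalars A M) (vertex_part M i n)" by (rule rn0(1))
  have rec0: "vertex_dim K A e (P 0) i n = vertex_dim K A e M i n + z 0"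
    using rn0(2) by (simp add: z_def vertex_dim_def)
  have rec: "vertex_dim K A e (P (Suc k)) i n = z k + z (Suc k)" for k
    using vertex_dim_rank_nullity(2)[OF P P d i fin, of k] unfolding exact z_def .
  have partial: "int (vertex_dim K A e M i n) =
      (\<Sum>k\<le>l. (- 1) ^ k * int (vertex_dim K A e (P k) i n)) - (- 1) ^ l * int (z l)" for l
  proof (induction l)
    case 0
    then show ?case using rec0 by simp
  next
    case (Suc l)
    then show ?case by (simp add: rec algebra_simps)
  qed
  have "d L \<zero>\<^bsub>P (Suc L)\<^esub> = \<zero>\<^bsub>P L\<^esub>"
    by (rule graded_hom_zero[OF PL.left_module PL'.left_module d])
  then have "vertex_part (P L) i n \<inter> d L ` carrier (P (Suc L)) = {\<zero>\<^bsub>P L\<^esub>}"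
    using top[of "Suc L"] subspaceD(2)[OF vertex_part_subspace[OF P i]] by (auto simp: restrict_scalars_def)
  then have "z L = 0"
    using subspace_dim_zero(1)[OF restrict_scalars_vectorspace[OF PL'.left_module]]
    by (simp add: z_def restrict_scalars_def)
  then show "int (vertex_dim K A e M i n) = (\<Sum>k\<le>L. (- 1) ^ k * int (vertex_dim K A e (P k) i n))"
    using partial[of L] by simp
qed

section \<open>The ideal of elements of positive degree\<close>

lemma positive_part_subgroup: "additive_subgroup (positive_part A) A"
proof -
  have "(\<Union>n\<in>{0<..}. gr A n) \<subseteq> carrier (add_monoid A)" using gr.gr_closed by auto
  then have "subgroup (positive_part A) (add_monoid A)"
    unfolding positive_part_def by (rule group.generate_is_subgroup[OF M.a_group])
  then show ?thesis by (rule additive_subgroup.intro)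
qed

lemma positive_part_closed: "a \<in> positive_part A \<Longrightarrow> a \<in> carrier A"
  using additive_subgroup.a_subset[OF positive_part_subgroup] by auto

lemma gr_positive_part: "a \<in> gr A n \<Longrightarrow> n > 0 \<Longrightarrow> a \<in> positive_part A"
  unfolding positive_part_def by (rule generate.incl) auto

lemma positive_part_induct [consumes 1, case_names incl zero minus add]:
  assumes "a \<in> positive_part A"
    and "\<And>a n. a \<in> gr A n \<Longrightarrow> n > 0 \<Longrightarrow> Q a" "Q \<zero>\<^bsub>A\<^esub>"
    and "\<And>a. a \<in> carrier A \<Longrightarrow> Q a \<Longrightarrow> Q (\<ominus>\<^bsub>A\<^esub> a)"
    and "\<And>a b. a \<in> carrier A \<Longrightarrow> b \<in> carrier A \<Longrightarrow> Q a \<Longrightarrow> Q b \<Longrightarrow> Q (a \<oplus>\<^bsub>A\<^esub> b)"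
  shows "Q a"
  using assms(1) unfolding positive_part_def
proof (induction rule: generate.induct)
  case one
  then show ?case using assms(3) by simp
next
  case (incl h)
  then show ?case using assms(2) by auto
next
  case (inv h)
  then show ?case using assms(2,4) gr.gr_closed by (auto simp: a_inv_def)
next
  case (eng h1 h2)
  then have "h1 \<in> carrier A" "h2 \<in> carrier A"
    using positive_part_closed by (auto simp: positive_part_def)
  then show ?case using eng assms(5) by simp
qed

lemma positive_part_component_0: "a \<in> positive_part A \<Longrightarrow> homogeneous_component A a 0 = \<zero>\<^bsub>A\<^esub>"
proof (induction rule: positive_part_induct)
  case (incl a n)
  then show ?case by (simp add: gr.component_homogeneous[of a n])
next
  case zero
  then show ?case using gr.component_homogeneous[OF gr.zero_gr[of 0]] by simp
next
  case (minus a)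
  have "homogeneous_component A (a \<oplus>\<^bsub>A\<^esub> \<ominus>\<^bsub>A\<^esub> a) 0 = homogeneous_component A (\<ominus>\<^bsub>A\<^esub> a) 0"
    using minus gr.component_closed by (simp add: gr.component_add)
  then show ?case using minus(1) gr.component_homogeneous[OF gr.zero_gr[of 0]] by (simp add: M.r_neg)
next
  case (add a b)
  then show ?case by (simp add: gr.component_add)
qed

text \<open>
  Since \<open>A\<close> has no negative degrees, multiplying a homogeneous element of positive degree by a
  homogeneous element cannot lower its degree.
\<close>

lemma positive_part_ideal:
  assumes a: "a \<in> positive_part A" and b: "b \<in> carrier A"
  shows "a \<otimes>\<^bsub>A\<^esub> b \<in> positive_part A" "b \<otimes>\<^bsub>A\<^esub> a \<in> positive_part A"
proof -
  interpret J: additive_subgroup "positive_part A" A by (rule positive_part_subgroup)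
  have hom: "x \<otimes>\<^bsub>A\<^esub> y \<in> positive_part A \<and> y \<otimes>\<^bsub>A\<^esub> x \<in> positive_part A"
    if x: "x \<in> gr A n" "n > 0" and y: "y \<in> gr A m" for x y n m
  proof (cases "m < 0")
    case True
    then have "y = \<zero>\<^bsub>A\<^esub>" using gr_negative y by auto
    then show ?thesis using gr.gr_closed[OF x(1)] J.zero_closed by simp
  next
    case False
    then show ?thesis
      using gr_positive_part[OF mult_gr[OF x(1) y]] gr_positive_part[OF mult_gr[OF y x(1)]] x(2) by simp
  qed
  have part: "x \<otimes>\<^bsub>A\<^esub> b \<in> positive_part A \<and> b \<otimes>\<^bsub>A\<^esub> x \<in> positive_part A"
    if x: "x \<in> gr A n" "n > 0" for x n
  proof -
    let ?S = "{n. gr.cmp b n \<noteq> \<zero>\<^bsub>A\<^esub>}"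
    have cc: "gr.cmp b \<in> ?S \<rightarrow> carrier A" using gr.component_closed[OF b] by auto
    have xc: "x \<in> carrier A" using gr.gr_closed x by auto
    have "x \<otimes>\<^bsub>A\<^esub> b = (\<Oplus>\<^bsub>A\<^esub>m\<in>?S. x \<otimes>\<^bsub>A\<^esub> gr.cmp b m)"
      using alg.finsum_rdistr[OF gr.component_finite[OF b] xc cc] gr.component_sum[OF b] by simp
    moreover have "b \<otimes>\<^bsub>A\<^esub> x = (\<Oplus>\<^bsub>A\<^esub>m\<in>?S. gr.cmp b m \<otimes>\<^bsub>A\<^esub> x)"
      using alg.finsum_ldistr[OF gr.component_finite[OF b] xc cc] gr.component_sum[OF b] by simp
    ultimately show ?thesis
      using hom[OF x gr.component_gr[OF b]]
      by (auto intro!: additive_subgroup_finsum[OF positive_part_subgroup M.abelian_group_axioms])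
  qed
  have "a \<otimes>\<^bsub>A\<^esub> b \<in> positive_part A \<and> b \<otimes>\<^bsub>A\<^esub> a \<in> positive_part A"
    using a
  proof (induction rule: positive_part_induct)
    case (incl a n)
    then show ?case by (rule part)
  next
    case zero
    then show ?case using b J.zero_closed by simp
  next
    case (minus a)
    then show ?case using b J.a_inv_closed by (simp add: alg.l_minus alg.r_minus)
  next
    case (add x y)
    then show ?case using b by (simp add: alg.l_distr alg.r_distr)
  qed
  then show "a \<otimes>\<^bsub>A\<^esub> b \<in> positive_part A" "b \<otimes>\<^bsub>A\<^esub> a \<in> positive_part A" by auto
qed

end

section \<open>Graded free modules\<close>

text \<open>
  For an idempotent \<open>f\<close> this is the left ideal \<open>A f\<close>. As a set of fixed points it is visibly closed
  under the operations.
\<close>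

definition right_corner :: "('k, 'a, 'y) graded_scheme \<Rightarrow> 'a \<Rightarrow> 'a set" where
  "right_corner A f = {a \<in> carrier A. a \<otimes>\<^bsub>A\<^esub> f = a}"

text \<open>Outside \<open>X\<close> the value is pinned to \<open>z\<close>, so that an element is determined by its values on \<open>X\<close>.\<close>

definition functions_into :: "'a \<Rightarrow> 'x set \<Rightarrow> ('x \<Rightarrow> 'a set) \<Rightarrow> ('x \<Rightarrow> 'a) set" where
  "functions_into z X S = {f. \<forall>x. if x \<in> X then f x \<in> S x else f x = z}"

lemma functions_intoD:
  "f \<in> functions_into z X S \<Longrightarrow> x \<in> X \<Longrightarrow> f x \<in> S x"
  "f \<in> functions_into z X S \<Longrightarrow> x \<notin> X \<Longrightarrow> f x = z"
  unfolding functions_into_def mem_Collect_eq by (metis, metis)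

lemma functions_intoI:
  "(\<And>x. x \<in> X \<Longrightarrow> f x \<in> S x) \<Longrightarrow> (\<And>x. x \<notin> X \<Longrightarrow> f x = z) \<Longrightarrow> f \<in> functions_into z X S"
  unfolding functions_into_def mem_Collect_eq by metis

text \<open>
  \<open>\<Oplus>\<^sub>x A e\<^bsub>v x\<^esub>\<close>, with the summand at \<open>x\<close> generated in degree \<open>dg x\<close>. When the
  indices \<open>x\<close> are elements of a module \<open>P\<close>, the elements have exactly the type over which
  \<^const>\<open>graded_projective\<close> tests the lifting property for \<open>P\<close>.
\<close>

definition free_module ::
  "('k, 'a, 'y) graded_scheme \<Rightarrow> (nat \<Rightarrow> 'a) \<Rightarrow> 'x set \<Rightarrow> ('x \<Rightarrow> nat) \<Rightarrow> ('x \<Rightarrow> int) \<Rightarrow>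
   ('a, 'x \<Rightarrow> 'a) graded" where
  "free_module A e X v dg =
     \<lparr>carrier = functions_into \<zero>\<^bsub>A\<^esub> X (\<lambda>x. right_corner A (e (v x))),
      mult = undefined, one = undefined, zero = (\<lambda>_. \<zero>\<^bsub>A\<^esub>),
      add = (\<lambda>f g x. f x \<oplus>\<^bsub>A\<^esub> g x), smult = (\<lambda>a f x. a \<otimes>\<^bsub>A\<^esub> f x),
      gr = (\<lambda>n. functions_into \<zero>\<^bsub>A\<^esub> X (\<lambda>x. right_corner A (e (v x)) \<inter> gr A (n - dg x)))\<rparr>"

context elementary_algebra
begin

lemma right_corner_closed: "a \<in> right_corner A f \<Longrightarrow> a \<in> carrier A"
  by (simp add: right_corner_def)

lemma right_corner_ops:
  assumes f: "f \<in> carrier A"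
  shows "\<zero>\<^bsub>A\<^esub> \<in> right_corner A f"
    "a \<in> right_corner A f \<Longrightarrow> b \<in> right_corner A f \<Longrightarrow> a \<oplus>\<^bsub>A\<^esub> b \<in> right_corner A f"
    "a \<in> right_corner A f \<Longrightarrow> \<ominus>\<^bsub>A\<^esub> a \<in> right_corner A f"
    "c \<in> carrier A \<Longrightarrow> a \<in> right_corner A f \<Longrightarrow> c \<otimes>\<^bsub>A\<^esub> a \<in> right_corner A f"
  using f by (auto simp: right_corner_def alg.l_distr alg.l_minus alg.m_assoc)

lemma right_corner_component:
  assumes f: "f \<in> gr A 0" and a: "a \<in> right_corner A f"
  shows "homogeneous_component A a n \<in> right_corner A f"
proof -
  have fc: "f \<in> carrier A" and ac: "a \<in> carrier A" "a \<otimes>\<^bsub>A\<^esub> f = a"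
    using gr.gr_closed[OF f] a by (auto simp: right_corner_def)
  have "gr.cmp (a \<otimes>\<^bsub>A\<^esub> f) (n + 0) = gr.cmp a n \<otimes>\<^bsub>A\<^esub> f"
  proof (rule component_additive_map)
    show "x \<otimes>\<^bsub>A\<^esub> f \<in> gr A (n + 0)" if "x \<in> gr A n" for n x using mult_gr[OF that f] .
  qed (use fc ac gr.graded_abelian_group_axioms in \<open>auto simp: alg.l_distr\<close>)
  then show ?thesis using ac gr.component_closed[OF ac(1)] by (simp add: right_corner_def)
qed

end

locale graded_free_module = elementary_algebra K A r e
  for K :: "('k, 'b) ring_scheme" and A :: "('k, 'a) graded" and r e +
  fixes X :: "'x set" and v :: "'x \<Rightarrow> nat" and dg :: "'x \<Rightarrow> int"
  assumes finite_X: "finite X" and v: "x \<in> X \<Longrightarrow> v x < r"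
begin

abbreviation F where "F \<equiv> free_module A e X v dg"

lemma F_carrier: "f \<in> carrier F \<longleftrightarrow> (\<forall>x. if x \<in> X then f x \<in> right_corner A (e (v x)) else f x = \<zero>\<^bsub>A\<^esub>)"
  by (simp add: free_module_def functions_into_def)

lemma F_gr: "f \<in> gr F n \<longleftrightarrow> f \<in> carrier F \<and> (\<forall>x\<in>X. f x \<in> gr A (n - dg x))"
  by (auto simp: free_module_def functions_into_def)

lemma F_ops [simp]: "\<zero>\<^bsub>F\<^esub> = (\<lambda>_. \<zero>\<^bsub>A\<^esub>)" "f \<oplus>\<^bsub>F\<^esub> g = (\<lambda>x. f x \<oplus>\<^bsub>A\<^esub> g x)"
  "a \<odot>\<^bsub>F\<^esub> f = (\<lambda>x. a \<otimes>\<^bsub>A\<^esub> f x)"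
  by (simp_all add: free_module_def)

lemma ev: "x \<in> X \<Longrightarrow> e (v x) \<in> carrier A" using e_closed v by simp

lemma F_closed: "f \<in> carrier F \<Longrightarrow> f x \<in> carrier A"
  unfolding F_carrier using right_corner_closed by (metis M.zero_closed)

lemma F_corner: "f \<in> carrier F \<Longrightarrow> x \<in> X \<Longrightarrow> f x \<otimes>\<^bsub>A\<^esub> e (v x) = f x"
  unfolding F_carrier right_corner_def by (metis (mono_tags, lifting) mem_Collect_eq)

lemma F_outside: "f \<in> carrier F \<Longrightarrow> x \<notin> X \<Longrightarrow> f x = \<zero>\<^bsub>A\<^esub>"
  unfolding F_carrier by metis

lemma abelian_group_F: "abelian_group F"
proof (rule abelian_groupI)
  show "\<zero>\<^bsub>F\<^esub> \<in> carrier F" unfolding F_carrier using ev by (auto intro: right_corner_ops)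
  show "x \<oplus>\<^bsub>F\<^esub> y \<in> carrier F" if "x \<in> carrier F" "y \<in> carrier F" for x y
    using that unfolding F_carrier by (auto intro: right_corner_ops ev)
  show "\<exists>y\<in>carrier F. y \<oplus>\<^bsub>F\<^esub> x = \<zero>\<^bsub>F\<^esub>" if "x \<in> carrier F" for x
  proof (rule bexI)
    show "(\<lambda>i. \<ominus>\<^bsub>A\<^esub> x i) \<in> carrier F"
      using that unfolding F_carrier by (auto intro: right_corner_ops ev)
    show "(\<lambda>i. \<ominus>\<^bsub>A\<^esub> x i) \<oplus>\<^bsub>F\<^esub> x = \<zero>\<^bsub>F\<^esub>" using F_closed[OF that] by (simp add: M.l_neg)
  qed
qed (auto simp: F_closed M.a_ac)

lemma F_finsum_apply:
  assumes "g \<in> S \<rightarrow> carrier F"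
  shows "(\<Oplus>\<^bsub>F\<^esub>i\<in>S. g i) x = (\<Oplus>\<^bsub>A\<^esub>i\<in>S. g i x)"
  by (rule additive_finsum[where f = "\<lambda>f. f x"])
    (use assms abelian_group_F F_closed M.abelian_group_axioms in \<open>auto intro: abelian_group.axioms\<close>)

lemma F_left_module: "left_module A F"
proof (intro left_module.intro left_module_axioms.intro abelian_group_F)
  show "ring A" by (rule alg.ring_axioms)
  show "a \<odot>\<^bsub>F\<^esub> f \<in> carrier F" if "a \<in> carrier A" "f \<in> carrier F" for a f
    using that unfolding F_carrier by (auto intro: right_corner_ops ev)
qed (auto simp: F_closed alg.l_distr alg.r_distr alg.m_assoc)

lemma F_gr_subgroup: "additive_subgroup (gr F n) F"
proof -
  interpret F: abelian_group F by (rule abelian_group_F)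
  have uminus: "(\<lambda>x. \<ominus>\<^bsub>A\<^esub> f x) = \<ominus>\<^bsub>F\<^esub> f" if f: "f \<in> carrier F" for f
  proof -
    have c: "(\<lambda>x. \<ominus>\<^bsub>A\<^esub> f x) \<in> carrier F"
      using f unfolding F_carrier by (auto intro: right_corner_ops ev)
    show ?thesis
      by (rule F.minus_equality[symmetric]) (use c f F_closed[OF f] in \<open>auto simp: M.l_neg\<close>)
  qed
  show ?thesis
  proof (intro additive_subgroup.intro group.subgroupI F.a_group)
    show "gr F n \<subseteq> carrier (add_monoid F)" using F_gr by auto
    have "\<zero>\<^bsub>F\<^esub> \<in> gr F n" using F.zero_closed gr.zero_gr by (simp add: F_gr)
    then show "gr F n \<noteq> {}" by blast
    show "a \<otimes>\<^bsub>add_monoid F\<^esub> b \<in> gr F n" if "a \<in> gr F n" "b \<in> gr F n" for a b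
      using that F.a_closed[of a b] by (simp add: F_gr gr.add_gr)
    show "inv\<^bsub>add_monoid F\<^esub> a \<in> gr F n" if a: "a \<in> gr F n" for a
    proof -
      have "\<ominus>\<^bsub>A\<^esub> a x \<in> gr A (n - dg x)" if "x \<in> X" for x
        using a that additive_subgroup.a_inv_closed[OF gr.gr_subgroup] by (auto simp: F_gr)
      then have "\<ominus>\<^bsub>F\<^esub> a \<in> gr F n"
        using a F.a_inv_closed[of a] uminus[of a, symmetric] by (simp add: F_gr)
      then show ?thesis by (simp add: a_inv_def)
    qed
  qed
qed

lemma F_direct_sum: "direct_sum_decomposition F"
proof (rule direct_sum_decompositionI[OF abelian_group_F F_gr_subgroup])
  (* The value at x of an element of degree n has degree n - dg x. *)
  let ?c = "\<lambda>f n x. if x \<in> X then gr.cmp (f x) (n - dg x) else \<zero>\<^bsub>A\<^esub>"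
  fix f n assume f: "f \<in> carrier F"
  show c_gr: "?c f n \<in> gr F n" for n
    unfolding F_gr F_carrier using f right_corner_component[OF e_gr[OF v]] gr.component_gr F_closed
    by (auto simp: F_carrier)
  have sub: "{n. ?c f n \<noteq> \<zero>\<^bsub>F\<^esub>} \<subseteq> (\<Union>x\<in>X. (\<lambda>k. k + dg x) ` {k. gr.cmp (f x) k \<noteq> \<zero>\<^bsub>A\<^esub>})"
  proof
    fix n assume "n \<in> {n. ?c f n \<noteq> \<zero>\<^bsub>F\<^esub>}"
    then obtain x where x: "x \<in> X" "gr.cmp (f x) (n - dg x) \<noteq> \<zero>\<^bsub>A\<^esub>" by (auto simp: fun_eq_iff split: if_splits)
    then show "n \<in> (\<Union>x\<in>X. (\<lambda>k. k + dg x) ` {k. gr.cmp (f x) k \<noteq> \<zero>\<^bsub>A\<^esub>})"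
      by (intro UN_I[OF x(1)] image_eqI[of _ _ "n - dg x"]) auto
  qed
  show fin: "finite {n. ?c f n \<noteq> \<zero>\<^bsub>F\<^esub>}"
    by (rule finite_subset[OF sub]) (use finite_X gr.component_finite F_closed[OF f] in auto)
  show "f = (\<Oplus>\<^bsub>F\<^esub>n\<in>{n. ?c f n \<noteq> \<zero>\<^bsub>F\<^esub>}. ?c f n)"
  proof
    fix x
    let ?S = "{n. ?c f n \<noteq> \<zero>\<^bsub>F\<^esub>}"
    have "(\<Oplus>\<^bsub>F\<^esub>n\<in>?S. ?c f n) x = (\<Oplus>\<^bsub>A\<^esub>n\<in>?S. ?c f n x)"
      by (rule F_finsum_apply) (use c_gr F_gr in auto)
    also have "\<dots> = f x"
    proof (cases "x \<in> X")
      case True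
      have fx: "f x \<in> carrier A" by (rule F_closed[OF f])
      let ?T = "(\<lambda>n. n - dg x) ` ?S"
      have "(\<Oplus>\<^bsub>A\<^esub>n\<in>?S. ?c f n x) = (\<Oplus>\<^bsub>A\<^esub>n\<in>?T. gr.cmp (f x) n)"
        using True gr.component_closed[OF fx] by (subst M.finsum_reindex) (auto simp: inj_on_def)
      also have "\<dots> = f x"
      proof (rule gr.component_sum_superset[OF fx])
        show "finite ?T" using fin by simp
        show "{n. gr.cmp (f x) n \<noteq> \<zero>\<^bsub>A\<^esub>} \<subseteq> ?T"
        proof
          fix k assume "k \<in> {n. gr.cmp (f x) n \<noteq> \<zero>\<^bsub>A\<^esub>}"
          then have "?c f (k + dg x) x \<noteq> \<zero>\<^bsub>A\<^esub>" using True by simp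
          then have "?c f (k + dg x) \<noteq> \<zero>\<^bsub>F\<^esub>" unfolding F_ops by metis
          then have "k + dg x \<in> ?S" by simp
          then show "k \<in> ?T" by (intro image_eqI[of _ _ "k + dg x"]) auto
        qed
      qed
      finally show ?thesis .
    next
      case False
      then show ?thesis using F_outside[OF f False] by simp
    qed
    finally show "f x = (\<Oplus>\<^bsub>F\<^esub>n\<in>?S. ?c f n) x" by simp
  qed
next
  let ?c = "\<lambda>f n x. if x \<in> X then gr.cmp (f x) (n - dg x) else \<zero>\<^bsub>A\<^esub>"
  show "?c (f \<oplus>\<^bsub>F\<^esub> g) n = ?c f n \<oplus>\<^bsub>F\<^esub> ?c g n" if "f \<in> carrier F" "g \<in> carrier F" for f g n
    using that F_closed by (auto simp: gr.component_add)
  show "?c f n = (if n = m then f else \<zero>\<^bsub>F\<^esub>)" if f: "f \<in> gr F m" for f m n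
  proof
    fix x
    show "?c f n x = (if n = m then f else \<zero>\<^bsub>F\<^esub>) x"
    proof (cases "x \<in> X")
      case True
      then have "f x \<in> gr A (m - dg x)" using f by (auto simp: F_gr)
      then show ?thesis using True gr.component_homogeneous[of "f x" "m - dg x" "n - dg x"] by auto
    next
      case False
      then show ?thesis using f F_outside[of f x] by (auto simp: F_gr)
    qed
  qed
qed

lemma F_module: "graded_left_module A F"
proof -
  interpret F: left_module A F by (rule F_left_module)
  show ?thesis
  proof (intro graded_left_module.intro graded_left_module_axioms.intro)
    show "a \<odot>\<^bsub>F\<^esub> f \<in> gr F (m + n)" if a: "a \<in> gr A m" and f: "f \<in> gr F n" for a f m n
    proof -
      have "a \<otimes>\<^bsub>A\<^esub> f x \<in> gr A (m + n - dg x)" if "x \<in> X" for x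
        using mult_gr[OF a, of "f x" "n - dg x"] f that by (simp add: F_gr algebra_simps)
      then show ?thesis using f F.smult_closed[OF gr.gr_closed[OF a], of f] by (simp add: F_gr)
    qed
  qed (fact alg.ring_axioms F.M.abelian_group_axioms F.smult_closed F.smult_l_distr F.smult_r_distr
      F.smult_assoc F.smult_one F_direct_sum)+
qed

definition basis_vec :: "'x \<Rightarrow> 'x \<Rightarrow> 'a" where
  "basis_vec x = (\<lambda>y. if y = x then e (v x) else \<zero>\<^bsub>A\<^esub>)"

lemma basis_vec_gr: "x \<in> X \<Longrightarrow> basis_vec x \<in> gr F (dg x)"
  by (auto simp: F_gr F_carrier basis_vec_def right_corner_def e_closed e_idem v e_gr gr.zero_gr)

lemma basis_vec_closed: "x \<in> X \<Longrightarrow> basis_vec x \<in> carrier F"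
  using basis_vec_gr F_gr by blast

lemma basis_vec_expansion:
  assumes f: "f \<in> carrier F"
  shows "f = (\<Oplus>\<^bsub>F\<^esub>x\<in>X. f x \<odot>\<^bsub>F\<^esub> basis_vec x)"
proof
  interpret F: left_module A F by (rule F_left_module)
  fix y
  have "(\<Oplus>\<^bsub>F\<^esub>x\<in>X. f x \<odot>\<^bsub>F\<^esub> basis_vec x) y = (\<Oplus>\<^bsub>A\<^esub>x\<in>X. (f x \<odot>\<^bsub>F\<^esub> basis_vec x) y)"
    by (rule F_finsum_apply) (use F.smult_closed[OF F_closed[OF f] basis_vec_closed] in auto)
  also have "\<dots> = (\<Oplus>\<^bsub>A\<^esub>x\<in>X. if y = x then f x else \<zero>\<^bsub>A\<^esub>)"
    using F_closed[OF f] F_corner[OF f] by (intro M.finsum_cong') (auto simp: basis_vec_def)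
  also have "\<dots> = f y"
  proof (cases "y \<in> X")
    case True
    then show ?thesis using M.finsum_singleton[OF True finite_X] F_closed[OF f] by auto
  next
    case False
    then have "(\<Oplus>\<^bsub>A\<^esub>x\<in>X. if y = x then f x else \<zero>\<^bsub>A\<^esub>) = (\<Oplus>\<^bsub>A\<^esub>x\<in>X. \<zero>\<^bsub>A\<^esub>)"
      by (intro M.finsum_cong') auto
    then show ?thesis using F_outside[OF f False] by simp
  qed
  finally show "f y = (\<Oplus>\<^bsub>F\<^esub>x\<in>X. f x \<odot>\<^bsub>F\<^esub> basis_vec x) y" by simp
qed

text \<open>
  An element is the combination of the basis vectors with its own values as coefficients, so a
  homomorphism kills it if it kills every basis vector that occurs.
\<close>

lemma linear_vanishing:
  assumes N: "graded_left_module A N" and p: "p \<in> graded_hom A F N"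
    and f: "f \<in> carrier F"
    and van: "\<And>x. x \<in> X \<Longrightarrow> f x = \<zero>\<^bsub>A\<^esub> \<or> p (basis_vec x) = \<zero>\<^bsub>N\<^esub>"
  shows "p f = \<zero>\<^bsub>N\<^esub>"
proof -
  interpret F: left_module A F by (rule F_left_module)
  interpret N: graded_left_module A N by (rule N)
  have "p f = p (\<Oplus>\<^bsub>F\<^esub>x\<in>X. f x \<odot>\<^bsub>F\<^esub> basis_vec x)" using basis_vec_expansion[OF f] by simp
  also have "\<dots> = (\<Oplus>\<^bsub>N\<^esub>x\<in>X. p (f x \<odot>\<^bsub>F\<^esub> basis_vec x))"
    by (rule additive_finsum[where f = p and M = F and N = N]) (use graded_homD(1,2)[OF p] F.M.abelian_monoid_axioms
        N.M.abelian_group_axioms F.smult_closed[OF F_closed[OF f] basis_vec_closed] in auto)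
  also have "\<dots> = (\<Oplus>\<^bsub>N\<^esub>x\<in>X. \<zero>\<^bsub>N\<^esub>)"
  proof (rule N.M.finsum_cong')
    fix x assume x: "x \<in> X"
    have u: "p (basis_vec x) \<in> carrier N" using graded_homD(1)[OF p] basis_vec_closed[OF x] by auto
    have "p (f x \<odot>\<^bsub>F\<^esub> basis_vec x) = f x \<odot>\<^bsub>N\<^esub> p (basis_vec x)"
      by (rule graded_homD(3)[OF p F_closed[OF f] basis_vec_closed[OF x]])
    then show "p (f x \<odot>\<^bsub>F\<^esub> basis_vec x) = \<zero>\<^bsub>N\<^esub>"
      using van[OF x] u F_closed[OF f] N.smult_zero_left N.smult_zero_right by auto
  qed auto
  finally show ?thesis by simp
qed

text \<open>
  Dimension of a direct sum by induction on the index set: evaluation at the new index is onto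
  its summand, and its kernel is the sum over the other indices.
\<close>

lemma functions_into_dim:
  assumes Y: "Y \<subseteq> X"
    and S: "\<And>x. x \<in> Y \<Longrightarrow> fin_dim_subspace K A (S x)" "\<And>x. x \<in> Y \<Longrightarrow> S x \<subseteq> right_corner A (e (v x))"
  shows "fin_dim_subspace K (restrict_scalars A F) (functions_into \<zero>\<^bsub>A\<^esub> Y S) \<and>
    subspace_dim K (restrict_scalars A F) (functions_into \<zero>\<^bsub>A\<^esub> Y S) = (\<Sum>x\<in>Y. subspace_dim K A (S x))"
  using finite_subset[OF Y finite_X] Y S
proof (induction Y rule: finite_induct)
  case empty
  have "functions_into \<zero>\<^bsub>A\<^esub> {} S = {\<zero>\<^bsub>restrict_scalars A F\<^esub>}"
    by (auto simp: functions_into_def restrict_scalars_def)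
  then show ?case using subspace_dim_zero[OF restrict_scalars_vectorspace[OF F_left_module]] by simp
next
  case (insert y Y)
  note V = restrict_scalars_vectorspace[OF F_left_module]
  interpret V: vectorspace K "restrict_scalars A F" by (rule V)
  interpret F: left_module A F by (rule F_left_module)
  let ?G = "functions_into \<zero>\<^bsub>A\<^esub> (insert y Y) S"
  have S: "VectorSpace.subspace K (S x) A" if "x \<in> insert y Y" for x
    using insert.prems(2)[OF that] by (simp add: fin_dim_subspace_def)
  have GF: "?G \<subseteq> carrier F"
  proof
    fix f assume f: "f \<in> ?G"
    show "f \<in> carrier F" unfolding F_carrier
    proof
      fix x
      show "if x \<in> X then f x \<in> right_corner A (e (v x)) else f x = \<zero>\<^bsub>A\<^esub>"
      proof (cases "x \<in> insert y Y")
        case True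
        then show ?thesis using f insert.prems(1) insert.prems(3)[OF True] unfolding functions_into_def by auto
      next
        case False
        then have "f x = \<zero>\<^bsub>A\<^esub>" using f unfolding functions_into_def by auto
        then show ?thesis using right_corner_ops(1)[OF ev] by auto
      qed
    qed
  qed
  have sm: "(c \<odot>\<^bsub>A\<^esub> \<one>\<^bsub>A\<^esub>) \<otimes>\<^bsub>A\<^esub> a = c \<odot>\<^bsub>A\<^esub> a" if "c \<in> carrier K" "a \<in> carrier A" for c a
    using that by (simp add: smult_mult)
  have G: "VectorSpace.subspace K ?G (restrict_scalars A F)"
  proof (rule V.subspaceI)
    show "?G \<subseteq> carrier (restrict_scalars A F)" using GF by (simp add: restrict_scalars_def)
    show "\<zero>\<^bsub>restrict_scalars A F\<^esub> \<in> ?G" using subspaceD(2)[OF S] by (auto simp: functions_into_def restrict_scalars_def)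
    show "f \<oplus>\<^bsub>restrict_scalars A F\<^esub> g \<in> ?G" if "f \<in> ?G" "g \<in> ?G" for f g
      using that subspaceD(3)[OF S] by (auto simp: functions_into_def restrict_scalars_def)
    show "c \<odot>\<^bsub>restrict_scalars A F\<^esub> f \<in> ?G" if c: "c \<in> carrier K" and f: "f \<in> ?G" for c f
    proof -
      have "f x \<in> carrier A" for x using F_closed GF f by auto
      then show ?thesis using f subspaceD(4)[OF S c]
        by (auto simp: functions_into_def restrict_scalars_def sm[OF c] c)
    qed
  qed
  have im: "(\<lambda>f. f y) ` ?G = S y"
  proof (intro equalityI subsetI)
    fix a assume "a \<in> S y"
    then have "(\<lambda>x. if x = y then a else \<zero>\<^bsub>A\<^esub>) \<in> ?G"
      using subspaceD(2)[OF S] by (auto simp: functions_into_def)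
    then show "a \<in> (\<lambda>f. f y) ` ?G" by (rule rev_image_eqI) simp
  qed (auto simp: functions_into_def)
  have ker: "{f \<in> ?G. f y = \<zero>\<^bsub>A\<^esub>} = functions_into \<zero>\<^bsub>A\<^esub> Y S"
    using insert.hyps(2) subspaceD(2)[OF S] by (fastforce simp: functions_into_def split: if_splits)
  have Sy: "S y \<subseteq> carrier A" using subspaceD(1)[OF S] by auto
  have add: "(f \<oplus>\<^bsub>restrict_scalars A F\<^esub> g) y = f y \<oplus>\<^bsub>A\<^esub> g y" for f g by (simp add: restrict_scalars_def)
  have smult: "(c \<odot>\<^bsub>restrict_scalars A F\<^esub> f) y = c \<odot>\<^bsub>A\<^esub> f y" if "c \<in> carrier K" "f \<in> ?G" for c f
    using that GF F_closed by (auto simp: restrict_scalars_def sm subsetD)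
  note rn = rank_nullity_subspace[where f = "\<lambda>f. f y", OF V vectorspace_A G im Sy add smult, unfolded ker]
  have IH: "fin_dim_subspace K (restrict_scalars A F) (functions_into \<zero>\<^bsub>A\<^esub> Y S)"
    "subspace_dim K (restrict_scalars A F) (functions_into \<zero>\<^bsub>A\<^esub> Y S) = (\<Sum>x\<in>Y. subspace_dim K A (S x))"
    using insert by auto
  have Gfin: "fin_dim_subspace K (restrict_scalars A F) ?G"
    by (rule rn(5)) (use IH insert.prems(2) in auto)
  show ?case using Gfin rn(4)[OF _ _ Gfin] IH(2) insert.hyps by simp
qed

end

section \<open>Minimal generating sets\<close>

definition module_span :: "('k, 'a, 'y) graded_scheme \<Rightarrow> ('a, 'm) graded \<Rightarrow> 'm set \<Rightarrow> 'm set" where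
  "module_span A M Y = {\<Oplus>\<^bsub>M\<^esub>y\<in>Y. c y \<odot>\<^bsub>M\<^esub> y | c. c \<in> Y \<rightarrow> carrier A}"

lemma module_spanI: "c \<in> Y \<rightarrow> carrier A \<Longrightarrow> (\<Oplus>\<^bsub>M\<^esub>y\<in>Y. c y \<odot>\<^bsub>M\<^esub> y) \<in> module_span A M Y"
  unfolding module_span_def by (intro CollectI exI[of _ c] conjI refl)

lemma module_spanE:
  assumes "x \<in> module_span A M Y"
  obtains c where "c \<in> Y \<rightarrow> carrier A" "x = (\<Oplus>\<^bsub>M\<^esub>y\<in>Y. c y \<odot>\<^bsub>M\<^esub> y)"
  using assms unfolding module_span_def by blast

context
  fixes A :: "('k, 'a, 'y) graded_scheme" and M :: "('a, 'm) graded" and Y :: "'m set"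
  assumes M: "left_module A M" and Y: "Y \<subseteq> carrier M"
begin

interpretation left_module A M by (rule M)

lemma module_span_closed: "module_span A M Y \<subseteq> carrier M"
  using Y smult_closed by (auto simp: module_span_def intro!: M.finsum_closed)

lemma module_span_zero: "\<zero>\<^bsub>M\<^esub> \<in> module_span A M Y"
proof -
  have "(\<Oplus>\<^bsub>M\<^esub>y\<in>Y. \<zero>\<^bsub>A\<^esub> \<odot>\<^bsub>M\<^esub> y) = (\<Oplus>\<^bsub>M\<^esub>y\<in>Y. \<zero>\<^bsub>M\<^esub>)"
    using Y by (intro M.finsum_cong') (auto simp: smult_zero_left)
  then show ?thesis using module_spanI[of "\<lambda>_. \<zero>\<^bsub>A\<^esub>" Y A M] by simp
qed

lemma module_span_add:
  assumes "x \<in> module_span A M Y" "y \<in> module_span A M Y"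
  shows "x \<oplus>\<^bsub>M\<^esub> y \<in> module_span A M Y"
proof -
  obtain c d where c: "c \<in> Y \<rightarrow> carrier A" "x = (\<Oplus>\<^bsub>M\<^esub>y\<in>Y. c y \<odot>\<^bsub>M\<^esub> y)"
    and d: "d \<in> Y \<rightarrow> carrier A" "y = (\<Oplus>\<^bsub>M\<^esub>y\<in>Y. d y \<odot>\<^bsub>M\<^esub> y)"
    using assms by (elim module_spanE)
  have "x \<oplus>\<^bsub>M\<^esub> y = (\<Oplus>\<^bsub>M\<^esub>y\<in>Y. c y \<odot>\<^bsub>M\<^esub> y \<oplus>\<^bsub>M\<^esub> d y \<odot>\<^bsub>M\<^esub> y)"
    unfolding c(2) d(2) using c(1) d(1) Y by (subst M.finsum_addf) (auto intro!: smult_closed)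
  also have "\<dots> = (\<Oplus>\<^bsub>M\<^esub>y\<in>Y. (c y \<oplus>\<^bsub>A\<^esub> d y) \<odot>\<^bsub>M\<^esub> y)"
    using c(1) d(1) Y smult_closed by (intro M.finsum_cong') (auto simp: smult_l_distr Pi_iff subset_eq)
  also have "\<dots> \<in> module_span A M Y" by (rule module_spanI) (use c(1) d(1) in auto)
  finally show ?thesis .
qed

lemma module_span_smult:
  assumes a: "a \<in> carrier A" and "x \<in> module_span A M Y"
  shows "a \<odot>\<^bsub>M\<^esub> x \<in> module_span A M Y"
proof -
  obtain c where c: "c \<in> Y \<rightarrow> carrier A" "x = (\<Oplus>\<^bsub>M\<^esub>y\<in>Y. c y \<odot>\<^bsub>M\<^esub> y)"
    using assms(2) by (elim module_spanE)
  have "a \<odot>\<^bsub>M\<^esub> x = (\<Oplus>\<^bsub>M\<^esub>y\<in>Y. a \<odot>\<^bsub>M\<^esub> (c y \<odot>\<^bsub>M\<^esub> y))"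
    unfolding c(2) using a c(1) Y smult_closed by (intro smult_finsum_right) auto
  also have "\<dots> = (\<Oplus>\<^bsub>M\<^esub>y\<in>Y. (a \<otimes>\<^bsub>A\<^esub> c y) \<odot>\<^bsub>M\<^esub> y)"
    using a c(1) Y smult_closed by (intro M.finsum_cong') (auto simp: smult_assoc Pi_iff subset_eq)
  also have "\<dots> \<in> module_span A M Y" by (rule module_spanI) (use a c(1) in auto)
  finally show ?thesis .
qed

lemma module_span_finsum:
  assumes f: "f \<in> S \<rightarrow> module_span A M Y"
  shows "finsum M f S \<in> module_span A M Y"
  using f
proof (induction S rule: infinite_finite_induct)
  case (insert x F)
  then show ?case
    using module_span_closed by (subst M.finsum_insert) (auto intro: module_span_add)
qed (auto simp: module_span_zero)

lemma module_span_superset: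
  assumes "finite Y"
  shows "Y \<subseteq> module_span A M Y"
proof
  fix x assume x: "x \<in> Y"
  let ?c = "\<lambda>y. if y = x then \<one>\<^bsub>A\<^esub> else \<zero>\<^bsub>A\<^esub>"
  have "(\<Oplus>\<^bsub>M\<^esub>y\<in>Y. ?c y \<odot>\<^bsub>M\<^esub> y) = (\<Oplus>\<^bsub>M\<^esub>y\<in>Y. if x = y then y else \<zero>\<^bsub>M\<^esub>)"
    using Y by (intro M.finsum_cong') (auto simp: smult_one smult_zero_left)
  also have "\<dots> = x" using M.finsum_singleton[OF x assms, of "\<lambda>y. y"] Y by auto
  finally show "x \<in> module_span A M Y" using module_spanI[of ?c Y A M] by simp
qed

lemma module_span_least:
  assumes X: "X \<subseteq> module_span A M Y"
  shows "module_span A M X \<subseteq> module_span A M Y"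
proof
  fix x assume "x \<in> module_span A M X"
  then obtain c where c: "c \<in> X \<rightarrow> carrier A" "x = (\<Oplus>\<^bsub>M\<^esub>y\<in>X. c y \<odot>\<^bsub>M\<^esub> y)"
    by (elim module_spanE)
  show "x \<in> module_span A M Y" unfolding c(2)
    by (rule module_span_finsum) (use c(1) X module_span_smult in auto)
qed

end

context elementary_algebra
begin

text \<open>
  Split each generator \<open>x\<close> into the elements \<open>e\<^sub>i x\<^sub>n\<close>; they generate it because \<open>1 = \<Sum>\<^sub>i e\<^sub>i\<close>.
\<close>

lemma vertex_homogeneous_generators:
  fixes P :: "('a, 'm) graded"
  assumes P: "graded_left_module A P" and fg: "finitely_generated A P"
  shows "\<exists>X. finite X \<and> (\<forall>x\<in>X. \<exists>i<r. \<exists>n. x \<in> vertex_part P i n) \<and> module_span A P X = carrier P"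
proof -
  interpret P: graded_left_module A P by fact
  obtain Y where "finite Y \<and> Y \<subseteq> carrier P \<and>
      (\<forall>m\<in>carrier P. \<exists>c\<in>Y \<rightarrow> carrier A. m = (\<Oplus>\<^bsub>P\<^esub>x\<in>Y. c x \<odot>\<^bsub>P\<^esub> x))"
    using fg unfolding finitely_generated_def by (elim exE)
  then have Y: "finite Y" "Y \<subseteq> carrier P"
    and gen: "\<forall>m\<in>carrier P. \<exists>c\<in>Y \<rightarrow> carrier A. m = (\<Oplus>\<^bsub>P\<^esub>x\<in>Y. c x \<odot>\<^bsub>P\<^esub> x)"
    by simp_all
  let ?I = "SIGMA x:Y. {..<r} \<times> {n. P.gr.cmp x n \<noteq> \<zero>\<^bsub>P\<^esub>}"
  define X where "X = (\<lambda>(x, i, n). e i \<odot>\<^bsub>P\<^esub> P.gr.cmp x n) ` ?I"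
  have fin: "finite X"
    unfolding X_def by (intro finite_imageI finite_SigmaI finite_cartesian_product)
      (use Y P.gr.component_finite in auto)
  have vp: "\<exists>i<r. \<exists>n. x \<in> vertex_part P i n" if x: "x \<in> X" for x
  proof -
    obtain y i n where y: "y \<in> Y" "i < r" "x = e i \<odot>\<^bsub>P\<^esub> P.gr.cmp y n"
      using x unfolding X_def by auto
    have "P.gr.cmp y n \<in> gr P n" using P.gr.component_gr y(1) Y(2) by auto
    then show ?thesis using y(2,3) by blast
  qed
  have Xc: "X \<subseteq> carrier P"
  proof
    fix x assume "x \<in> X"
    then obtain i n where "i < r" "x \<in> vertex_part P i n" using vp by blast
    then show "x \<in> carrier P" unfolding vertex_part_iff[OF P \<open>i < r\<close>] using P.gr.gr_closed by blast
  qed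
  note sp = module_span_finsum[OF P.left_module Xc] module_span_superset[OF P.left_module Xc fin]
  have "Y \<subseteq> module_span A P X"
  proof
    fix x assume x: "x \<in> Y"
    then have xc: "x \<in> carrier P" using Y by auto
    have "P.gr.cmp x n \<in> module_span A P X" if n: "P.gr.cmp x n \<noteq> \<zero>\<^bsub>P\<^esub>" for n
    proof -
      have "P.gr.cmp x n = (\<Oplus>\<^bsub>A\<^esub>i\<in>{..<r}. e i) \<odot>\<^bsub>P\<^esub> P.gr.cmp x n"
        using P.gr.component_closed[OF xc] by (simp add: P.smult_one flip: one_eq_sum_e)
      also have "\<dots> = (\<Oplus>\<^bsub>P\<^esub>i\<in>{..<r}. e i \<odot>\<^bsub>P\<^esub> P.gr.cmp x n)"
        using P.gr.component_closed[OF xc] e_closed by (intro P.smult_finsum_left) auto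
      also have "\<dots> \<in> module_span A P X"
      proof (rule sp(1), rule Pi_I)
        fix i assume "i \<in> {..<r}"
        then have "(x, i, n) \<in> ?I" using x n by simp
        then have "e i \<odot>\<^bsub>P\<^esub> P.gr.cmp x n \<in> X" unfolding X_def by (rule rev_image_eqI) simp
        then show "e i \<odot>\<^bsub>P\<^esub> P.gr.cmp x n \<in> module_span A P X" using sp(2) by auto
      qed
      finally show ?thesis .
    qed
    then have "(\<Oplus>\<^bsub>P\<^esub>n\<in>{n. P.gr.cmp x n \<noteq> \<zero>\<^bsub>P\<^esub>}. P.gr.cmp x n) \<in> module_span A P X"
      by (intro sp(1)) auto
    then show "x \<in> module_span A P X" using P.gr.component_sum[OF xc] by simp
  qed
  then have "module_span A P Y \<subseteq> module_span A P X" by (rule module_span_least[OF P.left_module Xc])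
  moreover have "carrier P \<subseteq> module_span A P Y"
  proof
    fix m assume "m \<in> carrier P"
    then obtain c where "c \<in> Y \<rightarrow> carrier A" "m = (\<Oplus>\<^bsub>P\<^esub>x\<in>Y. c x \<odot>\<^bsub>P\<^esub> x)"
      using gen by (elim ballE[of _ _ m]) auto
    then show "m \<in> module_span A P Y" by (simp add: module_spanI)
  qed
  ultimately have "module_span A P X = carrier P" using module_span_closed[OF P.left_module Xc] by auto
  then show ?thesis using fin vp by (intro exI[of _ X] conjI ballI)
qed

lemma minimal_vertex_homogeneous_generators:
  fixes P :: "('a, 'm) graded"
  assumes P: "graded_left_module A P" and fg: "finitely_generated A P"
  obtains X v dg where "finite X" "\<And>x. x \<in> X \<Longrightarrow> v x < r" "\<And>x. x \<in> X \<Longrightarrow> x \<in> vertex_part P (v x) (dg x)"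
    "module_span A P X = carrier P" "\<And>x. x \<in> X \<Longrightarrow> module_span A P (X - {x}) \<noteq> carrier P"
proof -
  (* Omitting an element from a generating set of least cardinality destroys generation. *)
  define good where "good X \<longleftrightarrow> finite X \<and> (\<forall>x\<in>X. \<exists>i<r. \<exists>n. x \<in> vertex_part P i n) \<and>
    module_span A P X = carrier P" for X
  have "\<exists>X. good X" unfolding good_def by (rule vertex_homogeneous_generators[OF P fg])
  then obtain X where X: "good X" "\<And>Y. good Y \<Longrightarrow> card X \<le> card Y"
    using ex_has_least_nat[of good _ card] by metis
  have "\<forall>x. \<exists>i n. x \<in> X \<longrightarrow> i < r \<and> x \<in> vertex_part P i n" using X(1) unfolding good_def by blast
  then obtain v dg where vd: "\<And>x. x \<in> X \<Longrightarrow> v x < r \<and> x \<in> vertex_part P (v x) (dg x)"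
    by metis
  have "module_span A P (X - {x}) \<noteq> carrier P" if x: "x \<in> X" for x
  proof
    assume "module_span A P (X - {x}) = carrier P"
    then have "good (X - {x})" using X(1) by (simp add: good_def)
    then have "card X \<le> card (X - {x})" by (rule X(2))
    moreover have "card (X - {x}) < card X" using x X(1) by (intro card_Diff1_less) (auto simp: good_def)
    ultimately show False by simp
  qed
  then show ?thesis using that[of X v dg] X(1) vd by (auto simp: good_def)
qed

end

section \<open>Graded projective modules are free on minimal generators\<close>

text \<open>
  The scalar multiplication of \<^const>\<open>quotient_module\<close> is a union over representatives; all of them
  give the same coset, as \<open>N\<close> is stable under \<open>a\<close>. This serves both \<open>P / J P\<close> and \<open>\<G>\<^sub>A\<^sup>+\<close>.
\<close>

lemma quotient_smult_coset:
  assumes M: "abelian_group M" and N: "additive_subgroup N M"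
    and closed: "\<And>y. y \<in> carrier M \<Longrightarrow> a \<odot>\<^bsub>M\<^esub> y \<in> carrier M"
    and distr: "\<And>y z. y \<in> carrier M \<Longrightarrow> z \<in> carrier M \<Longrightarrow> a \<odot>\<^bsub>M\<^esub> (y \<oplus>\<^bsub>M\<^esub> z) = a \<odot>\<^bsub>M\<^esub> y \<oplus>\<^bsub>M\<^esub> a \<odot>\<^bsub>M\<^esub> z"
    and aN: "\<And>y. y \<in> N \<Longrightarrow> a \<odot>\<^bsub>M\<^esub> y \<in> N"
    and x: "x \<in> carrier M"
  shows "(\<Union>y\<in>N +>\<^bsub>M\<^esub> x. N +>\<^bsub>M\<^esub> (a \<odot>\<^bsub>M\<^esub> y)) = N +>\<^bsub>M\<^esub> (a \<odot>\<^bsub>M\<^esub> x)"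
proof -
  interpret M: abelian_group M by fact
  interpret N: abelian_subgroup N M by (rule abelian_subgroupI3[OF N M])
  have "N +>\<^bsub>M\<^esub> (a \<odot>\<^bsub>M\<^esub> y) = N +>\<^bsub>M\<^esub> (a \<odot>\<^bsub>M\<^esub> x)" if y: "y \<in> N +>\<^bsub>M\<^esub> x" for y
  proof -
    obtain n where n: "n \<in> N" "y = n \<oplus>\<^bsub>M\<^esub> x" using y by (auto simp: a_r_coset_def')
    have nc: "n \<in> carrier M" "a \<odot>\<^bsub>M\<^esub> n \<in> carrier M" using n(1) N.a_subset aN by auto
    have "N +>\<^bsub>M\<^esub> (a \<odot>\<^bsub>M\<^esub> y) = (N +>\<^bsub>M\<^esub> (a \<odot>\<^bsub>M\<^esub> n)) +>\<^bsub>M\<^esub> (a \<odot>\<^bsub>M\<^esub> x)"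
      unfolding n(2) using distr[OF nc(1) x] M.a_coset_add_assoc[OF N.a_subset nc(2) closed[OF x]] by simp
    then show ?thesis using N.a_rcos_const[OF aN[OF n(1)]] by simp
  qed
  moreover have "x \<in> N +>\<^bsub>M\<^esub> x" by (rule N.a_rcos_self[OF x])
  ultimately show ?thesis by blast
qed

text \<open>
  The generators \<open>X\<close>, each with a vertex \<open>v x\<close> and a degree \<open>dg x\<close>, are minimal in that none may be
  omitted. The free module on them plays the role of a projective cover of \<open>P\<close>.
\<close>

locale minimal_cover = graded_free_module K A r e X v dg + P: graded_left_module A P
  for K :: "('k, 'b) ring_scheme" and A :: "('k, 'a) graded" and r e
    and X :: "'m set" and v dg and P :: "('a, 'm) graded" +
  assumes generators: "x \<in> X \<Longrightarrow> x \<in> vertex_part P (v x) (dg x)"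
    and spanning: "module_span A P X = carrier P"
    and minimal: "x \<in> X \<Longrightarrow> module_span A P (X - {x}) \<noteq> carrier P"
begin

definition cover :: "('m \<Rightarrow> 'a) \<Rightarrow> 'm" where
  "cover f = (\<Oplus>\<^bsub>P\<^esub>x\<in>X. f x \<odot>\<^bsub>P\<^esub> x)"

lemma generator_gr: "x \<in> X \<Longrightarrow> x \<in> gr P (dg x)" "x \<in> X \<Longrightarrow> e (v x) \<odot>\<^bsub>P\<^esub> x = x"
  using generators[of x] vertex_part_iff[OF P.graded_left_module_axioms v] by blast+

lemma X_closed: "X \<subseteq> carrier P"
  using generator_gr(1) P.gr.gr_closed by auto

lemma summand_closed: "f \<in> carrier F \<Longrightarrow> x \<in> X \<Longrightarrow> f x \<odot>\<^bsub>P\<^esub> x \<in> carrier P"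
  using F_closed P.smult_closed X_closed by blast

lemma cover_hom: "cover \<in> graded_hom A F P"
  unfolding graded_hom_def LinearCombinations.module_hom_def
proof (intro CollectI conjI allI impI image_subsetI)
  show "cover \<in> carrier F \<rightarrow> carrier P"
    using summand_closed by (auto simp: cover_def intro!: P.M.finsum_closed)
  show "cover (f \<oplus>\<^bsub>F\<^esub> g) = cover f \<oplus>\<^bsub>P\<^esub> cover g" if "f \<in> carrier F \<and> g \<in> carrier F" for f g
  proof -
    have "cover f \<oplus>\<^bsub>P\<^esub> cover g = (\<Oplus>\<^bsub>P\<^esub>x\<in>X. f x \<odot>\<^bsub>P\<^esub> x \<oplus>\<^bsub>P\<^esub> g x \<odot>\<^bsub>P\<^esub> x)"
      unfolding cover_def using that summand_closed by (subst P.M.finsum_addf) auto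
    also have "\<dots> = cover (f \<oplus>\<^bsub>F\<^esub> g)"
      unfolding cover_def
    proof (rule P.M.finsum_cong')
      show "(\<lambda>x. (f \<oplus>\<^bsub>F\<^esub> g) x \<odot>\<^bsub>P\<^esub> x) \<in> X \<rightarrow> carrier P"
        using that F_closed X_closed by (auto intro!: P.smult_closed)
      fix x assume "x \<in> X"
      then show "f x \<odot>\<^bsub>P\<^esub> x \<oplus>\<^bsub>P\<^esub> g x \<odot>\<^bsub>P\<^esub> x = (f \<oplus>\<^bsub>F\<^esub> g) x \<odot>\<^bsub>P\<^esub> x"
        using that F_closed X_closed by (simp add: P.smult_l_distr subset_eq)
    qed simp
    finally show ?thesis by simp
  qed
  show "cover (a \<odot>\<^bsub>F\<^esub> f) = a \<odot>\<^bsub>P\<^esub> cover f" if "a \<in> carrier A \<and> f \<in> carrier F" for a f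
  proof -
    have "a \<odot>\<^bsub>P\<^esub> cover f = (\<Oplus>\<^bsub>P\<^esub>x\<in>X. a \<odot>\<^bsub>P\<^esub> (f x \<odot>\<^bsub>P\<^esub> x))"
      unfolding cover_def using that summand_closed by (intro P.smult_finsum_right) auto
    also have "\<dots> = cover (a \<odot>\<^bsub>F\<^esub> f)"
      unfolding cover_def
    proof (rule P.M.finsum_cong')
      show "(\<lambda>x. (a \<odot>\<^bsub>F\<^esub> f) x \<odot>\<^bsub>P\<^esub> x) \<in> X \<rightarrow> carrier P"
        using that F_closed X_closed by (auto intro!: P.smult_closed)
      fix x assume "x \<in> X"
      then show "a \<odot>\<^bsub>P\<^esub> (f x \<odot>\<^bsub>P\<^esub> x) = (a \<odot>\<^bsub>F\<^esub> f) x \<odot>\<^bsub>P\<^esub> x"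
        using that F_closed X_closed by (simp add: P.smult_assoc subset_eq)
    qed simp
    finally show ?thesis by simp
  qed
  show "cover f \<in> gr P n" if f: "f \<in> gr F n" for f n
    unfolding cover_def
  proof (rule P.gr.finsum_gr, rule Pi_I)
    fix x assume x: "x \<in> X"
    have "f x \<in> gr A (n - dg x)" using f x F_gr by auto
    from P.smult_gr[OF this generator_gr(1)[OF x]] show "f x \<odot>\<^bsub>P\<^esub> x \<in> gr P n" by simp
  qed
qed

lemma cover_closed: "f \<in> carrier F \<Longrightarrow> cover f \<in> carrier P"
  using graded_homD(1)[OF cover_hom] by auto

lemma cover_surj: "cover ` carrier F = carrier P"
proof
  show "cover ` carrier F \<subseteq> carrier P" using graded_homD(1)[OF cover_hom] by auto
  show "carrier P \<subseteq> cover ` carrier F"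
  proof
    fix p assume "p \<in> carrier P"
    then obtain c where c: "c \<in> X \<rightarrow> carrier A" "p = (\<Oplus>\<^bsub>P\<^esub>x\<in>X. c x \<odot>\<^bsub>P\<^esub> x)"
      unfolding spanning[symmetric] by (elim module_spanE)
    let ?f = "\<lambda>x. if x \<in> X then c x \<otimes>\<^bsub>A\<^esub> e (v x) else \<zero>\<^bsub>A\<^esub>"
    have f: "?f \<in> carrier F"
      using c(1) ev v e_idem by (auto simp: F_carrier right_corner_def alg.m_assoc Pi_iff)
    have "p = cover ?f" unfolding c(2) cover_def
    proof (rule P.M.finsum_cong')
      show "(\<lambda>x. ?f x \<odot>\<^bsub>P\<^esub> x) \<in> X \<rightarrow> carrier P" using summand_closed[OF f] by auto
      fix x assume x: "x \<in> X"
      have "c x \<in> carrier A" "x \<in> carrier P" using x c(1) X_closed by auto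
      then show "c x \<odot>\<^bsub>P\<^esub> x = ?f x \<odot>\<^bsub>P\<^esub> x"
        using P.smult_assoc[of "c x" "e (v x)" x] ev[OF x] x generator_gr(2)[OF x] by simp
    qed simp
    then show "p \<in> cover ` carrier F" using f by blast
  qed
qed

text \<open>
  A coefficient of degree zero is a multiple \<open>c e\<^bsub>v x\<^esub>\<close>. If \<open>c\<close> were nonzero, dividing by it would
  express the generator \<open>x = e\<^bsub>v x\<^esub> x\<close> through the others, against minimality.
\<close>

lemma relation_coefficient:
  assumes f: "f \<in> gr F n" and rel: "cover f = \<zero>\<^bsub>P\<^esub>" and x: "x \<in> X" "dg x = n"
  shows "f x = \<zero>\<^bsub>A\<^esub>"
proof (rule ccontr)
  assume nz: "f x \<noteq> \<zero>\<^bsub>A\<^esub>"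
  have fF: "f \<in> carrier F" using f F_gr by blast
  have "f x \<in> gr A 0" using f x by (auto simp: F_gr)
  then obtain c where c: "c \<in> carrier K" "f x = c \<odot>\<^bsub>A\<^esub> e (v x)"
    using gr_0_mult_e[of "f x" "v x"] v[OF x(1)] F_corner[OF fF x(1)] by auto
  have "c \<noteq> \<zero>\<^bsub>K\<^esub>" using nz c ev[OF x(1)] by auto
  then have ci: "inv\<^bsub>K\<^esub> c \<in> carrier K" "inv\<^bsub>K\<^esub> c \<otimes>\<^bsub>K\<^esub> c = \<one>\<^bsub>K\<^esub>"
    using c(1) field_Units by (auto intro: Units_inv_closed Units_l_inv)
  (* Rescale so that the coefficient of x becomes the idempotent that fixes x. *)
  let ?b = "inv\<^bsub>K\<^esub> c \<odot>\<^bsub>A\<^esub> \<one>\<^bsub>A\<^esub>"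
  have b: "?b \<in> carrier A" using ci by simp
  interpret FF: graded_left_module A F by (rule F_module)
  let ?g = "?b \<odot>\<^bsub>F\<^esub> f"
  have gF: "?g \<in> carrier F" by (rule FF.smult_closed[OF b fF])
  have gx: "?g x = e (v x)"
  proof -
    have "?g x = inv\<^bsub>K\<^esub> c \<odot>\<^bsub>A\<^esub> (c \<odot>\<^bsub>A\<^esub> e (v x))"
      using ci(1) c ev[OF x(1)] by (simp add: smult_mult)
    also have "\<dots> = e (v x)"
      using ci c(1) ev[OF x(1)] by (simp flip: smult_assoc1)
    finally show ?thesis .
  qed
  have g0: "cover ?g = \<zero>\<^bsub>P\<^esub>"
    using graded_homD(3)[OF cover_hom b fF] rel P.smult_zero_right[OF b] by simp
  let ?Y = "X - {x}"
  have Yc: "?Y \<subseteq> carrier P" and finY: "finite ?Y" using X_closed finite_X by auto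
  define s where "s = (\<Oplus>\<^bsub>P\<^esub>y\<in>?Y. ?g y \<odot>\<^bsub>P\<^esub> y)"
  have s: "s \<in> module_span A P ?Y"
    unfolding s_def by (rule module_spanI) (use F_closed[OF gF] in auto)
  have sc: "s \<in> carrier P" using s module_span_closed[OF P.left_module Yc] by auto
  have xc: "x \<in> carrier P" using x X_closed by auto
  have "cover ?g = (\<Oplus>\<^bsub>P\<^esub>y\<in>insert x ?Y. ?g y \<odot>\<^bsub>P\<^esub> y)"
    unfolding cover_def using x(1) by (simp add: insert_absorb)
  also have "\<dots> = ?g x \<odot>\<^bsub>P\<^esub> x \<oplus>\<^bsub>P\<^esub> s"
    unfolding s_def using summand_closed[OF gF] x(1) finY by (intro P.M.finsum_insert) auto
  also have "\<dots> = x \<oplus>\<^bsub>P\<^esub> s" unfolding gx using generator_gr(2)[OF x(1)] by simp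
  finally have "x = \<ominus>\<^bsub>P\<^esub> s" using g0 sc xc by (metis P.M.minus_equality P.M.a_comm)
  also have "\<dots> = (\<ominus>\<^bsub>A\<^esub> \<one>\<^bsub>A\<^esub>) \<odot>\<^bsub>P\<^esub> s"
  proof -
    have "s \<oplus>\<^bsub>P\<^esub> (\<ominus>\<^bsub>A\<^esub> \<one>\<^bsub>A\<^esub>) \<odot>\<^bsub>P\<^esub> s = (\<one>\<^bsub>A\<^esub> \<oplus>\<^bsub>A\<^esub> \<ominus>\<^bsub>A\<^esub> \<one>\<^bsub>A\<^esub>) \<odot>\<^bsub>P\<^esub> s"
      using sc by (simp add: P.smult_l_distr P.smult_one)
    also have "\<dots> = \<zero>\<^bsub>P\<^esub>" using sc by (simp add: M.r_neg P.smult_zero_left)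
    finally show ?thesis using sc P.smult_closed[of "\<ominus>\<^bsub>A\<^esub> \<one>\<^bsub>A\<^esub>" s]
      by (metis P.M.minus_equality P.M.a_comm M.a_inv_closed alg.one_closed)
  qed
  finally have "x \<in> module_span A P ?Y"
    using module_span_smult[OF P.left_module Yc _ s, of "\<ominus>\<^bsub>A\<^esub> \<one>\<^bsub>A\<^esub>"] by simp
  then have "X \<subseteq> module_span A P ?Y" using module_span_superset[OF P.left_module Yc finY] by auto
  then have "carrier P \<subseteq> module_span A P ?Y"
    using module_span_least[OF P.left_module Yc] spanning by blast
  then have "module_span A P ?Y = carrier P" using module_span_closed[OF P.left_module Yc] by auto
  then show False using minimal[OF x(1)] by simp
qed

text \<open>
  Let \<open>p = id - h \<circ> cover\<close>, the projection of \<open>F\<close> onto the kernel of the cover along the splitting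
  \<open>h\<close>. A relation \<open>f\<close> of degree \<open>n\<close> satisfies \<open>f = p f = \<Sum>\<^sub>x f(x) p(\<epsilon>\<^sub>x)\<close>. A generator \<open>x\<close> of
  degree \<open>> n\<close> has \<open>f(x) = 0\<close> as \<open>A\<close> has no negative degrees, one of degree \<open>n\<close> has \<open>f(x) = 0\<close> by
  \<open>relation_coefficient\<close>, and for one of degree \<open>< n\<close> the relation \<open>p(\<epsilon>\<^sub>x)\<close> has smaller degree and
  vanishes by induction. The induction is well-founded since the degrees of the finitely many
  generators are bounded below.
\<close>

lemma cover_injective_homogeneous:
  assumes h: "h \<in> graded_hom A P F" and split: "\<And>p. p \<in> carrier P \<Longrightarrow> cover (h p) = p"
  shows "f \<in> gr F n \<Longrightarrow> cover f = \<zero>\<^bsub>P\<^esub> \<Longrightarrow> f = \<zero>\<^bsub>F\<^esub>"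
proof -
  interpret FF: graded_left_module A F by (rule F_module)
  have h0: "h \<zero>\<^bsub>P\<^esub> = \<zero>\<^bsub>F\<^esub>" by (rule graded_hom_zero[OF P.left_module F_left_module h])
  (* The values of p lie in the kernel of the cover, and p fixes every element of that kernel. *)
  define p where "p u = u \<ominus>\<^bsub>F\<^esub> h (cover u)" for u
  have hc: "h (cover u) \<in> carrier F" if "u \<in> carrier F" for u
    using that graded_homD(1)[OF h] graded_homD(1)[OF cover_hom] by auto
  have pc: "p u \<in> carrier F" if "u \<in> carrier F" for u
    using hc that by (simp add: p_def FF.M.minus_eq del: F_ops)
  have p: "p \<in> graded_hom A F F"
    unfolding graded_hom_def LinearCombinations.module_hom_def
  proof (intro CollectI conjI allI impI image_subsetI)
    show "p \<in> carrier F \<rightarrow> carrier F" using pc by auto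
    show "p (u \<oplus>\<^bsub>F\<^esub> w) = p u \<oplus>\<^bsub>F\<^esub> p w" if "u \<in> carrier F \<and> w \<in> carrier F" for u w
    proof -
      have "h (cover (u \<oplus>\<^bsub>F\<^esub> w)) = h (cover u) \<oplus>\<^bsub>F\<^esub> h (cover w)"
        using that by (simp add: graded_homD(2)[OF cover_hom] graded_homD(2)[OF h] cover_closed del: F_ops)
      then show ?thesis using that hc
        by (simp add: p_def FF.M.minus_eq FF.M.minus_add FF.M.a_ac del: F_ops)
    qed
    show "p (a \<odot>\<^bsub>F\<^esub> u) = a \<odot>\<^bsub>F\<^esub> p u" if "a \<in> carrier A \<and> u \<in> carrier F" for a u
    proof -
      have "h (cover (a \<odot>\<^bsub>F\<^esub> u)) = a \<odot>\<^bsub>F\<^esub> h (cover u)"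
        using that by (simp add: graded_homD(3)[OF cover_hom] graded_homD(3)[OF h] cover_closed del: F_ops)
      then show ?thesis using that hc
        by (simp add: p_def FF.M.minus_eq FF.smult_r_distr FF.smult_minus del: F_ops)
    qed
    show "p u \<in> gr F n" if "u \<in> gr F n" for u n
      unfolding p_def using that graded_homD(4)[OF cover_hom] graded_homD(4)[OF h]
      by (intro FF.gr.minus_gr) auto
  qed
  have pker: "cover (p u) = \<zero>\<^bsub>P\<^esub>" if u: "u \<in> carrier F" for u
  proof -
    have "cover u = cover (p u \<oplus>\<^bsub>F\<^esub> h (cover u))"
      using u hc[OF u] by (simp add: p_def FF.M.minus_eq FF.M.a_assoc FF.M.l_neg del: F_ops)
    also have "\<dots> = cover (p u) \<oplus>\<^bsub>P\<^esub> cover u"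
      using graded_homD(2)[OF cover_hom pc[OF u] hc[OF u]] split[OF cover_closed[OF u]] by simp
    finally show ?thesis
      using graded_homD(1)[OF cover_hom] u pc[OF u] by (metis P.M.add.r_cancel_one P.M.add.l_cancel_one' PiE)
  qed
  have "finite (dg ` X)" using finite_X by simp
  then obtain b where b: "\<And>x. x \<in> X \<Longrightarrow> b \<le> dg x"
    by (metis bdd_below_finite bdd_below.unfold imageI)
  show "f = \<zero>\<^bsub>F\<^esub>" if "f \<in> gr F n" "cover f = \<zero>\<^bsub>P\<^esub>" for f n
    using that
  proof (induction "nat (n - b)" arbitrary: n f rule: less_induct)
    case less
    have fF: "f \<in> carrier F" using less.prems F_gr by blast
    have "p f = \<zero>\<^bsub>F\<^esub>"
    proof (rule linear_vanishing[OF F_module p fF])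
      fix x assume x: "x \<in> X"
      consider "dg x > n" | "dg x = n" | "dg x < n" by linarith
      then show "f x = \<zero>\<^bsub>A\<^esub> \<or> p (basis_vec x) = \<zero>\<^bsub>F\<^esub>"
      proof cases
        case 1
        then show ?thesis using less.prems(1) x gr_negative[of "n - dg x"] by (auto simp: F_gr)
      next
        case 2
        then show ?thesis using relation_coefficient[OF less.prems x] by simp
      next
        case 3
        have "p (basis_vec x) \<in> gr F (dg x)" using graded_homD(4)[OF p basis_vec_gr[OF x]] .
        moreover have "nat (dg x - b) < nat (n - b)" using 3 b[OF x] by linarith
        ultimately show ?thesis using less.hyps pker[OF basis_vec_closed[OF x]] by blast
      qed
    qed
    moreover have "\<ominus>\<^bsub>F\<^esub> \<zero>\<^bsub>F\<^esub> = \<zero>\<^bsub>F\<^esub>"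
      by (rule FF.M.minus_equality) (rule FF.M.l_zero FF.M.zero_closed)+
    then have "p f = f"
      unfolding p_def less.prems(2) h0 FF.M.minus_eq using FF.M.r_zero[OF fF] by (simp only:)
    ultimately show ?case by simp
  qed
qed

end

locale projective_cover = minimal_cover K A r e X v dg P
  for K :: "('k, 'b) ring_scheme" and A :: "('k, 'a) graded" and r e
    and X :: "'m set" and v dg and P :: "('a, 'm) graded" +
  assumes projective: "graded_projective A P"
begin

sublocale FF: graded_left_module A F by (rule F_module)

text \<open>The kernel is graded, so it vanishes once its homogeneous elements do.\<close>

lemma cover_kernel:
  assumes f: "f \<in> carrier F" and rel: "cover f = \<zero>\<^bsub>P\<^esub>"
  shows "f = \<zero>\<^bsub>F\<^esub>"
proof -
  have "(\<lambda>p. p) \<in> graded_hom A P P"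
    by (simp add: graded_hom_def LinearCombinations.module_hom_def)
  then obtain h where h: "h \<in> graded_hom A P F" "\<And>p. p \<in> carrier P \<Longrightarrow> cover (h p) = p"
    using projective F_module P.graded_left_module_axioms cover_hom cover_surj
    unfolding graded_projective_def by metis
  have "FF.gr.cmp f n = \<zero>\<^bsub>F\<^esub>" for n
  proof (rule cover_injective_homogeneous[OF h])
    show "FF.gr.cmp f n \<in> gr F n" by (rule FF.gr.component_gr[OF f])
    have "P.gr.cmp (cover f) (n + 0) = cover (FF.gr.cmp f n)"
      by (rule component_additive_map[where f = cover and M = F and N = P]) (use FF.gr.graded_abelian_group_axioms
          P.gr.graded_abelian_group_axioms graded_homD[OF cover_hom] f in auto)
    then show "cover (FF.gr.cmp f n) = \<zero>\<^bsub>P\<^esub>"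
      using P.gr.component_homogeneous[OF P.gr.zero_gr[of n], of n] rel by simp
  qed
  then show ?thesis using FF.gr.component_sum[OF f] by simp
qed

lemma cover_inj: "inj_on cover (carrier F)"
proof (rule inj_onI)
  fix f g assume f: "f \<in> carrier F" and g: "g \<in> carrier F" and eq: "cover f = cover g"
  have d: "f \<ominus>\<^bsub>F\<^esub> g \<in> carrier F" using f g by (simp add: FF.M.minus_eq del: F_ops)
  have "f = (f \<ominus>\<^bsub>F\<^esub> g) \<oplus>\<^bsub>F\<^esub> g" using f g by (simp add: FF.M.minus_eq FF.M.a_assoc FF.M.l_neg del: F_ops)
  then have "cover g = cover (f \<ominus>\<^bsub>F\<^esub> g) \<oplus>\<^bsub>P\<^esub> cover g"
    using graded_homD(2)[OF cover_hom d g] eq by simp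
  then have "cover (f \<ominus>\<^bsub>F\<^esub> g) = \<zero>\<^bsub>P\<^esub>"
    using graded_homD(1)[OF cover_hom] d g by (metis P.M.add.r_cancel_one P.M.add.l_cancel_one' PiE)
  then have "f \<ominus>\<^bsub>F\<^esub> g = \<zero>\<^bsub>F\<^esub>" by (rule cover_kernel[OF d])
  then show "f = g" using f g by (simp del: F_ops)
qed

lemma vertex_part_F:
  assumes i: "i < r"
  shows "vertex_part F i n = functions_into \<zero>\<^bsub>A\<^esub> X (\<lambda>x. corner i (v x) (n - dg x))"
proof (intro equalityI subsetI)
  fix f assume "f \<in> vertex_part F i n"
  then have f: "f \<in> gr F n" "e i \<odot>\<^bsub>F\<^esub> f = f" unfolding vertex_part_iff[OF F_module i] by auto
  have "e i \<otimes>\<^bsub>A\<^esub> f x = f x" for x using fun_cong[OF f(2), of x] by simp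
  then show "f \<in> functions_into \<zero>\<^bsub>A\<^esub> X (\<lambda>x. corner i (v x) (n - dg x))"
    using f(1) F_corner F_outside by (simp add: functions_into_def F_gr corner_iff[OF i v])
next
  fix f assume f: "f \<in> functions_into \<zero>\<^bsub>A\<^esub> X (\<lambda>x. corner i (v x) (n - dg x))"
  have fx: "f x \<in> gr A (n - dg x)" "e i \<otimes>\<^bsub>A\<^esub> f x = f x" "f x \<otimes>\<^bsub>A\<^esub> e (v x) = f x" if x: "x \<in> X" for x
  proof -
    have "f x \<in> corner i (v x) (n - dg x)" by (rule functions_intoD(1)[OF f x])
    then show "f x \<in> gr A (n - dg x)" "e i \<otimes>\<^bsub>A\<^esub> f x = f x" "f x \<otimes>\<^bsub>A\<^esub> e (v x) = f x"
      unfolding corner_iff[OF i v[OF x]] by blast+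
  qed
  have f0: "f x = \<zero>\<^bsub>A\<^esub>" if "x \<notin> X" for x using f that unfolding functions_into_def by auto
  have "f \<in> gr F n"
    using fx f0 gr.gr_closed[OF fx(1)] by (simp add: F_gr F_carrier right_corner_def)
  moreover have "e i \<odot>\<^bsub>F\<^esub> f = f"
  proof
    show "(e i \<odot>\<^bsub>F\<^esub> f) x = f x" for x using fx(2) f0 e_closed[OF i] by (cases "x \<in> X") auto
  qed
  ultimately show "f \<in> vertex_part F i n" unfolding vertex_part_iff[OF F_module i] by blast
qed

lemma vertex_part_F_dim:
  assumes i: "i < r"
  shows "fin_dim_subspace K (restrict_scalars A F) (vertex_part F i n)"
    "vertex_dim K A e F i n = (\<Sum>x\<in>X. subspace_dim K A (corner i (v x) (n - dg x)))"
proof -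
  have "fin_dim_subspace K (restrict_scalars A F) (vertex_part F i n) \<and>
    subspace_dim K (restrict_scalars A F) (vertex_part F i n) =
      (\<Sum>x\<in>X. subspace_dim K A (corner i (v x) (n - dg x)))"
    unfolding vertex_part_F[OF i]
  proof (rule functions_into_dim)
    fix x assume x: "x \<in> X"
    show "fin_dim_subspace K A (corner i (v x) (n - dg x))" by (rule corner_fin_dim[OF i v[OF x]])
    show "corner i (v x) (n - dg x) \<subseteq> right_corner A (e (v x))"
      using corner_iff[OF i v[OF x]] gr.gr_closed by (auto simp del: image_iff simp: right_corner_def)
  qed simp
  then show "fin_dim_subspace K (restrict_scalars A F) (vertex_part F i n)"
    "vertex_dim K A e F i n = (\<Sum>x\<in>X. subspace_dim K A (corner i (v x) (n - dg x)))"
    unfolding vertex_dim_def by auto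
qed

lemma vertex_part_P_dim:
  assumes i: "i < r"
  shows "fin_dim_subspace K (restrict_scalars A P) (vertex_part P i n)"
    "vertex_dim K A e P i n = (\<Sum>x\<in>X. subspace_dim K A (corner i (v x) (n - dg x)))"
proof -
  note rn = vertex_dim_rank_nullity[OF F_module P.graded_left_module_axioms cover_hom i
      vertex_part_F_dim(1)[OF i], of n]
  have "vertex_part P i n \<inter> cover ` carrier F = vertex_part P i n"
    unfolding cover_surj using vertex_part_iff[OF P.graded_left_module_axioms i] P.gr.gr_closed by blast
  note rn = rn[unfolded this]
  have z: "\<zero>\<^bsub>F\<^esub> \<in> vertex_part F i n"
    using subspaceD(2)[OF vertex_part_subspace[OF F_module i]] by (simp add: restrict_scalars_def)
  have "vertex_part F i n \<inter> a_kernel F P cover = {\<zero>\<^bsub>F\<^esub>}"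
    using z cover_kernel graded_hom_zero[OF F_left_module P.left_module cover_hom]
    by (auto simp: a_kernel_def' simp del: F_ops)
  moreover have "\<zero>\<^bsub>F\<^esub> = \<zero>\<^bsub>restrict_scalars A F\<^esub>" by (simp add: restrict_scalars_def)
  ultimately have "subspace_dim K (restrict_scalars A F) (vertex_part F i n \<inter> a_kernel F P cover) = 0"
    using subspace_dim_zero(1)[OF restrict_scalars_vectorspace[OF F_left_module]] by simp
  then show "vertex_dim K A e P i n = (\<Sum>x\<in>X. subspace_dim K A (corner i (v x) (n - dg x)))"
    using rn(2) vertex_part_F_dim(2)[OF i] by (simp add: vertex_dim_def)
  show "fin_dim_subspace K (restrict_scalars A P) (vertex_part P i n)" by (rule rn(1))
qed

section \<open>The top of a graded projective module\<close>

abbreviation JP where "JP \<equiv> positive_part_smult A P"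

lemma JP_subgroup: "additive_subgroup JP P"
proof -
  have "{a \<odot>\<^bsub>P\<^esub> m | a m. a \<in> positive_part A \<and> m \<in> carrier P} \<subseteq> carrier (add_monoid P)"
    using positive_part_closed P.smult_closed by auto
  then have "subgroup JP (add_monoid P)"
    unfolding positive_part_smult_def by (rule group.generate_is_subgroup[OF P.M.a_group])
  then show ?thesis by (rule additive_subgroup.intro)
qed

lemma smult_JP: "a \<in> positive_part A \<Longrightarrow> p \<in> carrier P \<Longrightarrow> a \<odot>\<^bsub>P\<^esub> p \<in> JP"
  unfolding positive_part_smult_def by (rule generate.incl) auto

lemma cover_in_JP:
  assumes f: "f \<in> carrier F" and "\<And>x. x \<in> X \<Longrightarrow> f x \<in> positive_part A"
  shows "cover f \<in> JP"
  unfolding cover_def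
  by (rule additive_subgroup_finsum[OF JP_subgroup P.M.abelian_group_axioms])
    (use assms smult_JP X_closed in auto)

text \<open>
  Since \<open>J\<close> is stable under multiplication from the right, \<open>a m\<close> with \<open>a \<in> J\<close> has
  coefficients in \<open>J\<close> whenever \<open>m\<close> is written in the generators.
\<close>

lemma JP_coefficients:
  assumes "p \<in> JP"
  shows "\<exists>f\<in>carrier F. p = cover f \<and> (\<forall>x\<in>X. f x \<in> positive_part A)"
proof -
  interpret J: additive_subgroup "positive_part A" A by (rule positive_part_subgroup)
  have prod: "\<exists>f\<in>carrier F. a \<odot>\<^bsub>P\<^esub> m = cover f \<and> (\<forall>x\<in>X. f x \<in> positive_part A)"
    if a: "a \<in> positive_part A" and m: "m \<in> carrier P" for a m
  proof -
    obtain f where f: "f \<in> carrier F" "m = cover f" using m cover_surj by blast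
    have "a \<odot>\<^bsub>F\<^esub> f \<in> carrier F" by (rule FF.smult_closed[OF positive_part_closed[OF a] f(1)])
    moreover have "a \<odot>\<^bsub>P\<^esub> m = cover (a \<odot>\<^bsub>F\<^esub> f)"
      unfolding f(2) by (rule graded_homD(3)[OF cover_hom positive_part_closed[OF a] f(1), symmetric])
    moreover have "\<forall>x\<in>X. (a \<odot>\<^bsub>F\<^esub> f) x \<in> positive_part A"
      using positive_part_ideal(1)[OF a] F_closed[OF f(1)] by simp
    ultimately show ?thesis by blast
  qed
  show ?thesis using assms unfolding positive_part_smult_def
  proof (induction rule: generate.induct)
    case one
    have "cover \<zero>\<^bsub>F\<^esub> = \<zero>\<^bsub>P\<^esub>" by (rule graded_hom_zero[OF F_left_module P.left_module cover_hom])
    then show ?case using FF.M.zero_closed J.zero_closed by (intro bexI[of _ "\<zero>\<^bsub>F\<^esub>"]) auto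
  next
    case (incl h)
    then show ?case using prod by auto
  next
    case (inv h)
    then obtain a m where am: "a \<in> positive_part A" "m \<in> carrier P" "h = a \<odot>\<^bsub>P\<^esub> m" by auto
    have "\<ominus>\<^bsub>P\<^esub> h = a \<odot>\<^bsub>P\<^esub> (\<ominus>\<^bsub>P\<^esub> m)" using P.smult_minus[OF positive_part_closed[OF am(1)] am(2)] am(3) by simp
    then show ?case using prod[OF am(1), of "\<ominus>\<^bsub>P\<^esub> m"] am(2) by (simp add: a_inv_def)
  next
    case (eng h1 h2)
    then obtain f g where f: "f \<in> carrier F" "h1 = cover f" "\<forall>x\<in>X. f x \<in> positive_part A"
      and g: "g \<in> carrier F" "h2 = cover g" "\<forall>x\<in>X. g x \<in> positive_part A" by blast
    have "f \<oplus>\<^bsub>F\<^esub> g \<in> carrier F" by (rule FF.M.a_closed[OF f(1) g(1)])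
    moreover have "h1 \<otimes>\<^bsub>add_monoid P\<^esub> h2 = cover (f \<oplus>\<^bsub>F\<^esub> g)"
      using graded_homD(2)[OF cover_hom f(1) g(1)] f(2) g(2) by simp
    moreover have "\<forall>x\<in>X. (f \<oplus>\<^bsub>F\<^esub> g) x \<in> positive_part A" using f(3) g(3) by simp
    ultimately show ?case by blast
  qed
qed

lemma JP_smult:
  assumes a: "a \<in> carrier A" and p: "p \<in> JP"
  shows "a \<odot>\<^bsub>P\<^esub> p \<in> JP"
proof -
  obtain f where f: "f \<in> carrier F" "p = cover f" "\<forall>x\<in>X. f x \<in> positive_part A"
    using JP_coefficients[OF p] by blast
  have "cover (a \<odot>\<^bsub>F\<^esub> f) \<in> JP"
    by (rule cover_in_JP[OF FF.smult_closed[OF a f(1)]]) (use f(3) positive_part_ideal(2)[OF _ a] in auto)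
  then show ?thesis using graded_homD(3)[OF cover_hom a f(1)] f(2) by simp
qed

abbreviation Q where "Q \<equiv> graded_quotient P JP"

lemma Q_simps:
  "carrier Q = a_rcosets\<^bsub>P\<^esub> JP" "\<zero>\<^bsub>Q\<^esub> = JP" "add Q = set_add P"
  "smult Q = (\<lambda>a X. \<Union>x\<in>X. JP +>\<^bsub>P\<^esub> (a \<odot>\<^bsub>P\<^esub> x))" "gr Q n = (\<lambda>x. JP +>\<^bsub>P\<^esub> x) ` gr P n"
  by (simp_all add: graded_quotient_def quotient_module_def module.extend_def graded.fields_def)

lemma JP_abelian_subgroup: "abelian_subgroup JP P"
  by (rule abelian_subgroupI3[OF JP_subgroup P.M.abelian_group_axioms])

lemma quotient_map:
  shows "(\<lambda>x. JP +>\<^bsub>P\<^esub> x) ` carrier P = carrier Q"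
    "JP +>\<^bsub>P\<^esub> \<zero>\<^bsub>P\<^esub> = \<zero>\<^bsub>Q\<^esub>"
    "\<And>x y. x \<in> carrier P \<Longrightarrow> y \<in> carrier P \<Longrightarrow> JP +>\<^bsub>P\<^esub> (x \<oplus>\<^bsub>P\<^esub> y) = (JP +>\<^bsub>P\<^esub> x) \<oplus>\<^bsub>Q\<^esub> (JP +>\<^bsub>P\<^esub> y)"
    "\<And>a x. a \<in> carrier A \<Longrightarrow> x \<in> carrier P \<Longrightarrow> JP +>\<^bsub>P\<^esub> (a \<odot>\<^bsub>P\<^esub> x) = a \<odot>\<^bsub>Q\<^esub> (JP +>\<^bsub>P\<^esub> x)"
    "\<And>x. x \<in> carrier P \<Longrightarrow> JP +>\<^bsub>P\<^esub> x = \<zero>\<^bsub>Q\<^esub> \<longleftrightarrow> x \<in> JP"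
proof -
  interpret JP: abelian_subgroup JP P by (rule JP_abelian_subgroup)
  show "(\<lambda>x. JP +>\<^bsub>P\<^esub> x) ` carrier P = carrier Q"
    by (auto simp: Q_simps A_RCOSETS_def')
  show "JP +>\<^bsub>P\<^esub> \<zero>\<^bsub>P\<^esub> = \<zero>\<^bsub>Q\<^esub>"
    using JP.a_rcos_const[OF JP.zero_closed] by (simp add: Q_simps)
  show "JP +>\<^bsub>P\<^esub> (x \<oplus>\<^bsub>P\<^esub> y) = (JP +>\<^bsub>P\<^esub> x) \<oplus>\<^bsub>Q\<^esub> (JP +>\<^bsub>P\<^esub> y)"
    if "x \<in> carrier P" "y \<in> carrier P" for x y
    using JP.a_rcos_sum[OF that] by (simp add: Q_simps)
  show "JP +>\<^bsub>P\<^esub> (a \<odot>\<^bsub>P\<^esub> x) = a \<odot>\<^bsub>Q\<^esub> (JP +>\<^bsub>P\<^esub> x)" if a: "a \<in> carrier A" and x: "x \<in> carrier P" for a x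
    unfolding Q_simps
    by (rule quotient_smult_coset[symmetric])
      (use a x P.M.abelian_group_axioms JP_subgroup P.smult_closed P.smult_r_distr JP_smult in auto)
  show "JP +>\<^bsub>P\<^esub> x = \<zero>\<^bsub>Q\<^esub> \<longleftrightarrow> x \<in> JP" if "x \<in> carrier P" for x
    using JP.a_rcos_const JP.a_rcos_self[OF that] by (auto simp: Q_simps)
qed

lemma Q_left_module: "left_module A Q"
  by (rule left_module_image[OF P.left_module quotient_map(1-4)])

text \<open>
  A coefficient \<open>f x\<close> of an element of degree \<open>n\<close> has degree \<open>n - dg x\<close>. It always lies in \<open>J\<close>
  (or is zero) unless this is \<open>0\<close>, in which case it lies in \<open>J\<close> only if it is zero.
\<close>

lemma vertex_part_JP:
  assumes i: "i < r"
  shows "{f \<in> vertex_part F i n. cover f \<in> JP} =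
    functions_into \<zero>\<^bsub>A\<^esub> X (\<lambda>x. if dg x = n then {\<zero>\<^bsub>A\<^esub>} else corner i (v x) (n - dg x))" (is "?L = ?R")
proof (intro equalityI subsetI)
  fix f assume "f \<in> ?L"
  then have f: "f \<in> functions_into \<zero>\<^bsub>A\<^esub> X (\<lambda>x. corner i (v x) (n - dg x))" "f \<in> gr F n" and J: "cover f \<in> JP"
    unfolding vertex_part_F[OF i, symmetric] using vertex_part_iff[OF F_module i] by blast+
  have fF: "f \<in> carrier F" using f(2) F_gr by blast
  obtain g where g: "g \<in> carrier F" "cover f = cover g" "\<forall>x\<in>X. g x \<in> positive_part A"
    using JP_coefficients[OF J] by blast
  have "f = g" using cover_inj fF g(1,2) by (simp add: inj_on_eq_iff)
  have "f x = \<zero>\<^bsub>A\<^esub>" if x: "x \<in> X" "dg x = n" for x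
  proof -
    have "f x \<in> gr A 0" using f(2) x by (auto simp: F_gr)
    then have "gr.cmp (f x) 0 = f x" by (simp add: gr.component_homogeneous)
    then show ?thesis using positive_part_component_0[of "f x"] g(3) x(1) \<open>f = g\<close> by simp
  qed
  then show "f \<in> ?R"
    using functions_intoD[OF f(1)] by (intro functions_intoI) (simp_all only: if_split singleton_iff, blast+)
next
  fix f assume f: "f \<in> ?R"
  have "f x \<in> corner i (v x) (n - dg x)" if x: "x \<in> X" for x
  proof (cases "dg x = n")
    case True
    then have "f x = \<zero>\<^bsub>A\<^esub>" using functions_intoD(1)[OF f x] by simp
    then show ?thesis using subspaceD(2)[OF corner_subspace[OF i v[OF x], of "n - dg x"]] by (simp only:)
  next
    case False
    then show ?thesis using functions_intoD(1)[OF f x] by (simp only: if_False)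
  qed
  then have fS: "f \<in> vertex_part F i n"
    unfolding vertex_part_F[OF i] using functions_intoD(2)[OF f] by (rule functions_intoI)
  then have fF: "f \<in> carrier F" and fgr: "f \<in> gr F n"
    using F_gr unfolding vertex_part_iff[OF F_module i] by blast+
  have "cover f \<in> JP"
  proof (rule cover_in_JP[OF fF])
    fix x assume x: "x \<in> X"
    have fx: "f x \<in> gr A (n - dg x)" using fgr x by (auto simp: F_gr)
    have zero: "\<zero>\<^bsub>A\<^esub> \<in> positive_part A" by (rule additive_subgroup.zero_closed[OF positive_part_subgroup])
    consider "n = dg x" | "n > dg x" | "n < dg x" by linarith
    then show "f x \<in> positive_part A"
    proof cases
      case 1
      then have "f x = \<zero>\<^bsub>A\<^esub>" using functions_intoD(1)[OF f x] by simp
      then show ?thesis using zero by simp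
    next
      case 2
      then show ?thesis using gr_positive_part[OF fx] by simp
    next
      case 3
      then show ?thesis using fx gr_negative[of "n - dg x"] zero by simp
    qed
  qed
  then show "f \<in> ?L" using fS by blast
qed

text \<open>
  Rank-nullity for \<open>e\<^sub>i F\<^sub>n \<rightarrow> e\<^sub>i (P / J P)\<^sub>n\<close>. By the description of the kernel just given, only the summands
  \<open>e\<^sub>i A\<^sub>0 e\<^bsub>v x\<^esub>\<close> at generators of degree \<open>n\<close> survive, and each has dimension \<open>1\<close> or \<open>0\<close>
  according to whether \<open>v x = i\<close>.
\<close>

lemma vertex_dim_top:
  assumes i: "i < r"
  shows "vertex_dim K A e Q i n = card {x \<in> X. v x = i \<and> dg x = n}"
proof -
  note V = restrict_scalars_vectorspace[OF F_left_module]
  note W = restrict_scalars_vectorspace[OF Q_left_module]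
  let ?T = "vertex_part Q i n"
  let ?q = "\<lambda>f. JP +>\<^bsub>P\<^esub> cover f"
  have Sc: "f \<in> carrier F" if "f \<in> vertex_part F i n" for f
    using that F_gr unfolding vertex_part_iff[OF F_module i] by blast
  have im: "?q ` vertex_part F i n = ?T"
  proof -
    have "cover ` vertex_part F i n = vertex_part P i n"
      using vertex_part_hom_image[OF F_module P.graded_left_module_axioms cover_hom i, of n]
        vertex_part_iff[OF P.graded_left_module_axioms i, of _ n] P.gr.gr_closed
      unfolding cover_surj by blast
    moreover have "(\<lambda>x. JP +>\<^bsub>P\<^esub> x) ` vertex_part P i n = ?T"
      unfolding Q_simps(5) image_image
      by (rule image_cong) (use quotient_map(4)[OF e_closed[OF i]] P.gr.gr_closed in auto)
    ultimately show ?thesis by (metis image_image)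
  qed
  have Tc: "?T \<subseteq> carrier (restrict_scalars A Q)"
    unfolding im[symmetric] using quotient_map(1) cover_closed[OF Sc] by (auto simp: restrict_scalars_def)
  have add: "?q (f \<oplus>\<^bsub>restrict_scalars A F\<^esub> g) = ?q f \<oplus>\<^bsub>restrict_scalars A Q\<^esub> ?q g"
    if "f \<in> vertex_part F i n" "g \<in> vertex_part F i n" for f g
    using graded_homD(2)[OF cover_hom Sc[OF that(1)] Sc[OF that(2)]]
      quotient_map(3)[OF cover_closed[OF Sc[OF that(1)]] cover_closed[OF Sc[OF that(2)]]]
    by (simp add: restrict_scalars_def)
  have smult: "?q (c \<odot>\<^bsub>restrict_scalars A F\<^esub> f) = c \<odot>\<^bsub>restrict_scalars A Q\<^esub> ?q f"
    if c: "c \<in> carrier K" and f: "f \<in> vertex_part F i n" for c f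
    using graded_homD(3)[OF cover_hom gr.gr_closed[OF scalar_gr_0[OF c]] Sc[OF f]]
      quotient_map(4)[OF gr.gr_closed[OF scalar_gr_0[OF c]] cover_closed[OF Sc[OF f]]]
    by (simp add: restrict_scalars_def)
  have ker: "{f \<in> vertex_part F i n. ?q f = \<zero>\<^bsub>restrict_scalars A Q\<^esub>} =
      functions_into \<zero>\<^bsub>A\<^esub> X (\<lambda>x. if dg x = n then {\<zero>\<^bsub>A\<^esub>} else corner i (v x) (n - dg x))"
    unfolding vertex_part_JP[OF i, symmetric] using quotient_map(5)[OF cover_closed[OF Sc]]
    by (auto simp: restrict_scalars_def)
  have "vertex_dim K A e F i n = vertex_dim K A e Q i n + subspace_dim K (restrict_scalars A F)
      (functions_into \<zero>\<^bsub>A\<^esub> X (\<lambda>x. if dg x = n then {\<zero>\<^bsub>A\<^esub>} else corner i (v x) (n - dg x)))"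
    unfolding vertex_dim_def
    using rank_nullity_subspace(4)[where f = ?q, OF V W vertex_part_subspace[OF F_module i] im Tc add smult
        vertex_part_F_dim(1)[OF i]] unfolding ker by simp
  also have "subspace_dim K (restrict_scalars A F)
      (functions_into \<zero>\<^bsub>A\<^esub> X (\<lambda>x. if dg x = n then {\<zero>\<^bsub>A\<^esub>} else corner i (v x) (n - dg x))) =
      (\<Sum>x\<in>X. subspace_dim K A (if dg x = n then {\<zero>\<^bsub>A\<^esub>} else corner i (v x) (n - dg x)))"
  proof (rule functions_into_dim[THEN conjunct2])
    fix x assume x: "x \<in> X"
    show "fin_dim_subspace K A (if dg x = n then {\<zero>\<^bsub>A\<^esub>} else corner i (v x) (n - dg x))"
      using corner_fin_dim[OF i v[OF x]] subspace_dim_zero(2)[OF vectorspace_A] by simp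
    have "\<And>a. a \<in> corner i (v x) (n - dg x) \<Longrightarrow> a \<in> right_corner A (e (v x))"
      unfolding corner_iff[OF i v[OF x]] using gr.gr_closed by (auto simp: right_corner_def)
    then show "(if dg x = n then {\<zero>\<^bsub>A\<^esub>} else corner i (v x) (n - dg x)) \<subseteq> right_corner A (e (v x))"
      using right_corner_ops(1)[OF ev[OF x]] by (auto simp del: image_iff)
  qed simp
  finally have "(\<Sum>x\<in>X. subspace_dim K A (corner i (v x) (n - dg x))) = vertex_dim K A e Q i n +
      (\<Sum>x\<in>X. if dg x = n then 0 else subspace_dim K A (corner i (v x) (n - dg x)))"
    using subspace_dim_zero(1)[OF vectorspace_A]
    by (simp add: vertex_part_F_dim(2)[OF i] if_distrib cong: if_cong)
  moreover have "(\<Sum>x\<in>X. subspace_dim K A (corner i (v x) (n - dg x))) =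
      (\<Sum>x\<in>X. if v x = i \<and> dg x = n then 1 else 0) +
      (\<Sum>x\<in>X. if dg x = n then 0 else subspace_dim K A (corner i (v x) (n - dg x)))"
    unfolding sum.distrib[symmetric] by (rule sum.cong) (auto simp: corner_dim_0[OF i v] simp del: image_iff)
  moreover have "(\<Sum>x\<in>X. if v x = i \<and> dg x = n then 1 else 0) = card {x \<in> X. v x = i \<and> dg x = n}"
    using finite_X by (simp add: sum.If_cases Int_def)
  ultimately show ?thesis by simp
qed

end

text \<open>
  In the language of modules: \<open>P \<cong> \<Oplus>\<^sub>x A e\<^bsub>v x\<^esub>\<close>, with the summand at \<open>x\<close> generated in degree \<open>dg x\<close>,
  and \<open>X\<close> gives a basis of \<open>P / J P\<close>. Only the numerical consequences are recorded.
\<close>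

theorem graded_projective_structure:
  fixes K :: "('k, 'b) ring_scheme" and A :: "('k, 'a) graded" and P :: "('a, 'm) graded"
  assumes A: "elementary_algebra K A r e"
    and P: "graded_projective A P" and fg: "finitely_generated A P"
  shows "\<exists>(X :: 'm set) v dg. finite X \<and> (\<forall>x\<in>X. v x < r) \<and> (\<forall>i<r. \<forall>n.
    fin_dim_subspace K (restrict_scalars A P) ((\<lambda>m. e i \<odot>\<^bsub>P\<^esub> m) ` gr P n) \<and>
    vertex_dim K A e P i n =
      (\<Sum>x\<in>X. subspace_dim K A ((\<lambda>a. e i \<otimes>\<^bsub>A\<^esub> a \<otimes>\<^bsub>A\<^esub> e (v x)) ` gr A (n - dg x))) \<and>
    vertex_dim K A e (graded_quotient P (positive_part_smult A P)) i n =
      card {x \<in> X. v x = i \<and> dg x = n})"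
proof -
  interpret elementary_algebra K A r e by (rule A)
  have PM: "graded_left_module A P" using P by (simp add: graded_projective_def)
  obtain X v dg where X: "finite X" "\<And>x. x \<in> X \<Longrightarrow> v x < r" "\<And>x. x \<in> X \<Longrightarrow> x \<in> vertex_part P (v x) (dg x)"
    "module_span A P X = carrier P" "\<And>x. x \<in> X \<Longrightarrow> module_span A P (X - {x}) \<noteq> carrier P"
    by (rule minimal_vertex_homogeneous_generators[OF PM fg]) (rule that)
  interpret projective_cover K A r e X v dg P
    by (intro projective_cover.intro minimal_cover.intro graded_free_module.intro
        graded_free_module_axioms.intro minimal_cover_axioms.intro projective_cover_axioms.intro A PM P X)
  show ?thesis
    using X(1,2) vertex_part_P_dim vertex_dim_top
    by (intro exI[of _ X] exI[of _ v] exI[of _ dg] conjI ballI allI impI)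
qed

section \<open>Laurent polynomials, rational functions and expansions\<close>

lemma poly_at_hom:
  "poly_at c (p * q) = poly_at c p * poly_at c q"
  "poly_at c (p + q) = poly_at c p + poly_at c q"
  "poly_at c 1 = 1" "poly_at c 0 = 0"
  by (simp_all add: poly_at_def pcompose_mult fps_of_poly_mult fls_times_fps_to_fls
      pcompose_add fps_of_poly_add pcompose_1)

lemma poly_at_eq_0_iff: "poly_at c q = 0 \<longleftrightarrow> q = 0"
  by (auto simp: poly_at_def dest: pcompose_eq_0)

text \<open>
  Substituting \<open>x = c + t\<close> is an injective ring homomorphism from polynomials to the field
  \<open>\<rat>((t))\<close>, hence extends to the field of fractions.
\<close>

interpretation expansion_at: field_hom "expansion_at c"
proof
  show "expansion_at c 1 = 1"
    by (simp add: One_fract_def expansion_at_Fract poly_at_hom)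
  show "expansion_at c 0 = 0"
    by (simp add: Zero_fract_def expansion_at_Fract poly_at_hom)
  fix x y :: "rat poly fract"
  obtain a b where x: "x = Fract a b" "b \<noteq> 0" by (cases x) auto
  obtain a' b' where y: "y = Fract a' b'" "b' \<noteq> 0" by (cases y) auto
  show "expansion_at c (x + y) = expansion_at c x + expansion_at c y"
    using x y by (simp add: expansion_at_Fract poly_at_hom poly_at_eq_0_iff add_frac_eq)
  show "expansion_at c (x * y) = expansion_at c x * expansion_at c y"
    using x y by (simp add: expansion_at_Fract poly_at_hom)
qed

lemma expansion_at_power_int: "expansion_at c (x powi n) = expansion_at c x powi n"
  by (simp add: power_int_def expansion_at.hom_power expansion_at.hom_inverse)

lemma rat_fls_of_int_nth [simp]: "fls_nth (rat_fls_of_int f) n = of_int (fls_nth f n)"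
proof -
  have "\<forall>\<^sub>\<infinity>n. fls_nth f (- int n) = 0" using fls_nth[of f] by simp
  then have "\<forall>\<^sub>\<infinity>n. rat_of_int (fls_nth f (- int n)) = 0" by (rule MOST_mono) simp
  then show ?thesis unfolding rat_fls_of_int_def by (subst Abs_fls_inverse) auto
qed

lemma rat_fls_of_int_subdegree [simp]: "fls_subdegree (rat_fls_of_int f) = fls_subdegree f"
proof (cases "f = 0")
  case True
  then have "rat_fls_of_int f = 0" by (intro fls_eqI) simp
  then show ?thesis using True by simp
next
  case False
  then show ?thesis by (intro fls_subdegree_eqI) auto
qed

lemma fps_to_fls_sum: "fps_to_fls (\<Sum>x\<in>S. f x) = (\<Sum>x\<in>S. fps_to_fls (f x))"
  by (induction S rule: infinite_finite_induct) auto

interpretation rat_fls_of_int: inj_comm_ring_hom rat_fls_of_int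
proof
  show "rat_fls_of_int (f * g) = rat_fls_of_int f * rat_fls_of_int g" for f g
    by (intro fls_eqI) (simp add: fls_times_nth(2))
  show "rat_fls_of_int x = 0 \<Longrightarrow> x = 0" for x
    by (auto intro!: fls_eqI simp: fls_eq_iff)
qed (auto intro!: fls_eqI)

definition fls_of_laurent :: "(int \<Rightarrow>\<^sub>0 int) \<Rightarrow> int fls" where
  "fls_of_laurent q = Abs_fls (Poly_Mapping.lookup q)"

lemma bounded_below_nth_Abs_fls:
  fixes f :: "int \<Rightarrow> 'a::zero"
  assumes "\<And>n. n < b \<Longrightarrow> f n = 0"
  shows "fls_nth (Abs_fls f) = f"
proof (rule Abs_fls_inverse, simp, unfold MOST_nat, intro exI allI impI)
  fix n assume "nat (- b) < n"
  then show "f (- int n) = 0" by (intro assms) linarith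
qed

lemma fls_of_laurent_nth [simp]: "fls_nth (fls_of_laurent q) n = Poly_Mapping.lookup q n"
proof -
  have "finite (Poly_Mapping.keys q)" by simp
  then obtain b where b: "\<forall>n\<in>Poly_Mapping.keys q. b \<le> n"
    by (metis bdd_below_finite bdd_below.unfold)
  have "fls_nth (fls_of_laurent q) = Poly_Mapping.lookup q"
    unfolding fls_of_laurent_def
    by (rule bounded_below_nth_Abs_fls[of b]) (use b in_keys_iff in force)
  then show ?thesis by simp
qed

definition fract_of_laurent :: "(int \<Rightarrow>\<^sub>0 int) \<Rightarrow> rat poly fract" where
  "fract_of_laurent q =
     (\<Sum>m\<in>Poly_Mapping.keys q. of_int (Poly_Mapping.lookup q m) * Fract [:0, 1:] 1 powi m)"

lemma expansion_at_of_int: "expansion_at c (of_int z) = of_int z"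
  by (cases z rule: int_diff_cases) (simp add: expansion_at.hom_minus expansion_at.hom_of_nat)

lemma expansion_at_X: "expansion_at c (Fract [:0, 1:] 1) = fps_to_fls (fps_const c + fps_X)"
  by (simp add: expansion_at_Fract poly_at_hom(3)) (simp add: poly_at_def pcompose_pCons fps_of_poly_pCons)

lemma fls_X_powi: "(fls_X :: rat fls) powi m = fls_X_intpow m"
proof (cases "m \<ge> 0")
  case True
  then show ?thesis by (simp add: power_int_def fls_X_power_conv_shift_1)
next
  case False
  then show ?thesis
    by (simp add: power_int_def fls_inverse_X fls_X_inv_power_conv_shift_1)
qed

lemma expansion_at_0_fract_of_laurent:
  "expansion_at 0 (fract_of_laurent q) = rat_fls_of_int (fls_of_laurent q)"
proof (rule fls_eqI)
  fix n
  have "expansion_at 0 (fract_of_laurent q) =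
      (\<Sum>m\<in>Poly_Mapping.keys q. of_int (Poly_Mapping.lookup q m) * fls_X_intpow m)"
    by (simp add: fract_of_laurent_def expansion_at.hom_sum expansion_at.hom_mult
        expansion_at_power_int expansion_at_of_int expansion_at_X fls_X_powi)
  moreover have "fls_nth (of_int a * fls_X_intpow m :: rat fls) n = (if n = m then of_int a else 0)" for a m
    by (auto simp: fls_of_int)
  ultimately show "fls_nth (expansion_at 0 (fract_of_laurent q)) n = fls_nth (rat_fls_of_int (fls_of_laurent q)) n"
    by (simp add: fls_nth_sum in_keys_iff)
qed

lemma fps_to_fls_power_int:
  fixes f :: "'a::field fps"
  shows "subdegree f = 0 \<Longrightarrow> fps_to_fls f powi m = fps_to_fls (f powi m)"
  by (simp add: power_int_def fps_to_fls_power fls_inverse_fps_to_fls)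

lemma expansion_at_1_fract_of_laurent:
  "expansion_at 1 (fract_of_laurent q) = fps_to_fls (laurent_at_1_plus_t q)"
proof -
  have "expansion_at 1 (Fract [:0, 1:] 1) powi m = fps_to_fls ((1 + fps_X) powi m)" for m
  proof -
    have "subdegree (fps_const 1 + fps_X :: rat fps) = 0" by (rule subdegree_eq_0) simp
    from fps_to_fls_power_int[OF this, of m] show ?thesis by (simp only: expansion_at_X fps_const_1_eq_1)
  qed
  then show ?thesis
    by (simp add: fract_of_laurent_def laurent_at_1_plus_t_def expansion_at.hom_sum expansion_at.hom_mult
        expansion_at_power_int expansion_at_of_int fps_to_fls_sum fls_times_fps_to_fls fps_to_fls_of_int)
qed

lemma fract_of_laurent_inj: "fract_of_laurent q = fract_of_laurent q' \<Longrightarrow> q = q'"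
proof -
  assume "fract_of_laurent q = fract_of_laurent q'"
  then have "rat_fls_of_int (fls_of_laurent q) = rat_fls_of_int (fls_of_laurent q')"
    by (simp flip: expansion_at_0_fract_of_laurent)
  then have "fls_of_laurent q = fls_of_laurent q'" by (simp add: rat_fls_of_int.eq_iff)
  then show "q = q'" by (intro poly_mapping_eqI) (simp flip: fls_of_laurent_nth)
qed

lemma rational_function_of_eqI:
  "expansion_at 0 g = rat_fls_of_int f \<Longrightarrow> rational_function_of f = g"
  unfolding rational_function_of_def by (rule the_equality) (metis expansion_at.eq_iff)+

lemma expansion_at_0_rational_function_of:
  "is_rational_series f \<Longrightarrow> expansion_at 0 (rational_function_of f) = rat_fls_of_int f"
  unfolding is_rational_series_def using rational_function_of_eqI by metis

text \<open>
  The determinant is a power series with constant term \<open>1\<close>, hence nonzero, and this transfers along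
  the expansion at \<open>0\<close> to the matrix over \<open>\<rat>(x)\<close>.
\<close>

lemma rational_matrix_inverse:
  fixes H :: "int fps mat"
  assumes H: "H \<in> carrier_mat r r"
    and H0: "\<And>i j. i < r \<Longrightarrow> j < r \<Longrightarrow> fps_nth (H $$ (i, j)) 0 = (if i = j then 1 else 0)"
    and rational: "\<And>i j. i < r \<Longrightarrow> j < r \<Longrightarrow> is_rational_series (fps_to_fls (H $$ (i, j)))"
  defines "C \<equiv> map_mat (\<lambda>f. rational_function_of (fps_to_fls f)) H"
  shows "the (mat_inverse C) \<in> carrier_mat r r" "C * the (mat_inverse C) = 1\<^sub>m r"
    "the (mat_inverse C) * C = 1\<^sub>m r"
proof -
  have C: "C \<in> carrier_mat r r" using H by (simp add: C_def)
  interpret nth0: comm_ring_hom "\<lambda>f :: int fps. fps_nth f 0"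
    by unfold_locales auto
  interpret fps_to_fls: comm_ring_hom "fps_to_fls :: int fps \<Rightarrow> int fls"
    by unfold_locales (auto simp: fls_times_fps_to_fls)
  have "map_mat (\<lambda>f. fps_nth f 0) H = 1\<^sub>m r" using H H0 by (intro eq_matI) auto
  then have "fps_nth (det H) 0 = 1" using nth0.hom_det[of H] by simp
  then have "det H \<noteq> 0" by auto
  moreover have "map_mat (expansion_at 0) C = map_mat rat_fls_of_int (map_mat fps_to_fls H)"
    using H rational by (intro eq_matI) (auto simp: C_def expansion_at_0_rational_function_of)
  then have "expansion_at 0 (det C) = rat_fls_of_int (fps_to_fls (det H))"
    by (metis expansion_at.hom_det rat_fls_of_int.hom_det fps_to_fls.hom_det)
  ultimately have "det C \<noteq> 0" by auto
  then have "C \<in> Units (ring_mat TYPE(rat poly fract) r ())"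
    using det_non_zero_imp_unit[OF C] by simp
  then obtain B where B: "mat_inverse C = Some B"
    using mat_inverse(1)[OF C, of "()"] by (cases "mat_inverse C") auto
  from mat_inverse(2)[OF C B] B
  show "the (mat_inverse C) \<in> carrier_mat r r" "C * the (mat_inverse C) = 1\<^sub>m r"
    "the (mat_inverse C) * C = 1\<^sub>m r" by auto
qed

lemma fls_of_laurent_hom:
  "fls_of_laurent (p + q) = fls_of_laurent p + fls_of_laurent q"
  "fls_of_laurent (- p) = - fls_of_laurent p"
  "fls_of_laurent 0 = 0"
  by (intro fls_eqI; simp add: lookup_add)+

lemma fls_of_laurent_sum: "fls_of_laurent (\<Sum>x\<in>S. f x) = (\<Sum>x\<in>S. fls_of_laurent (f x))"
  by (induction S rule: infinite_finite_induct) (simp_all add: fls_of_laurent_hom)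

lemma fls_of_laurent_sign: "fls_of_laurent ((- 1) ^ k * p) = (- 1) ^ k * fls_of_laurent p"
  by (simp add: minus_one_power_iff fls_of_laurent_hom)

section \<open>Hilbert series of perfect modules\<close>

text \<open>
  Each generator of vertex \<open>j\<close> and degree \<open>d\<close> contributes \<open>x\<^sup>d\<close> to the \<open>j\<close>-th entry of the numerator and
  \<open>x\<^sup>d C\<^sub>i\<^sub>j\<close> to the Hilbert series.
\<close>

lemma projective_hilbert_series:
  fixes K :: "('k, 'b) ring_scheme" and A :: "('k, 'a) graded" and P :: "('a, 'm) graded"
  assumes A: "elementary_algebra K A r e"
    and P: "graded_projective A P" "finitely_generated A P" and i: "i < r"
  shows "fls_nth (\<Sum>j<r. fps_to_fls (hilbert_matrix K A r e $$ (i, j)) *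
      fls_of_laurent (projective_numerator K A r e P $ j)) n = int (vertex_dim K A e P i n)"
    and "fin_dim_subspace K (restrict_scalars A P) ((\<lambda>m. e i \<odot>\<^bsub>P\<^esub> m) ` gr P n)"
proof -
  interpret elementary_algebra K A r e by (rule A)
  obtain X :: "'m set" and v dg where "finite X \<and> (\<forall>x\<in>X. v x < r) \<and> (\<forall>i<r. \<forall>n.
      fin_dim_subspace K (restrict_scalars A P) (vertex_part P i n) \<and>
      vertex_dim K A e P i n = (\<Sum>x\<in>X. subspace_dim K A (corner i (v x) (n - dg x))) \<and>
      vertex_dim K A e (graded_quotient P (positive_part_smult A P)) i n =
        card {x \<in> X. v x = i \<and> dg x = n})"
    using graded_projective_structure[OF A P] by (elim exE)
  then have X: "finite X" "\<And>x. x \<in> X \<Longrightarrow> v x < r"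
    and fin: "\<And>i n. i < r \<Longrightarrow> fin_dim_subspace K (restrict_scalars A P) (vertex_part P i n)"
    and dim: "\<And>i n. i < r \<Longrightarrow> vertex_dim K A e P i n = (\<Sum>x\<in>X. subspace_dim K A (corner i (v x) (n - dg x)))"
    and top: "\<And>i n. i < r \<Longrightarrow> vertex_dim K A e (graded_quotient P (positive_part_smult A P)) i n =
       card {x \<in> X. v x = i \<and> dg x = n}"
    by simp_all
  show "fin_dim_subspace K (restrict_scalars A P) (vertex_part P i n)" by (rule fin[OF i])
  (* Both sides count generators: the coefficient at m counts those of vertex j and degree m. *)
  have num: "fls_of_laurent (projective_numerator K A r e P $ j) =
      (\<Sum>x\<in>{x \<in> X. v x = j}. fls_X_intpow (dg x))" if j: "j < r" for j
  proof (rule fls_eqI)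
    fix m
    have "finite {m. int (card {x \<in> X. v x = j \<and> dg x = m}) \<noteq> 0}"
    proof (rule finite_subset)
      show "{m. int (card {x \<in> X. v x = j \<and> dg x = m}) \<noteq> 0} \<subseteq> dg ` X"
      proof
        fix m assume "m \<in> {m. int (card {x \<in> X. v x = j \<and> dg x = m}) \<noteq> 0}"
        then have "{x \<in> X. v x = j \<and> dg x = m} \<noteq> {}" by (metis (mono_tags, lifting) card.empty mem_Collect_eq of_nat_0)
        then show "m \<in> dg ` X" by auto
      qed
    qed (simp add: X)
    then have "Poly_Mapping.lookup (projective_numerator K A r e P $ j) m = int (card {x \<in> X. v x = j \<and> dg x = m})"
      using j by (simp add: projective_numerator_def top Abs_poly_mapping_inverse)
    also have "\<dots> = (\<Sum>x\<in>{x \<in> X. v x = j}. if m = dg x then 1 else 0)"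
      using X(1) by (simp add: sum.If_cases) (simp add: Int_def conj_ac eq_commute)
    finally show "fls_nth (fls_of_laurent (projective_numerator K A r e P $ j)) m =
        fls_nth (\<Sum>x\<in>{x \<in> X. v x = j}. fls_X_intpow (dg x)) m"
      by (simp add: fls_nth_sum)
  qed
  have coeff: "fls_nth (fps_to_fls (hilbert_matrix K A r e $$ (i, j)) * fls_X_intpow d) n =
      int (subspace_dim K A (corner i j (n - d)))" if j: "j < r" for j d
  proof (cases "n - d < 0")
    case True
    then show ?thesis using i j corner_negative[OF i j True] subspace_dim_zero(1)[OF vectorspace_A]
      by (simp add: fls_X_intpow_times_conv_shift)
  next
    case False
    then show ?thesis using i j by (simp add: fls_X_intpow_times_conv_shift hilbert_matrix_def)
  qed
  have "fls_nth (\<Sum>j<r. fps_to_fls (hilbert_matrix K A r e $$ (i, j)) *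
      fls_of_laurent (projective_numerator K A r e P $ j)) n =
      (\<Sum>j<r. \<Sum>x\<in>{x \<in> X. v x = j}. int (subspace_dim K A (corner i (v x) (n - dg x))))"
    unfolding fls_nth_sum
  proof (rule sum.cong)
    fix j assume "j \<in> {..<r}"
    then have j: "j < r" by simp
    show "fls_nth (fps_to_fls (hilbert_matrix K A r e $$ (i, j)) *
        fls_of_laurent (projective_numerator K A r e P $ j)) n =
        (\<Sum>x\<in>{x \<in> X. v x = j}. int (subspace_dim K A (corner i (v x) (n - dg x))))"
      unfolding num[OF j] sum_distrib_left fls_nth_sum coeff[OF j] by (rule sum.cong) auto
  qed simp
  also have "\<dots> = (\<Sum>x\<in>X. int (subspace_dim K A (corner i (v x) (n - dg x))))"
    by (rule sum.group) (use X in auto)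
  finally show "fls_nth (\<Sum>j<r. fps_to_fls (hilbert_matrix K A r e $$ (i, j)) *
      fls_of_laurent (projective_numerator K A r e P $ j)) n = int (vertex_dim K A e P i n)"
    by (simp add: dim[OF i])
qed

definition resolution_numerator where
  "resolution_numerator K A r e L P =
     vec r (\<lambda>j. \<Sum>n\<le>L. (- 1) ^ n * projective_numerator K A r e (P n) $ j)"

text \<open>
  The Hilbert series and the numerator of \<open>M\<close> are the same alternating sums over the resolution, so
  the identity \<open>Hilb = C\<^sub>A q\<close> is inherited from the projectives.
\<close>

lemma perfect_hilbert_series:
  fixes K :: "('k, 'b) ring_scheme" and A :: "('k, 'a) graded" and M :: "('a, 'm) graded"
    and P :: "nat \<Rightarrow> ('a, 'p) graded"
  assumes A: "elementary_algebra K A r e" and M: "graded_left_module A M"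
    and res: "finite_fg_projective_resolution A M L P d \<epsilon>" and i: "i < r"
  shows "hilbert_vec K A r e M $ i = (\<Sum>j<r. fps_to_fls (hilbert_matrix K A r e $$ (i, j)) *
      fls_of_laurent (resolution_numerator K A r e L P $ j))" (is "_ = ?G")
proof -
  have res': "fg_projective_resolution A M P d \<epsilon>"
    using res by (simp add: finite_fg_projective_resolution_def)
  note proj = fg_projective_resolutionD(1,2)[OF res']
  have "fls_nth ?G n = int (vertex_dim K A e M i n)" for n
  proof -
    have "?G = (\<Sum>j<r. \<Sum>k\<le>L. (- 1) ^ k * (fps_to_fls (hilbert_matrix K A r e $$ (i, j)) *
        fls_of_laurent (projective_numerator K A r e (P k) $ j)))"
      by (rule sum.cong) (simp_all add: resolution_numerator_def fls_of_laurent_sum fls_of_laurent_sign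
          sum_distrib_left mult_ac)
    also have "\<dots> = (\<Sum>k\<le>L. (- 1) ^ k * (\<Sum>j<r. fps_to_fls (hilbert_matrix K A r e $$ (i, j)) *
        fls_of_laurent (projective_numerator K A r e (P k) $ j)))"
      by (subst sum.swap) (simp add: sum_distrib_left)
    also have "fls_nth \<dots> n = (\<Sum>k\<le>L. (- 1) ^ k * int (vertex_dim K A e (P k) i n))"
      unfolding fls_nth_sum
    proof (rule sum.cong)
      fix k
      have sign: "fls_nth ((- 1) ^ k * f) n = (- 1) ^ k * fls_nth f n" for f :: "int fls"
        by (simp add: minus_one_power_iff)
      show "fls_nth ((- 1) ^ k * (\<Sum>j<r. fps_to_fls (hilbert_matrix K A r e $$ (i, j)) *
        fls_of_laurent (projective_numerator K A r e (P k) $ j))) n = (- 1) ^ k * int (vertex_dim K A e (P k) i n)"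
        unfolding sign projective_hilbert_series(1)[OF A proj i] ..
    qed simp
    also have "\<dots> = int (vertex_dim K A e M i n)"
      by (rule elementary_algebra.euler_characteristic(2)[OF A M res _ i, symmetric])
        (rule projective_hilbert_series(2)[OF A proj i])
    finally show ?thesis .
  qed
  then have "(\<lambda>n. int (vertex_dim K A e M i n)) = fls_nth ?G" by auto
  then show ?thesis using i by (simp add: hilbert_vec_def fls_nth_inverse)
qed

lemma hilbert_matrix_carrier: "hilbert_matrix K A r e \<in> carrier_mat r r"
  by (simp add: hilbert_matrix_def)

lemma (in elementary_algebra) hilbert_matrix_nth_0:
  "i < r \<Longrightarrow> j < r \<Longrightarrow> fps_nth (hilbert_matrix K A r e $$ (i, j)) 0 = (if i = j then 1 else 0)"
  using corner_dim_0[of i j] by (simp add: hilbert_matrix_def)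

text \<open>Expansion at \<open>0\<close> is injective, so an identity of Laurent series is one of rational functions.\<close>

lemma rational_hilbert_vec:
  fixes K :: "('k, 'b) ring_scheme" and A :: "('k, 'a) graded" and M :: "('a, 'm) graded"
    and P :: "nat \<Rightarrow> ('a, 'p) graded"
  assumes A: "elementary_algebra K A r e" and M: "graded_left_module A M"
    and rational: "\<And>i j. i < r \<Longrightarrow> j < r \<Longrightarrow> is_rational_series (fps_to_fls (hilbert_matrix K A r e $$ (i, j)))"
    and res: "finite_fg_projective_resolution A M L P d \<epsilon>"
  shows "map_vec rational_function_of (hilbert_vec K A r e M) =
    rational_hilbert_matrix K A r e *\<^sub>v map_vec fract_of_laurent (resolution_numerator K A r e L P)"
proof (rule eq_vecI)
  let ?q = "resolution_numerator K A r e L P"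
  show "dim_vec (map_vec rational_function_of (hilbert_vec K A r e M)) =
    dim_vec (rational_hilbert_matrix K A r e *\<^sub>v map_vec fract_of_laurent ?q)"
    by (simp add: hilbert_vec_def rational_hilbert_matrix_def hilbert_matrix_def)
  fix i assume "i < dim_vec (rational_hilbert_matrix K A r e *\<^sub>v map_vec fract_of_laurent ?q)"
  then have i: "i < r" by (simp add: rational_hilbert_matrix_def hilbert_matrix_def)
  have dq: "dim_vec ?q = r" by (simp add: resolution_numerator_def)
  have "(rational_hilbert_matrix K A r e *\<^sub>v map_vec fract_of_laurent ?q) $ i =
      (\<Sum>j<r. rational_function_of (fps_to_fls (hilbert_matrix K A r e $$ (i, j))) * fract_of_laurent (?q $ j))"
    using i dq hilbert_matrix_carrier[of K A r e]
    by (auto simp: rational_hilbert_matrix_def scalar_prod_def lessThan_atLeast0 intro!: sum.cong)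
  moreover have "expansion_at 0 \<dots> = rat_fls_of_int (hilbert_vec K A r e M $ i)"
    unfolding perfect_hilbert_series[OF A M res i] expansion_at.hom_sum expansion_at.hom_mult
      rat_fls_of_int.hom_sum rat_fls_of_int.hom_mult
    by (rule sum.cong) (simp_all add: expansion_at_0_fract_of_laurent
        expansion_at_0_rational_function_of rational i)
  ultimately show "map_vec rational_function_of (hilbert_vec K A r e M) $ i =
      (rational_hilbert_matrix K A r e *\<^sub>v map_vec fract_of_laurent ?q) $ i"
    using i rational_function_of_eqI by (simp add: hilbert_vec_def del: index_mult_mat_vec)
qed

text \<open>
  Two resolutions of \<open>M\<close> have the same product \<open>C\<^sub>A q\<close>, the Hilbert series of \<open>M\<close>, and \<open>C\<^sub>A\<close> can be
  cancelled. So the definite description picks the numerator of any resolution.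
\<close>

lemma euler_numerator_eq:
  fixes K :: "('k, 'b) ring_scheme" and A :: "('k, 'a) graded" and M :: "('a, 'm) graded"
    and P :: "nat \<Rightarrow> ('a, nat \<Rightarrow> 'a) graded"
  assumes A: "elementary_algebra K A r e" and M: "graded_left_module A M"
    and rational: "\<And>i j. i < r \<Longrightarrow> j < r \<Longrightarrow> is_rational_series (fps_to_fls (hilbert_matrix K A r e $$ (i, j)))"
    and res: "finite_fg_projective_resolution A M L P d \<epsilon>"
  shows "euler_numerator K A r e M = resolution_numerator K A r e L P"
  unfolding euler_numerator_def resolution_numerator_def[symmetric]
proof (rule the_equality)
  show "\<exists>L' (P' :: nat \<Rightarrow> ('a, nat \<Rightarrow> 'a) graded) d \<epsilon>. finite_fg_projective_resolution A M L' P' d \<epsilon> \<and>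
      resolution_numerator K A r e L P = resolution_numerator K A r e L' P'"
    by (rule exI[of _ L], rule exI[of _ P], rule exI[of _ d], rule exI[of _ \<epsilon>]) (simp add: res)
  fix q assume "\<exists>L' (P' :: nat \<Rightarrow> ('a, nat \<Rightarrow> 'a) graded) d \<epsilon>. finite_fg_projective_resolution A M L' P' d \<epsilon> \<and>
      q = resolution_numerator K A r e L' P'"
  then obtain L' d' \<epsilon>' and P' :: "nat \<Rightarrow> ('a, nat \<Rightarrow> 'a) graded"
    where res': "finite_fg_projective_resolution A M L' P' d' \<epsilon>'" and q: "q = resolution_numerator K A r e L' P'"
    by (elim exE conjE)
  let ?p = "resolution_numerator K A r e L P"
  let ?C = "rational_hilbert_matrix K A r e"
  have dims: "?p \<in> carrier_vec r" "q \<in> carrier_vec r" by (simp_all add: q resolution_numerator_def)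
  note inv = rational_matrix_inverse[OF hilbert_matrix_carrier
      elementary_algebra.hilbert_matrix_nth_0[OF A] rational, folded rational_hilbert_matrix_def]
  have C: "?C \<in> carrier_mat r r" by (simp add: rational_hilbert_matrix_def hilbert_matrix_carrier)
  have "?C *\<^sub>v map_vec fract_of_laurent q = ?C *\<^sub>v map_vec fract_of_laurent ?p"
    unfolding q by (rule trans[OF rational_hilbert_vec[OF A M rational res', symmetric]
        rational_hilbert_vec[OF A M rational res]])
  then have "the (mat_inverse ?C) *\<^sub>v (?C *\<^sub>v map_vec fract_of_laurent q) =
      the (mat_inverse ?C) *\<^sub>v (?C *\<^sub>v map_vec fract_of_laurent ?p)" by simp
  then have eq: "map_vec fract_of_laurent q = map_vec fract_of_laurent ?p"
    using dims by (simp add: inv(3) flip: assoc_mult_mat_vec[OF inv(1) C])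
  show "q = ?p"
  proof (rule eq_vecI)
    show "dim_vec q = dim_vec ?p" using dims by simp
    fix i assume "i < dim_vec ?p"
    then have "fract_of_laurent (q $ i) = fract_of_laurent (?p $ i)"
      using arg_cong[OF eq, of "\<lambda>v. vec_index v i"] dims by simp
    then show "q $ i = ?p $ i" by (rule fract_of_laurent_inj)
  qed
qed

section \<open>Lattices of Laurent series vectors\<close>

lemma integral_vecs_iff:
  "h \<in> integral_vecs r \<longleftrightarrow> h \<in> carrier_vec r \<and> (\<forall>i<r. h $ i \<in> range fps_to_fls)"
proof
  assume h: "h \<in> carrier_vec r \<and> (\<forall>i<r. h $ i \<in> range fps_to_fls)"
  then have "h = map_vec fps_to_fls (vec r (\<lambda>i. fls_regpart (h $ i)))"
    by (intro eq_vecI) auto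
  then show "h \<in> integral_vecs r" unfolding integral_vecs_def by auto
qed (auto simp: integral_vecs_def)

lemma integral_vecs_ops:
  "0\<^sub>v r \<in> integral_vecs r"
  "g \<in> integral_vecs r \<Longrightarrow> h \<in> integral_vecs r \<Longrightarrow> g + h \<in> integral_vecs r"
  "h \<in> integral_vecs r \<Longrightarrow> fps_to_fls f \<cdot>\<^sub>v h \<in> integral_vecs r"
proof -
  show "0\<^sub>v r \<in> integral_vecs r"
    by (auto simp: integral_vecs_iff intro!: range_eqI[of _ _ 0])
  show "g + h \<in> integral_vecs r" if gh: "g \<in> integral_vecs r" "h \<in> integral_vecs r"
    unfolding integral_vecs_iff
  proof (intro conjI allI impI)
    fix i assume i: "i < r"
    obtain a b where "g $ i = fps_to_fls a" "h $ i = fps_to_fls b" using gh i unfolding integral_vecs_iff by blast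
    then have "(g + h) $ i = fps_to_fls (a + b)" using gh i unfolding integral_vecs_iff by auto
    then show "(g + h) $ i \<in> range fps_to_fls" by blast
  qed (use gh in \<open>auto simp: integral_vecs_iff\<close>)
  show "fps_to_fls f \<cdot>\<^sub>v h \<in> integral_vecs r" if h: "h \<in> integral_vecs r"
    unfolding integral_vecs_iff
  proof (intro conjI allI impI)
    fix i assume i: "i < r"
    obtain b where "h $ i = fps_to_fls b" using h i unfolding integral_vecs_iff by blast
    then have "(fps_to_fls f \<cdot>\<^sub>v h) $ i = fps_to_fls (f * b)"
      using h i unfolding integral_vecs_iff by (auto simp: fls_times_fps_to_fls)
    then show "(fps_to_fls f \<cdot>\<^sub>v h) $ i \<in> range fps_to_fls" by blast
  qed (use h in \<open>auto simp: integral_vecs_iff\<close>)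
qed

lemma map_vec_fps_to_fls_ops:
  fixes x y :: "rat fps vec"
  shows "x \<in> carrier_vec r \<Longrightarrow> y \<in> carrier_vec r \<Longrightarrow>
      map_vec fps_to_fls (x + y) = map_vec fps_to_fls x + map_vec fps_to_fls y"
    "map_vec fps_to_fls (f \<cdot>\<^sub>v x) = fps_to_fls f \<cdot>\<^sub>v map_vec fps_to_fls x"
    "map_vec fps_to_fls (0\<^sub>v r :: rat fps vec) = 0\<^sub>v r"
  by (auto intro!: eq_vecI simp: fls_times_fps_to_fls)

lemma abelian_group_module_vec:
  "abelian_group (module_vec TYPE('a::comm_ring_1) r)"
proof (rule abelian_groupI)
  fix x :: "'a vec" assume x: "x \<in> carrier (module_vec TYPE('a) r)"
  then show "\<exists>y\<in>carrier (module_vec TYPE('a) r). y \<oplus>\<^bsub>module_vec TYPE('a) r\<^esub> x = \<zero>\<^bsub>module_vec TYPE('a) r\<^esub>"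
    by (intro bexI[of _ "- x"]) (auto simp: module_vec_simps)
qed (auto simp: module_vec_simps intro: comm_add_vec)

theorem proposition5p1:
  fixes K :: "('k, 'b) ring_scheme"
    and A :: "('k, 'a) graded"
    and r :: nat
    and e :: "nat \<Rightarrow> 'a"
    and M :: "('a, 'm) graded"
  assumes "elementary_algebra K A r e"
    and "\<forall>j<r. graded_FP_infinity A (vertex_simple A e j)"
    and "\<forall>i<r. \<forall>j<r. is_rational_series (fps_to_fls (hilbert_matrix K A r e $$ (i, j)))"
    and "graded_left_module A M"
    and "perfect A M"
  shows "lambda_plus K A r e
           (pi_plus K A r e (map_vec laurent_at_1_plus_t (euler_numerator K A r e M)))
         = pole_order_1 (map_vec rational_function_of (hilbert_vec K A r e M))"
proof -
  note A = assms(1) and M = assms(4)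
  have rational: "\<And>i j. i < r \<Longrightarrow> j < r \<Longrightarrow> is_rational_series (fps_to_fls (hilbert_matrix K A r e $$ (i, j)))"
    using assms(3) by blast
  obtain L d \<epsilon> and P :: "nat \<Rightarrow> ('a, nat \<Rightarrow> 'a) graded"
    where res: "finite_fg_projective_resolution A M L P d \<epsilon>"
    using assms(5) unfolding perfect_def by (elim exE)
  let ?C = "rational_hilbert_matrix K A r e" and ?E = "euler_matrix K A r e"
  define C where "C = map_mat (expansion_at 1) ?C"
  define E where "E = map_mat (expansion_at 1) ?E"
  define q where "q = resolution_numerator K A r e L P"
  have q: "euler_numerator K A r e M = q" "q \<in> carrier_vec r"
    using euler_numerator_eq[OF A M rational res] by (simp_all add: q_def resolution_numerator_def)
  note inv = rational_matrix_inverse[OF hilbert_matrix_carrier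
      elementary_algebra.hilbert_matrix_nth_0[OF A] rational, folded rational_hilbert_matrix_def, folded euler_matrix_def]
  have C': "?C \<in> carrier_mat r r" by (simp add: rational_hilbert_matrix_def hilbert_matrix_carrier)
  have C: "C \<in> carrier_mat r r" and E: "E \<in> carrier_mat r r" using C' inv(1) by (simp_all add: C_def E_def)
  have CE: "C * E = 1\<^sub>m r" "E * C = 1\<^sub>m r"
    unfolding C_def E_def
    by (simp_all add: inv(2,3) expansion_at.mat_hom_one
        flip: expansion_at.mat_hom_mult[OF C' inv(1)] expansion_at.mat_hom_mult[OF inv(1) C'])
  define N where "N = integral_euler_lattice K A r e"
  (* As E is inverse to C, multiplication by C carries the lattice onto the integral vectors. *)
  have N: "v \<in> N \<longleftrightarrow> v \<in> carrier_vec r \<and> C *\<^sub>v map_vec fps_to_fls v \<in> integral_vecs r" for v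
  proof (cases "v \<in> carrier_vec r")
    case True
    let ?v = "map_vec fps_to_fls v"
    have vc: "?v \<in> carrier_vec r" using True by simp
    have "(\<exists>w\<in>integral_vecs r. ?v = E *\<^sub>v w) \<longleftrightarrow> C *\<^sub>v ?v \<in> integral_vecs r"
    proof
      assume "\<exists>w\<in>integral_vecs r. ?v = E *\<^sub>v w"
      then obtain w where w: "w \<in> integral_vecs r" "?v = E *\<^sub>v w" by blast
      have "w \<in> carrier_vec r" using w(1) by (simp add: integral_vecs_iff)
      then have "C *\<^sub>v ?v = w" unfolding w(2) by (simp add: CE flip: assoc_mult_mat_vec[OF C E])
      then show "C *\<^sub>v ?v \<in> integral_vecs r" using w by simp
    next
      assume "C *\<^sub>v ?v \<in> integral_vecs r"
      moreover have "?v = E *\<^sub>v (C *\<^sub>v ?v)" using vc by (simp add: CE flip: assoc_mult_mat_vec[OF E C])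
      ultimately show "\<exists>w\<in>integral_vecs r. ?v = E *\<^sub>v w" by blast
    qed
    then show ?thesis using True
      unfolding N_def integral_euler_lattice_def euler_lattice_def E_def[symmetric] by blast
  qed (auto simp: N_def integral_euler_lattice_def)
  let ?V = "module_vec TYPE(rat fps) r"
  interpret V: abelian_group ?V by (rule abelian_group_module_vec)
  have N_smult: "f \<cdot>\<^sub>v x \<in> N" if "x \<in> N" for f x
    using that integral_vecs_ops(3)[of "C *\<^sub>v map_vec fps_to_fls x" r f]
    by (simp add: N map_vec_fps_to_fls_ops mult_mat_vec[OF C])
  have N_add: "x + y \<in> N" if "x \<in> N" "y \<in> N" for x y
    using that integral_vecs_ops(2)[of "C *\<^sub>v map_vec fps_to_fls x" r "C *\<^sub>v map_vec fps_to_fls y"]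
    by (simp add: N map_vec_fps_to_fls_ops(1)[of _ r] mult_add_distrib_mat_vec[OF C])
  have N_zero: "0\<^sub>v r \<in> N"
  proof -
    have "C *\<^sub>v 0\<^sub>v r = 0\<^sub>v r" using C by (intro eq_vecI) auto
    then show ?thesis using integral_vecs_ops(1) by (simp add: N map_vec_fps_to_fls_ops)
  qed
  have N_sub: "additive_subgroup N ?V"
  proof (intro additive_subgroup.intro group.subgroupI V.a_group)
    show "N \<subseteq> carrier (add_monoid ?V)" using N by (auto simp: module_vec_simps)
    show "N \<noteq> {}" using N_zero by blast
    show "x \<otimes>\<^bsub>add_monoid ?V\<^esub> y \<in> N" if "x \<in> N" "y \<in> N" for x y
      using N_add[OF that] by (simp add: module_vec_simps)
    show "inv\<^bsub>add_monoid ?V\<^esub> x \<in> N" if x: "x \<in> N" for x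
    proof -
      have "\<ominus>\<^bsub>?V\<^esub> x = (- 1) \<cdot>\<^sub>v x"
        by (rule V.minus_equality) (use x in \<open>auto simp: N module_vec_simps\<close>)
      then show ?thesis using N_smult[OF x, of "- 1"] by (simp add: a_inv_def)
    qed
  qed
  interpret N: abelian_subgroup N ?V by (rule abelian_subgroupI3[OF N_sub V.abelian_group_axioms])
  define v where "v = map_vec laurent_at_1_plus_t q"
  have v: "v \<in> carrier_vec r" using q(2) by (simp add: v_def)
  define h where "h = map_vec (expansion_at 1) (map_vec rational_function_of (hilbert_vec K A r e M))"
  have dh: "dim_vec h = r" by (simp add: h_def hilbert_vec_def)
  have h: "C *\<^sub>v map_vec fps_to_fls v = h"
  proof -
    have "map_vec fps_to_fls v = map_vec (expansion_at 1) (map_vec fract_of_laurent q)"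
      by (intro eq_vecI) (simp_all add: v_def expansion_at_1_fract_of_laurent)
    then have "C *\<^sub>v map_vec fps_to_fls v = map_vec (expansion_at 1) (?C *\<^sub>v map_vec fract_of_laurent q)"
      unfolding C_def using expansion_at.mult_mat_vec_hom[OF C', of "map_vec fract_of_laurent q"] q(2) by simp
    also have "\<dots> = h"
      unfolding h_def q_def
      by (rule arg_cong[of _ _ "map_vec (expansion_at 1)", OF rational_hilbert_vec[OF A M rational res, symmetric]])
    finally show ?thesis .
  qed
  (* The two LEAST operators range over the same set of exponents. *)
  have "(fps_X ^ d) \<odot>\<^bsub>G_plus K A r e\<^esub> (pi_plus K A r e v) = \<zero>\<^bsub>G_plus K A r e\<^esub> \<longleftrightarrow>
      fls_X ^ d \<cdot>\<^sub>v h \<in> integral_vecs r" for d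
  proof -
    let ?w = "fps_X ^ d \<cdot>\<^sub>v v"
    have w: "?w \<in> carrier_vec r" using v by simp
    have "(fps_X ^ d) \<odot>\<^bsub>G_plus K A r e\<^esub> (pi_plus K A r e v) = N +>\<^bsub>?V\<^esub> ?w"
      using quotient_smult_coset[OF V.abelian_group_axioms N_sub, of "fps_X ^ d" v] v N_smult
      by (simp add: G_plus_def pi_plus_def quotient_module_def N_def[symmetric] module_vec_simps
          smult_add_distrib_vec[of _ r])
    moreover have "\<zero>\<^bsub>G_plus K A r e\<^esub> = N" by (simp add: G_plus_def quotient_module_def N_def)
    moreover have "N +>\<^bsub>?V\<^esub> ?w = N \<longleftrightarrow> ?w \<in> N"
      using N.a_rcos_const[of ?w] N.a_rcos_self[of ?w] w by (auto simp: module_vec_simps)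
    moreover have "?w \<in> N \<longleftrightarrow> fps_to_fls (fps_X ^ d) \<cdot>\<^sub>v h \<in> integral_vecs r"
      using w v by (simp only: N map_vec_fps_to_fls_ops mult_mat_vec[OF C] h map_carrier_vec simp_thms)
    moreover have "fps_to_fls (fps_X ^ d :: rat fps) = fls_X ^ d" by (simp add: fps_to_fls_power)
    ultimately show ?thesis by simp
  qed
  then have "lambda_plus K A r e (pi_plus K A r e v) = pole_order h"
    by (simp add: lambda_plus_def pole_order_def dh)
  then show ?thesis by (simp add: q(1) v_def h_def pole_order_1_def)
qed

end
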